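(* Let $\mathcal{A}\in\{0,1\}^{n\times n}$ be the zero-nonzero pattern of a structurally full-rank system matrix $A$, and let the system digraph have exactly $m$ parent SCCs, $SCC_1,\dots,SCC_m$. Suppose there are $m$ sensors $y_1,\dots,y_m$, each measuring exactly one state, and positive sensing costs $c_{ij}$ ($1\le i\le m$, $1\le j\le n$) for sensor $y_i$ measuring state $x_j$. Consider the sensing cost optimization problem $$\min_{\mathcal{H}\in\{0,1\}^{m\times n}}\ \sum_{i=1}^m\sum_{j=1}^n c_{ij}\mathcal{H}_{ij}\quad\text{s.t. } (A,H)\text{ is structurally observable},\quad \sum_{i=1}^m\mathcal{H}_{ij}\le 1\ \ (1\le j\le n),\quad \sum_{j=1}^n\mathcal{H}_{ij}=1\ \ (1\le i\le m),$$ where $\mathcal{H}$ is the zero-nonzero pattern of $H$. Define $\mathcal{C}\in\mathbb{R}^{m\times m}$ by $\mathcal{C}_{ij}=\min\{c_{il} : x_l\in SCC_j\}$. Then this problem is equivalent to the linear sum assignment problem $$\min_{\mathcal{Z}\in\{0,1\}^{m\times m}}\ \sum_{i=1}^m\sum_{j=1}^m\mathcal{C}_{ij}\mathcal{Z}_{ij}\quad\text{s.t. }\sum_{j=1}^m\mathcal{Z}_{ij}=1\ \ (1\le i\le m),\quad \sum_{i=1}^m\mathcal{Z}_{ij}=1\ \ (1\le j\le m),$$ in the sense that the two optimal values coincide, and from an optimal $\mathcal{Z}$ one obtains an optimal $\mathcal{H}$ by letting, whenever $\mathcal{Z}_{ij}=1$, sensor $y_i$ measure a state of $SCC_j$ attaining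 the minimum defining $\mathcal{C}_{ij}$. Consequently, the sensing cost optimization problem for structurally full-rank systems has an exact polynomial-order solution (obtained by applying the Hungarian method to the assignment problem) with complexity $\mathcal{O}(m^3)$.
   Context: The system is the linear time-invariant system $\mathbf{x}_{k+1}=A\mathbf{x}_k+\mathbf{v}_k$ with states $x_1,\dots,x_n$ and measurements $y^i_k=H_i\mathbf{x}_k+r^i_k$, $i=1,\dots,m$, where $H_i$ is the $i$-th row of $H\in\mathbb{R}^{m\times n}$ and $\mathbf{v},r$ are noise. $\mathcal{A}$ and $\mathcal{H}$ are the zero-nonzero patterns (0-1 matrices) of $A$ and $H$; $\mathcal{H}_{ij}=1$ means sensor $y_i$ measures state $x_j$. $\mathcal{Z}_{ij}=1$ means that sensor $y_i$ is assigned to measure a state in $SCC_j$. Structural observability: $(A,H)$ is structurally observable if $(A',H')$ is observable for almost all (equivalently, for some) real matrices $A',H'$ whose entries vanish wherever the entries of $\mathcal{A},\mathcal{H}$ vanish. System digraph: nodes $x_1,\dots,x_n$, with an edge $x_j\to x_i$ if and only if $\mathcal{A}_{ij}\neq 0$ (and edges $x_j\to y_i$ to output nodes if and only if $\mathcal{H}_{ij}\ne 0$). The system is structurally full rank (equivalently, structurally cyclic) if there is a family of pairwise disjoint cycles (self-loops allowed) in the digraph on the state nodes that spans all state nodes; equivalently, almost all matrices with pattern $\mathcal{A}$ are invertible. An SCC is a strongly connected component of the digraph on the state nodes. A parent SCC is an SCC with no outgoing edge to a state in another SCC. The number of sensors is assumed to be the minimum number needed for structural observability, which for structurally full-rank systems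 equals the number $m$ of parent SCCs.
   Formalization: The O(m^3) bound counts solving the assignment problem and placing the sensors once the matrix C and its minimizing states are given; computing these from A and the costs c is shown polynomial in n, since reading n costs cannot be O(m^3) in general (e.g. m=1). *)

theory Defs
  imports
    "Jordan_Normal_Form.Matrix"
    "Graph_Theory.Graph_Theory"
    "HOL-Library.Landau_Symbols"
begin

text \<open>States, sensors and parent components are numbered from 0.  A zero-nonzero pattern is a
  real matrix with entries 0 and 1.\<close>

definition binary_mat :: "nat \<Rightarrow> nat \<Rightarrow> real mat set" where
  "binary_mat r k = {M \<in> carrier_mat r k. \<forall>i<r. \<forall>j<k. M $$ (i, j) \<in> {0, 1}}"


section \<open>Structural observability\<close>

definition outputs :: "real mat \<Rightarrow> real mat \<Rightarrow> real vec \<Rightarrow> nat \<Rightarrow> real vec" where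
  "outputs A H x k = H *\<^sub>v ((A ^\<^sub>m k) *\<^sub>v x)"

definition observable :: "real mat \<Rightarrow> real mat \<Rightarrow> bool" where
  "observable A H \<longleftrightarrow>
     (\<forall>x \<in> carrier_vec (dim_row A). \<forall>x' \<in> carrier_vec (dim_row A).
        (\<forall>k. outputs A H x k = outputs A H x' k) \<longrightarrow> x = x')"

definition realizes :: "real mat \<Rightarrow> real mat \<Rightarrow> bool" where
  "realizes M P \<longleftrightarrow> M \<in> carrier_mat (dim_row P) (dim_col P) \<and>
     (\<forall>i<dim_row P. \<forall>j<dim_col P. P $$ (i, j) = 0 \<longrightarrow> M $$ (i, j) = 0)"

text \<open>Only the zeros of the two arguments matter, so this applies to a pair of matrices as well as
  to the pair of their patterns.\<close>

definition structurally_observable :: "real mat \<Rightarrow> real mat \<Rightarrow> bool" where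
  "structurally_observable A H \<longleftrightarrow>
     (\<exists>A' H'. realizes A' A \<and> realizes H' H \<and> observable A' H')"


section \<open>The system digraph\<close>

text \<open>The edge \<open>x\<^sub>j \<rightarrow> x\<^sub>i\<close> is present iff the entry \<open>(i, j)\<close> (row \<open>i\<close>, column \<open>j\<close>) is nonzero.\<close>

definition state_digraph :: "real mat \<Rightarrow> (nat, nat \<times> nat) pre_digraph" where
  "state_digraph A =
     \<lparr> verts = {..<dim_row A},
       arcs = {(j, i). j < dim_row A \<and> i < dim_row A \<and> A $$ (i, j) \<noteq> 0},
       tail = fst, head = snd \<rparr>"

text \<open>The vertices on a cycle, given as a list of arcs, are the tails of its arcs.\<close>

definition structurally_full_rank :: "real mat \<Rightarrow> bool" where
  "structurally_full_rank A \<longleftrightarrow>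
     (\<exists>F. (\<forall>p \<in> F. pre_digraph.cycle (state_digraph A) p) \<and>
          (\<forall>p \<in> F. \<forall>q \<in> F. p \<noteq> q \<longrightarrow> fst ` set p \<inter> fst ` set q = {}) \<and>
          (\<Union>p \<in> F. fst ` set p) = verts (state_digraph A))"

definition parent_sccs :: "real mat \<Rightarrow> nat set set" where
  "parent_sccs A =
     {S \<in> pre_digraph.sccs_verts (state_digraph A).
        \<not> (\<exists>S' \<in> pre_digraph.sccs_verts (state_digraph A).
              S' \<noteq> S \<and> (\<exists>u \<in> S. \<exists>v \<in> S'. (u, v) \<in> arcs (state_digraph A)))}"


section \<open>The two optimization problems\<close>

definition total_cost :: "real mat \<Rightarrow> real mat \<Rightarrow> real" where
  "total_cost c X = (\<Sum>i<dim_row c. \<Sum>j<dim_col c. c $$ (i, j) * X $$ (i, j))"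

definition sensing_feasible :: "nat \<Rightarrow> nat \<Rightarrow> real mat \<Rightarrow> real mat \<Rightarrow> bool" where
  "sensing_feasible m n A H \<longleftrightarrow>
     H \<in> binary_mat m n \<and> structurally_observable A H \<and>
     (\<forall>j<n. (\<Sum>i<m. H $$ (i, j)) \<le> 1) \<and> (\<forall>i<m. (\<Sum>j<n. H $$ (i, j)) = 1)"

definition assignment_feasible :: "nat \<Rightarrow> real mat \<Rightarrow> bool" where
  "assignment_feasible m Z \<longleftrightarrow>
     Z \<in> binary_mat m m \<and>
     (\<forall>i<m. (\<Sum>j<m. Z $$ (i, j)) = 1) \<and> (\<forall>j<m. (\<Sum>i<m. Z $$ (i, j)) = 1)"

definition optimal_sensing :: "nat \<Rightarrow> nat \<Rightarrow> real mat \<Rightarrow> real mat \<Rightarrow> real mat \<Rightarrow> bool" where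
  "optimal_sensing m n A c H \<longleftrightarrow> is_arg_min (total_cost c) (sensing_feasible m n A) H"

definition optimal_assignment :: "nat \<Rightarrow> real mat \<Rightarrow> real mat \<Rightarrow> bool" where
  "optimal_assignment m C Z \<longleftrightarrow> is_arg_min (total_cost C) (assignment_feasible m) Z"

text \<open>\<open>scc j\<close> is the \<open>j\<close>-th parent component.\<close>

definition sensing_instance ::
    "nat \<Rightarrow> nat \<Rightarrow> real mat \<Rightarrow> real mat \<Rightarrow> (nat \<Rightarrow> nat set) \<Rightarrow> bool" where
  "sensing_instance m n A c scc \<longleftrightarrow>
     A \<in> binary_mat n n \<and> structurally_full_rank A \<and>
     bij_betw scc {..<m} (parent_sccs A) \<and>
     c \<in> carrier_mat m n \<and> (\<forall>i<m. \<forall>l<n. 0 < c $$ (i, l))"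

definition scc_cost :: "nat \<Rightarrow> real mat \<Rightarrow> (nat \<Rightarrow> nat set) \<Rightarrow> real mat" where
  "scc_cost m c scc = mat m m (\<lambda>(i, j). Min ((\<lambda>l. c $$ (i, l)) ` scc j))"

definition induced_sensing ::
    "nat \<Rightarrow> nat \<Rightarrow> real mat \<Rightarrow> (nat \<Rightarrow> nat set) \<Rightarrow> real mat \<Rightarrow> real mat \<Rightarrow> bool" where
  "induced_sensing m n c scc Z H \<longleftrightarrow>
     H \<in> binary_mat m n \<and> (\<forall>i<m. (\<Sum>l<n. H $$ (i, l)) = 1) \<and>
     (\<forall>i<m. \<forall>j<m. Z $$ (i, j) = 1 \<longrightarrow>
        (\<exists>l \<in> scc j. c $$ (i, l) = scc_cost m c scc $$ (i, j) \<and> H $$ (i, l) = 1))"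


section \<open>A real RAM\<close>

text \<open>Running time is measured on a random access machine with named two-dimensional arrays of
  natural numbers and of real numbers; a scalar is the entry \<open>(0, 0)\<close> of an array.  Every memory
  access, arithmetic operation and comparison has unit cost.  The only operations are addition,
  subtraction and comparison, and the only constants are integers, so unit cost
  cannot hide superpolynomial work.  Subtraction of naturals is truncated.\<close>

record state =
  nats :: "string \<Rightarrow> nat \<Rightarrow> nat \<Rightarrow> nat"
  reals :: "string \<Rightarrow> nat \<Rightarrow> nat \<Rightarrow> real"

datatype nexp =
    NConst nat
  | NGet string nexp nexp
  | NPlus nexp nexp
  | NMinus nexp nexp

datatype rexp =
    RConst int
  | RGet string nexp nexp
  | RPlus rexp rexp
  | RMinus rexp rexp

datatype bexp =
    NLess nexp nexp
  | RLess rexp rexp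
  | Not bexp
  | And bexp bexp

datatype com =
    Skip
  | NSet string nexp nexp nexp
  | RSet string nexp nexp rexp
  | Seq com com
  | If bexp com com
  | While bexp com

primrec nval :: "nexp \<Rightarrow> state \<Rightarrow> nat" where
  "nval (NConst k) s = k"
| "nval (NGet x a b) s = nats s x (nval a s) (nval b s)"
| "nval (NPlus a b) s = nval a s + nval b s"
| "nval (NMinus a b) s = nval a s - nval b s"

primrec rval :: "rexp \<Rightarrow> state \<Rightarrow> real" where
  "rval (RConst k) s = of_int k"
| "rval (RGet x a b) s = reals s x (nval a s) (nval b s)"
| "rval (RPlus a b) s = rval a s + rval b s"
| "rval (RMinus a b) s = rval a s - rval b s"

primrec bval :: "bexp \<Rightarrow> state \<Rightarrow> bool" where
  "bval (NLess a b) s \<longleftrightarrow> nval a s < nval b s"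
| "bval (RLess a b) s \<longleftrightarrow> rval a s < rval b s"
| "bval (Not p) s \<longleftrightarrow> \<not> bval p s"
| "bval (And p q) s \<longleftrightarrow> bval p s \<and> bval q s"

primrec ntime :: "nexp \<Rightarrow> nat" where
  "ntime (NConst k) = 1"
| "ntime (NGet x a b) = 1 + ntime a + ntime b"
| "ntime (NPlus a b) = 1 + ntime a + ntime b"
| "ntime (NMinus a b) = 1 + ntime a + ntime b"

primrec rtime :: "rexp \<Rightarrow> nat" where
  "rtime (RConst k) = 1"
| "rtime (RGet x a b) = 1 + ntime a + ntime b"
| "rtime (RPlus a b) = 1 + rtime a + rtime b"
| "rtime (RMinus a b) = 1 + rtime a + rtime b"

primrec btime :: "bexp \<Rightarrow> nat" where
  "btime (NLess a b) = 1 + ntime a + ntime b"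
| "btime (RLess a b) = 1 + rtime a + rtime b"
| "btime (Not p) = 1 + btime p"
| "btime (And p q) = 1 + btime p + btime q"

definition nat_update :: "string \<Rightarrow> nat \<Rightarrow> nat \<Rightarrow> nat \<Rightarrow> state \<Rightarrow> state" where
  "nat_update x i j v s = s\<lparr>nats := (nats s)(x := (nats s x)(i := (nats s x i)(j := v)))\<rparr>"

definition real_update :: "string \<Rightarrow> nat \<Rightarrow> nat \<Rightarrow> real \<Rightarrow> state \<Rightarrow> state" where
  "real_update x i j v s = s\<lparr>reals := (reals s)(x := (reals s x)(i := (reals s x i)(j := v)))\<rparr>"

text \<open>\<open>exec p s t s'\<close>: the program \<open>p\<close>, started in \<open>s\<close>, halts in \<open>s'\<close> after \<open>t\<close> steps.\<close>

inductive exec :: "com \<Rightarrow> state \<Rightarrow> nat \<Rightarrow> state \<Rightarrow> bool" where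
  Skip: "exec Skip s 1 s"
| NSet: "exec (NSet x a b e) s (1 + ntime a + ntime b + ntime e)
           (nat_update x (nval a s) (nval b s) (nval e s) s)"
| RSet: "exec (RSet x a b e) s (1 + ntime a + ntime b + rtime e)
           (real_update x (nval a s) (nval b s) (rval e s) s)"
| Seq: "exec p s t s' \<Longrightarrow> exec q s' t' s'' \<Longrightarrow> exec (Seq p q) s (t + t') s''"
| IfTrue: "bval b s \<Longrightarrow> exec p s t s' \<Longrightarrow> exec (If b p q) s (btime b + t) s'"
| IfFalse: "\<not> bval b s \<Longrightarrow> exec q s t s' \<Longrightarrow> exec (If b p q) s (btime b + t) s'"
| WhileFalse: "\<not> bval b s \<Longrightarrow> exec (While b p) s (btime b) s"
| WhileTrue: "bval b s \<Longrightarrow> exec p s t s' \<Longrightarrow> exec (While b p) s' t' s'' \<Longrightarrow>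
    exec (While b p) s (btime b + t + t') s''"


section \<open>Representation of the problems in memory\<close>

text \<open>Memory outside the listed entries is unconstrained, so a program cannot rely on it.\<close>

definition stores_sensing :: "nat \<Rightarrow> nat \<Rightarrow> real mat \<Rightarrow> real mat \<Rightarrow> state \<Rightarrow> bool" where
  "stores_sensing m n A c s \<longleftrightarrow>
     nats s ''m'' 0 0 = m \<and> nats s ''n'' 0 0 = n \<and>
     (\<forall>i<n. \<forall>j<n. nats s ''A'' i j = (if A $$ (i, j) = 0 then 0 else 1)) \<and>
     (\<forall>i<m. \<forall>l<n. reals s ''c'' i l = c $$ (i, l))"

text \<open>The assignment problem is stored together with, for each of its costs, a state at which the
  minimum defining that cost is attained.\<close>

definition stores_assignment ::
    "nat \<Rightarrow> real mat \<Rightarrow> (nat \<Rightarrow> nat set) \<Rightarrow> state \<Rightarrow> bool" where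
  "stores_assignment m c scc s \<longleftrightarrow>
     nats s ''m'' 0 0 = m \<and>
     (\<forall>i<m. \<forall>j<m.
        reals s ''C'' i j = scc_cost m c scc $$ (i, j) \<and>
        nats s ''L'' i j \<in> scc j \<and>
        c $$ (i, nats s ''L'' i j) = scc_cost m c scc $$ (i, j))"

definition stored_assignment :: "nat \<Rightarrow> state \<Rightarrow> real mat" where
  "stored_assignment m s = mat m m (\<lambda>(i, j). if j = nats s ''z'' i 0 then 1 else 0)"

definition stored_placement :: "nat \<Rightarrow> nat \<Rightarrow> state \<Rightarrow> real mat" where
  "stored_placement m n s = mat m n (\<lambda>(i, l). if l = nats s ''h'' i 0 then 1 else 0)"

end

(*
  Observability: a spanning family of disjoint cycles is a permutation of the states.  Give every cycle its own
  weight, and let each cycle without a measured state feed one cycle of smaller weight on the way to a measured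
  state.  Let z be a trajectory with zero output, r the largest weight of a cycle on which it lives, and pi^K = id.
  The top cycle has no input, so the zero-output trajectory z(t + K) - r^K z(t) lives on smaller weights and vanishes
  by induction.  Thus z is geometric with ratio r^K.  Without input, a cycle of weight s < r only sustains the ratio
  s^K, so such a z can live below the top cycle only as a response to the input from there, and a response that is
  invisible in the output forces this input to vanish.

  Hence m sensors suffice exactly if they pick one state in each of the m parent components, which makes a placement
  a permutation together with a choice of states; the choice is optimal for each sensor separately.

  Complexity: the Hungarian method with slacks maintained along the alternating tree, where feasible dual prices that
  are tight on a perfect matching certify optimality; Warshall's transitive closure finds the parent components.
*)
theory Submission
  imports Defs "HOL-Combinatorics.Cycles"
begin

section \<open>Structural observability of structurally full-rank systems\<close>

text \<open>\<open>rk u\<close> is the weight of the arc from \<open>u\<close> to \<open>\<pi> u\<close>, the same along each cycle of \<open>\<pi>\<close>; \<open>X w i\<close> is an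
  additional arc of weight 1 by which a cycle feeds one of smaller weight.\<close>

locale cycle_forest =
  fixes n :: nat and \<pi> :: "nat \<Rightarrow> nat" and rk :: "nat \<Rightarrow> nat" and X :: "nat \<Rightarrow> nat \<Rightarrow> bool" and M :: "nat set" and K :: nat
  assumes perm: "\<pi> permutes {..<n}"
    and K: "0 < K" "\<pi> ^^ K = id"
    and rk_pi: "u < n \<Longrightarrow> rk (\<pi> u) = rk u"
    and rk_pos: "u < n \<Longrightarrow> 0 < rk u"
    and rk_orbit: "u < n \<Longrightarrow> w < n \<Longrightarrow> rk u = rk w \<Longrightarrow> \<exists>a. w = (\<pi> ^^ a) u"
    and X_less: "X w i \<Longrightarrow> w < n \<and> i < n \<and> rk i < rk w"
    and X_unique: "X w i \<Longrightarrow> X w' i' \<Longrightarrow> rk w = rk w' \<Longrightarrow> w = w' \<and> i = i'"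
    and exit: "u < n \<Longrightarrow> (\<exists>w\<in>M. w < n \<and> rk w = rk u) \<or> (\<exists>w i. X w i \<and> rk w = rk u)"
begin

definition trajectory :: "(nat \<Rightarrow> nat \<Rightarrow> real) \<Rightarrow> nat \<Rightarrow> (nat \<Rightarrow> real) \<Rightarrow> bool" where
  "trajectory z v f \<longleftrightarrow> (\<forall>t. \<forall>u<n. z (Suc t) (\<pi> u) =
     real (rk u) * z t u + (\<Sum>w | w < n \<and> X w (\<pi> u). z t w) + (if \<pi> u = v then f t else 0))"

definition bounded_rank :: "nat \<Rightarrow> (nat \<Rightarrow> nat \<Rightarrow> real) \<Rightarrow> bool" where
  "bounded_rank r z \<longleftrightarrow> (\<forall>t. \<forall>u<n. r < rk u \<longrightarrow> z t u = 0)"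

definition geometric :: "nat \<Rightarrow> (nat \<Rightarrow> nat \<Rightarrow> real) \<Rightarrow> bool" where
  "geometric \<rho> z \<longleftrightarrow> (\<forall>t. \<forall>u<n. z (t + K) u = real \<rho> ^ K * z t u)"

lemma pi_less [simp]: "\<pi> u < n \<longleftrightarrow> u < n"
  using permutes_in_image[OF perm, of u] by simp

lemma pi_pow_less [simp]: "(\<pi> ^^ a) u < n \<longleftrightarrow> u < n"
  by (induction a) auto

lemma rk_pow: "u < n \<Longrightarrow> rk ((\<pi> ^^ a) u) = rk u"
  by (induction a) (auto simp: rk_pi)

lemma pi_eq: "\<pi> u = \<pi> w \<longleftrightarrow> u = w"
  using permutes_inj[OF perm] by (auto simp: inj_def)

lemma top_cycle:
  assumes "trajectory z v f" "bounded_rank r z" "u < n" "rk u = r"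
  shows "z (Suc t) (\<pi> u) = real r * z t u + (if \<pi> u = v then f t else 0)"
proof -
  have "(\<Sum>w | w < n \<and> X w (\<pi> u). z t w) = 0"
    using assms X_less rk_pi[OF assms(3)] by (intro sum.neutral) (force simp: bounded_rank_def)
  then show ?thesis using assms by (simp add: trajectory_def)
qed

lemma free_cycle_pow:
  assumes T: "trajectory z v f" "bounded_rank r z" and u: "u < n" "rk u = r" and f: "rk v \<noteq> r \<or> f = (\<lambda>t. 0)"
  shows "z (t + a) ((\<pi> ^^ a) u) = real r ^ a * z t u"
proof (induction a)
  case (Suc a)
  have "\<pi> ((\<pi> ^^ a) u) \<noteq> v \<or> f = (\<lambda>t. 0)" using f u rk_pi rk_pow by auto
  then show ?case
    using top_cycle[OF T, of "(\<pi> ^^ a) u" "t + a"] u Suc by (auto simp: rk_pow)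
qed simp

lemma free_cycle_zero:
  assumes T: "trajectory z v f" "bounded_rank r z" and f: "rk v \<noteq> r \<or> f = (\<lambda>t. 0)"
    and m: "m < n" "rk m = r" "\<And>t. z t m = 0" and u: "u < n" "rk u = r"
  shows "z t u = 0"
proof -
  obtain a where "m = (\<pi> ^^ a) u" using rk_orbit u m by metis
  then have "real r ^ a * z t u = 0" using free_cycle_pow[OF T u f, of t a] m by simp
  then show ?thesis using rk_pos[OF u(1)] u(2) by simp
qed

lemma forced_cycle_zero:
  assumes T: "trajectory z v f" "bounded_rank r z" and G: "geometric \<rho> z" "0 < \<rho>"
    and v: "v < n" "rk v = r" and m: "m < n" "rk m = r" "\<And>t. z t m = 0"
  shows "f t = 0"
proof -
  define Z where "Z = {u. u < n \<and> rk u = r \<and> (\<forall>t. z t u = 0)}"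
  have fwd: "\<pi> u \<in> Z" if "u \<in> Z" "\<pi> u \<noteq> v" for u
  proof -
    have u: "u < n" "rk u = r" "\<And>t. z t u = 0" using that by (auto simp: Z_def)
    have "z (Suc t) (\<pi> u) = 0" for t using top_cycle[OF T u(1,2)] that u(3) by simp
    then have "z (t + K) (\<pi> u) = 0" for t using K(1) by (metis add_Suc_right gr0_implies_Suc)
    then have "z t (\<pi> u) = 0" for t using G u(1) unfolding geometric_def by (metis mult_eq_0_iff of_nat_0_eq_iff less_irrefl pi_less power_not_zero)
    then show ?thesis using u rk_pi by (auto simp: Z_def)
  qed
  have bwd: "u \<in> Z" if "\<pi> u \<in> Z" "\<pi> u \<noteq> v" for u
  proof -
    have u: "u < n" "rk u = r" "\<And>t. z t (\<pi> u) = 0" using that rk_pi by (auto simp: Z_def)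
    then have "real r * z t u = 0" for t using top_cycle[OF T u(1,2), of t] that by simp
    then show ?thesis using u rk_pos[of u] by (auto simp: Z_def)
  qed
  have mZ: "m \<in> Z" using m by (simp add: Z_def)
  have "v \<in> Z"
  proof -
    obtain a where "m = (\<pi> ^^ a) v" using rk_orbit v m by metis
    with mZ have "(\<pi> ^^ a) v \<in> Z" by simp
    then show ?thesis
    proof (induction a)
      case (Suc a)
      then show ?case using bwd[of "(\<pi> ^^ a) v"] by (cases "\<pi> ((\<pi> ^^ a) v) = v") auto
    qed simp
  qed
  obtain p where p: "\<pi> p = v" using permutes_surj[OF perm] by (metis surjD)
  have pn: "p < n" "rk p = r" using p v rk_pi pi_less by metis+
  have "p \<in> Z"
  proof -
    obtain a where a: "p = (\<pi> ^^ a) m" using rk_orbit pn m by metis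
    have "(\<pi> ^^ b) m \<in> Z \<or> p \<in> Z" for b
    proof (induction b)
      case (Suc b)
      then show ?case using fwd[of "(\<pi> ^^ b) m"] p pi_eq by (cases "\<pi> ((\<pi> ^^ b) m) = v") auto
    qed (simp add: mZ)
    then show ?thesis using a by blast
  qed
  then show ?thesis
    using top_cycle[OF T pn, of t] p \<open>v \<in> Z\<close> by (simp add: Z_def)
qed

lemma cut_top_cycle:
  assumes T: "trajectory z v f" "bounded_rank r z" and f: "rk v = r \<or> f = (\<lambda>t. 0)" and X: "X w i" "rk w = r"
  shows "trajectory (\<lambda>t u. if rk u < r then z t u else 0) i (\<lambda>t. z t w)"
  unfolding trajectory_def
proof (intro allI impI)
  fix t u assume u: "u < n"
  let ?z = "\<lambda>t u. if rk u < r then z t u else 0"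
  have i: "rk i < r" "w < n" using X_less[OF X(1)] X(2) by auto
  show "?z (Suc t) (\<pi> u) = real (rk u) * ?z t u + (\<Sum>w | w < n \<and> X w (\<pi> u). ?z t w) + (if \<pi> u = i then z t w else 0)"
  proof (cases "rk u < r")
    case False
    then have "(\<Sum>w | w < n \<and> X w (\<pi> u). ?z t w) = 0"
      using X_less rk_pi[OF u] by (intro sum.neutral) force
    then show ?thesis using False i rk_pi[OF u] by auto
  next
    case True
    have "(\<Sum>w | w < n \<and> X w (\<pi> u). z t w) = (\<Sum>w' | w' < n \<and> X w' (\<pi> u). ?z t w' + (if w' = w then z t w else 0))"
    proof (intro sum.cong refl)
      fix w' assume "w' \<in> {w'. w' < n \<and> X w' (\<pi> u)}"
      then have w': "w' < n" "X w' (\<pi> u)" by auto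
      have "w' = w" if "rk w' = r" using X_unique[OF w'(2) X(1)] that X by simp
      moreover have "z t w' = 0" if "r < rk w'" using T(2) w'(1) that by (simp add: bounded_rank_def)
      ultimately show "z t w' = ?z t w' + (if w' = w then z t w else 0)"
        using X(2) by (cases "rk w'" r rule: linorder_cases) auto
    qed
    also have "\<dots> = (\<Sum>w | w < n \<and> X w (\<pi> u). ?z t w) + (if X w (\<pi> u) then z t w else 0)"
      using i by (simp add: sum.distrib)
    also have "X w (\<pi> u) \<longleftrightarrow> \<pi> u = i" using X X_unique by blast
    finally have S: "(\<Sum>w | w < n \<and> X w (\<pi> u). z t w) =
      (\<Sum>w | w < n \<and> X w (\<pi> u). ?z t w) + (if \<pi> u = i then z t w else 0)" .
    have "(if \<pi> u = v then f t else 0) = 0" using f True rk_pi[OF u] by auto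
    moreover have "z (Suc t) (\<pi> u) = real (rk u) * z t u + (\<Sum>w | w < n \<and> X w (\<pi> u). z t w) + (if \<pi> u = v then f t else 0)"
      using T(1) u unfolding trajectory_def by blast
    ultimately show ?thesis
      using True rk_pi[OF u] unfolding S by simp
  qed
qed

lemma bounded_rank_pred:
  "bounded_rank (Suc r) z \<Longrightarrow> (\<And>t u. u < n \<Longrightarrow> rk u = Suc r \<Longrightarrow> z t u = 0) \<Longrightarrow> bounded_rank r z"
  unfolding bounded_rank_def by (metis Suc_lessI)

lemma forced_zero:
  assumes "trajectory z v f" "bounded_rank r z" "v < n" "rk v \<le> r" "r < \<rho>" "geometric \<rho> z"
    and "\<And>t m. m \<in> M \<Longrightarrow> m < n \<Longrightarrow> z t m = 0"
  shows "f t = 0"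
  using assms
proof (induction r arbitrary: z v f t)
  case 0
  then show ?case using rk_pos[of v] by simp
next
  case (Suc r)
  show ?case
  proof (cases "rk v = Suc r")
    case False
    have "z t u = 0" if u: "u < n" "rk u = Suc r" for t u
    proof -
      have "z (t + K) u = real (Suc r) ^ K * z t u"
        using free_cycle_pow[OF Suc.prems(1,2) u, of t K] False K by simp
      moreover have "z (t + K) u = real \<rho> ^ K * z t u" using Suc.prems(6) u by (simp add: geometric_def)
      moreover have "real (Suc r) ^ K < real \<rho> ^ K"
        using Suc.prems(5) K(1) by (intro power_strict_mono) auto
      ultimately show ?thesis by (metis less_irrefl mult_cancel_right)
    qed
    with Suc.prems(2) have "bounded_rank r z" by (rule bounded_rank_pred)
    then show ?thesis using Suc.IH[OF Suc.prems(1)] Suc.prems False by simp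
  next
    case True
    have "\<exists>m<n. rk m = Suc r \<and> (\<forall>t. z t m = 0)"
      using exit[OF Suc.prems(3)]
    proof
      assume "\<exists>w\<in>M. w < n \<and> rk w = rk v"
      then show ?thesis using Suc.prems(7) True by metis
    next
      assume "\<exists>w i. X w i \<and> rk w = rk v"
      then obtain w i where X: "X w i" "rk w = Suc r" using True by auto
      let ?z = "\<lambda>t u. if rk u < Suc r then z t u else 0"
      have "trajectory ?z i (\<lambda>t. z t w)" using cut_top_cycle[OF Suc.prems(1,2) _ X] True by simp
      moreover have "bounded_rank r ?z" by (simp add: bounded_rank_def)
      moreover have "geometric \<rho> ?z" using Suc.prems(6) by (simp add: geometric_def)
      ultimately have "z t w = 0" for t
        using Suc.IH[of ?z i "\<lambda>t. z t w"] X_less[OF X(1)] X(2) Suc.prems(5,7) by simp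
      then show ?thesis using X X_less by metis
    qed
    then show ?thesis using forced_cycle_zero[OF Suc.prems(1,2,6)] Suc.prems(3,5) True by auto
  qed
qed

lemma unforced_zero:
  assumes "trajectory z v (\<lambda>t. 0)" "bounded_rank r z" "\<And>t m. m \<in> M \<Longrightarrow> m < n \<Longrightarrow> z t m = 0" "u < n"
  shows "z t u = 0"
  using assms
proof (induction r arbitrary: z t u)
  case 0
  then show ?case using rk_pos[of u] by (simp add: bounded_rank_def)
next
  case (Suc r)
  note T = Suc.prems(1,2)
  have G: "geometric (Suc r) z"
  proof -
    let ?y = "\<lambda>t u. z (t + K) u - real (Suc r) ^ K * z t u"
    have "trajectory ?y v (\<lambda>t. 0)"
      using Suc.prems(1) by (auto simp: trajectory_def sum_subtractf sum_distrib_left algebra_simps)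
    moreover have "?y t u = 0" if "u < n" "r < rk u" for t u
    proof (cases "rk u = Suc r")
      case True
      then show ?thesis using free_cycle_pow[OF T that(1), of t K] K by simp
    next
      case False
      then show ?thesis using Suc.prems(2) that by (simp add: bounded_rank_def)
    qed
    then have "bounded_rank r ?y" by (simp add: bounded_rank_def)
    ultimately have "?y t u = 0" if "u < n" for t u
      using Suc.IH[of ?y u t] Suc.prems(3) that by simp
    then show ?thesis by (simp add: geometric_def)
  qed
  have "z t u = 0" if u: "u < n" "rk u = Suc r" for t u
  proof -
    have "\<exists>m<n. rk m = Suc r \<and> (\<forall>t. z t m = 0)"
      using exit[OF u(1)]
    proof
      assume "\<exists>w\<in>M. w < n \<and> rk w = rk u"
      then show ?thesis using Suc.prems(3) u by metis
    next
      assume "\<exists>w i. X w i \<and> rk w = rk u"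
      then obtain w i where X: "X w i" "rk w = Suc r" using u by auto
      let ?z = "\<lambda>t u. if rk u < Suc r then z t u else 0"
      have "trajectory ?z i (\<lambda>t. z t w)" using cut_top_cycle[OF T _ X] by simp
      moreover have "bounded_rank r ?z" by (simp add: bounded_rank_def)
      moreover have "geometric (Suc r) ?z" using G by (simp add: geometric_def)
      ultimately have "z t w = 0" for t
        using forced_zero[of ?z i "\<lambda>t. z t w" r "Suc r"] X_less[OF X(1)] X(2) Suc.prems(3) by simp
      then show ?thesis using X X_less by metis
    qed
    then show ?thesis using free_cycle_zero[OF T _ _ _ _ u] by auto
  qed
  with Suc.prems(2) have "bounded_rank r z" by (rule bounded_rank_pred)
  then show ?case using Suc.IH[OF Suc.prems(1)] Suc.prems by simp
qed

end


lemma rtranclp_crossing: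
  assumes "E\<^sup>*\<^sup>* u w" "u \<notin> R" "w \<in> R"
  shows "\<exists>a b. E\<^sup>*\<^sup>* u a \<and> E a b \<and> a \<notin> R \<and> b \<in> R"
  using assms by (induction rule: rtranclp_induct) blast+

lemma ex_cycle_forest:
  assumes perm: "\<pi> permutes {..<n}" and E: "\<And>u w. E u w \<Longrightarrow> u < n \<and> w < n"
    and reach: "\<And>u. u < n \<Longrightarrow> \<exists>m\<in>M. E\<^sup>*\<^sup>* u m" and M: "M \<subseteq> {..<n}"
  shows "\<exists>rk X K. cycle_forest n \<pi> rk X M K \<and> (\<forall>u w. X u w \<longrightarrow> E u w)"
proof -
  have piV: "\<pi> u < n \<longleftrightarrow> u < n" for u using permutes_in_image[OF perm, of u] by simp
  obtain K where K: "0 < K" "\<pi> ^^ K = id"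
    using permutation_is_nilpotent[of \<pi>] permutation_permutes perm by blast
  define good where "good R rk X \<longleftrightarrow> R \<subseteq> {..<n} \<and> (\<forall>u. \<pi> u \<in> R \<longleftrightarrow> u \<in> R) \<and>
     (\<forall>u\<in>R. rk (\<pi> u) = rk u \<and> 0 < rk u) \<and>
     (\<forall>u\<in>R. \<forall>w\<in>R. rk u = rk w \<longrightarrow> (\<exists>a. w = (\<pi> ^^ a) u)) \<and>
     (\<forall>u w. X u w \<longrightarrow> u \<in> R \<and> w \<in> R \<and> E u w \<and> rk w < rk u) \<and>
     (\<forall>u w u' w'. X u w \<longrightarrow> X u' w' \<longrightarrow> rk u = rk u' \<longrightarrow> u = u' \<and> w = w') \<and>
     (\<forall>u\<in>R. (\<exists>w\<in>M. w \<in> R \<and> rk w = rk u) \<or> (\<exists>w i. X w i \<and> rk w = rk u))"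
    for R and rk :: "nat \<Rightarrow> nat" and X
  have "\<exists>R rk X. good R rk X \<and> k \<le> card R" if "k \<le> n" for k
    using that
  proof (induction k)
    case 0
    have "good {} (\<lambda>u. 0) (\<lambda>u w. False)" by (simp add: good_def)
    then show ?case by blast
  next
    case (Suc k)
    then obtain R rk X where g: "good R rk X" and k: "k \<le> card R" by auto
    have R: "R \<subseteq> {..<n}" and Rpi: "\<And>u. \<pi> u \<in> R \<longleftrightarrow> u \<in> R" and rk: "\<And>u. u \<in> R \<Longrightarrow> rk (\<pi> u) = rk u \<and> 0 < rk u"
      and orb: "\<And>u w. u \<in> R \<Longrightarrow> w \<in> R \<Longrightarrow> rk u = rk w \<Longrightarrow> \<exists>a. w = (\<pi> ^^ a) u"
      and X: "\<And>u w. X u w \<Longrightarrow> u \<in> R \<and> w \<in> R \<and> E u w \<and> rk w < rk u"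
      and Xu: "\<And>u w u' w'. X u w \<Longrightarrow> X u' w' \<Longrightarrow> rk u = rk u' \<Longrightarrow> u = u' \<and> w = w'"
      and ex: "\<And>u. u \<in> R \<Longrightarrow> (\<exists>w\<in>M. w \<in> R \<and> rk w = rk u) \<or> (\<exists>w i. X w i \<and> rk w = rk u)"
      using g unfolding good_def by blast+
    have finR: "finite R" using R finite_subset by blast
    show ?case
    proof (cases "R = {..<n}")
      case True
      then show ?thesis using g Suc.prems by (metis card_lessThan)
    next
      case False
      then obtain u0 where u0: "u0 < n" "u0 \<notin> R" using R by auto
      obtain m where m: "m \<in> M" "E\<^sup>*\<^sup>* u0 m" using reach u0 by blast
      have "\<exists>u v. u < n \<and> u \<notin> R \<and> (u \<in> M \<or> E u v \<and> v \<in> R)"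
      proof (cases "m \<in> R")
        case True
        then show ?thesis using rtranclp_crossing[OF m(2) u0(2)] E by blast
      next
        case False
        then show ?thesis using m M by auto
      qed
      then obtain u v where u: "u < n" "u \<notin> R" "u \<in> M \<or> E u v \<and> v \<in> R" by blast
      define Q where "Q = range (\<lambda>a. (\<pi> ^^ a) u)"
      define N where "N = Suc (sum rk R)"
      have N: "rk w < N" if "w \<in> R" for w
        using member_le_sum[OF that _ finR, of rk] by (simp add: N_def)
      have pow_less: "(\<pi> ^^ a) w < n \<longleftrightarrow> w < n" for a w by (induction a) (auto simp: piV)
      have pow_R: "(\<pi> ^^ a) w \<in> R \<longleftrightarrow> w \<in> R" for a w by (induction a) (auto simp: Rpi)
      have QR: "Q \<inter> R = {}" using u pow_R by (auto simp: Q_def)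
      have uQ: "u \<in> Q" unfolding Q_def by (rule range_eqI[of _ _ 0]) simp
      have returns: "\<exists>b. u = (\<pi> ^^ b) w" if w: "w \<in> Q" for w
      proof -
        obtain a where a: "w = (\<pi> ^^ a) u" using w by (auto simp: Q_def)
        have id: "(\<pi> ^^ (K * c)) x = x" for c x
          using K(2) by (simp add: funpow_mult [symmetric])
        have "K * a = (K * a - a) + a" using K(1) by simp
        then have "(\<pi> ^^ (K * a - a)) w = (\<pi> ^^ (K * a)) u" using a by (metis comp_apply funpow_add)
        then show ?thesis using id by metis
      qed
      have Qpi: "\<pi> w \<in> Q \<longleftrightarrow> w \<in> Q" for w
      proof
        assume "w \<in> Q"
        then obtain a where "w = (\<pi> ^^ a) u" by (auto simp: Q_def)
        then have "\<pi> w = (\<pi> ^^ Suc a) u" by simp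
        then show "\<pi> w \<in> Q" unfolding Q_def by (rule range_eqI)
      next
        assume "\<pi> w \<in> Q"
        then obtain a where a: "\<pi> w = (\<pi> ^^ a) u" by (auto simp: Q_def)
        have "(\<pi> ^^ (K - 1)) (\<pi> w) = w"
          using K by (metis Suc_diff_1 comp_apply funpow_Suc_right id_apply)
        then have "w = (\<pi> ^^ (K - 1 + a)) u" using a by (simp add: funpow_add)
        then show "w \<in> Q" by (auto simp: Q_def)
      qed
      define rk' where "rk' w = (if w \<in> Q then N else rk w)" for w
      define X' where "X' a b \<longleftrightarrow> X a b \<or> u \<notin> M \<and> a = u \<and> b = v" for a b
      have rkR: "rk' w = rk w" "w \<notin> Q" if "w \<in> R" for w using that QR by (auto simp: rk'_def)
      have rkQ: "rk' w = N" "w \<notin> R" if "w \<in> Q" for w using that QR by (auto simp: rk'_def)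
      have "good (R \<union> Q) rk' X'"
        unfolding good_def
      proof (intro conjI allI ballI impI)
        show "R \<union> Q \<subseteq> {..<n}" using R u pow_less by (auto simp: Q_def)
        show "\<pi> w \<in> R \<union> Q \<longleftrightarrow> w \<in> R \<union> Q" for w using Rpi Qpi by blast
        fix w assume w: "w \<in> R \<union> Q"
        show "rk' (\<pi> w) = rk' w" using w rk Qpi by (auto simp: rk'_def)
        show "0 < rk' w" using w rk by (auto simp: rk'_def N_def)
        show "(\<exists>x\<in>M. x \<in> R \<union> Q \<and> rk' x = rk' w) \<or> (\<exists>x i. X' x i \<and> rk' x = rk' w)"
        proof (cases "w \<in> Q")
          case True
          then show ?thesis using uQ rkQ by (cases "u \<in> M") (auto simp: X'_def)
        next
          case False
          then have "w \<in> R" using w by blast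
          from ex[OF this] show ?thesis using rkR \<open>w \<in> R\<close> X unfolding X'_def by (metis UnI1)
        qed
        fix x assume x: "x \<in> R \<union> Q" and eq: "rk' w = rk' x"
        show "\<exists>a. x = (\<pi> ^^ a) w"
        proof (cases "w \<in> Q")
          case True
          then have "x \<in> Q" using x eq rkQ rkR N by (metis UnE less_irrefl)
          then obtain a where "x = (\<pi> ^^ a) u" by (auto simp: Q_def)
          moreover obtain b where "u = (\<pi> ^^ b) w" using returns True by blast
          ultimately have "x = (\<pi> ^^ (a + b)) w" by (simp add: funpow_add)
          then show ?thesis by blast
        next
          case False
          then have "w \<in> R" using w by blast
          moreover have "x \<in> R" using x eq rkQ rkR N \<open>w \<in> R\<close> by (metis UnE less_irrefl)
          ultimately show ?thesis using orb eq rkR by simp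
        qed
      next
        fix a b assume ab: "X' a b"
        show "a \<in> R \<union> Q" "b \<in> R \<union> Q" "E a b" "rk' b < rk' a"
          using ab X u uQ rkR rkQ N unfolding X'_def by (metis UnI1 UnI2)+
        fix c d assume cd: "X' c d" and eq: "rk' a = rk' c"
        have "a \<in> R \<longleftrightarrow> c \<in> R"
          using ab cd X uQ rkR rkQ N eq unfolding X'_def by (metis less_irrefl)
        then have "X a b \<and> X c d \<and> rk a = rk c \<or> a = u \<and> b = v \<and> c = u \<and> d = v"
          using ab cd X u(2) eq rkR unfolding X'_def by metis
        then show "a = c" "b = d" using Xu by blast+
      qed
      moreover have "Suc k \<le> card (R \<union> Q)"
      proof -
        have "card (insert u R) \<le> card (R \<union> Q)"
        proof (rule card_mono)
          have "Q \<subseteq> {..<n}" using u pow_less by (auto simp: Q_def)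
          then show "finite (R \<union> Q)" using finR finite_subset by blast
        qed (use uQ in auto)
        then show ?thesis using k u finR by simp
      qed
      ultimately show ?thesis by blast
    qed
  qed
  from this[of n] obtain R rk X where g: "good R rk X" "n \<le> card R" by auto
  have "R = {..<n}"
    using g card_seteq[of "{..<n}" R] by (simp add: good_def)
  with g(1) have "cycle_forest n \<pi> rk X M K \<and> (\<forall>u w. X u w \<longrightarrow> E u w)"
    using perm K unfolding good_def cycle_forest_def by (simp add: Ball_def)
  then show ?thesis by blast
qed


definition edge :: "real mat \<Rightarrow> nat \<Rightarrow> nat \<Rightarrow> bool" where
  "edge A u w \<longleftrightarrow> u < dim_row A \<and> w < dim_row A \<and> A $$ (w, u) \<noteq> 0"

lemma edge_rtranclp_less: "(edge A)\<^sup>*\<^sup>* u w \<Longrightarrow> u < dim_row A \<Longrightarrow> w < dim_row A"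
  by (induction rule: rtranclp_induct) (auto simp: edge_def)

lemma verts_state_digraph [simp]: "verts (state_digraph A) = {..<dim_row A}"
  and arcs_state_digraph: "(u, w) \<in> arcs (state_digraph A) \<longleftrightarrow> edge A u w"
  by (auto simp: state_digraph_def edge_def)

lemma arcs_ends_state_digraph: "arcs_ends (state_digraph A) = {(u, w). edge A u w}"
  by (auto simp: arcs_ends_def arc_to_ends_def state_digraph_def edge_def)

lemma reachable_state_digraph:
  "u \<rightarrow>\<^sup>*\<^bsub>state_digraph A\<^esub> w \<longleftrightarrow> u < dim_row A \<and> (edge A)\<^sup>*\<^sup>* u w"
proof
  assume "u \<rightarrow>\<^sup>*\<^bsub>state_digraph A\<^esub> w"
  then have "(u, w) \<in> rtrancl_on {..<dim_row A} {(u, w). edge A u w}"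
    by (simp add: reachable_def arcs_ends_state_digraph)
  then show "u < dim_row A \<and> (edge A)\<^sup>*\<^sup>* u w"
    by (induction rule: rtrancl_on_induct) (auto intro: rtranclp.rtrancl_into_rtrancl)
next
  assume "u < dim_row A \<and> (edge A)\<^sup>*\<^sup>* u w"
  then have "(edge A)\<^sup>*\<^sup>* u w" and u: "u < dim_row A" by auto
  then have "(u, w) \<in> rtrancl_on {..<dim_row A} {(u, w). edge A u w}"
  proof (induction rule: rtranclp_induct)
    case base
    then show ?case using u by simp
  next
    case (step y z)
    have "(y, z) \<in> {(u, w). edge A u w}" "z \<in> {..<dim_row A}" using step(2) by (simp_all add: edge_def)
    with step.IH[OF u] show ?case by (rule rtrancl_on_into_rtrancl_on)
  qed
  then show "u \<rightarrow>\<^sup>*\<^bsub>state_digraph A\<^esub> w"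
    by (simp add: reachable_def arcs_ends_state_digraph)
qed

lemma in_parent_sccs:
  "S \<in> parent_sccs A \<longleftrightarrow> S \<noteq> {} \<and> S \<subseteq> {..<dim_row A} \<and> (\<forall>u\<in>S. S = {w. (edge A)\<^sup>*\<^sup>* u w})"
proof -
  let ?R = "(edge A)\<^sup>*\<^sup>*"
  have scc: "T \<in> pre_digraph.sccs_verts (state_digraph A) \<longleftrightarrow> T \<noteq> {} \<and> T \<subseteq> {..<dim_row A} \<and>
      (\<forall>u\<in>T. \<forall>w\<in>T. ?R u w) \<and> (\<forall>u\<in>T. \<forall>w. w \<notin> T \<longrightarrow> \<not> ?R u w \<or> \<not> ?R w u)" for T
  proof -
    have "T \<in> pre_digraph.sccs_verts (state_digraph A) \<longleftrightarrow> T \<noteq> {} \<and>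
      (\<forall>u\<in>T. \<forall>w\<in>T. u < dim_row A \<and> ?R u w) \<and>
      (\<forall>u\<in>T. \<forall>w. w \<notin> T \<longrightarrow> \<not> (u < dim_row A \<and> ?R u w) \<or> \<not> (w < dim_row A \<and> ?R w u))"
      unfolding pre_digraph.sccs_verts_def reachable_state_digraph by simp
    then show ?thesis using edge_rtranclp_less[of A] by blast
  qed
  show ?thesis
  proof
    assume "S \<in> parent_sccs A"
    then have S: "S \<in> pre_digraph.sccs_verts (state_digraph A)"
      and out: "\<And>S' u v. S' \<in> pre_digraph.sccs_verts (state_digraph A) \<Longrightarrow> u \<in> S \<Longrightarrow> v \<in> S' \<Longrightarrow> edge A u v \<Longrightarrow> S' = S"
      unfolding parent_sccs_def arcs_state_digraph by blast+
    have closed: "v \<in> S" if "u \<in> S" "edge A u v" for u v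
    proof -
      let ?T = "{w. ?R v w \<and> ?R w v}"
      have "?T \<in> pre_digraph.sccs_verts (state_digraph A)"
        unfolding scc
      proof (intro conjI)
        show "?T \<noteq> {}" by blast
        show "?T \<subseteq> {..<dim_row A}" using that(2) edge_rtranclp_less by (auto simp: edge_def)
      qed (auto intro: rtranclp_trans)
      then show ?thesis using out[of ?T u v] that by blast
    qed
    have "w \<in> S" if "?R u w" "u \<in> S" for u w
      using that closed by (induction rule: rtranclp_induct) auto
    then have "S = {w. ?R u w}" if "u \<in> S" for u using S that unfolding scc by blast
    then show "S \<noteq> {} \<and> S \<subseteq> {..<dim_row A} \<and> (\<forall>u\<in>S. S = {w. ?R u w})"
      using S unfolding scc by blast
  next
    assume S: "S \<noteq> {} \<and> S \<subseteq> {..<dim_row A} \<and> (\<forall>u\<in>S. S = {w. ?R u w})"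
    then have "S \<in> pre_digraph.sccs_verts (state_digraph A)" unfolding scc by blast
    moreover have "S' = S" if "S' \<in> pre_digraph.sccs_verts (state_digraph A)" "u \<in> S" "v \<in> S'" "edge A u v" for S' u v
    proof -
      have "v \<in> S" using S that(2,4) by blast
      then have "w \<in> S' \<longleftrightarrow> w \<in> S" for w
        using S that(1,3) unfolding scc by blast
      then show ?thesis by blast
    qed
    ultimately show "S \<in> parent_sccs A"
      unfolding parent_sccs_def arcs_state_digraph by blast
  qed
qed

lemma awalk_verts_tl:
  "pre_digraph.cas G u p v \<Longrightarrow> pre_digraph.awalk_verts G u p = u # map (head G) p"
  by (induction p arbitrary: u) (auto simp: pre_digraph.cas.simps pre_digraph.awalk_verts.simps)

lemma cas_last_head: "pre_digraph.cas G u p v \<Longrightarrow> p \<noteq> [] \<Longrightarrow> head G (last p) = v"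
  by (induction p arbitrary: u) (auto simp: pre_digraph.cas.simps split: if_splits)

lemma closed_walk_heads:
  assumes "pre_digraph.cas G u p u"
  shows "head G ` set p = tail G ` set p"
proof (cases "p = []")
  case False
  have "map (tail G) p @ [head G (last p)] = u # map (head G) p"
    using awalk_verts_tl[OF assms] False by (simp add: pre_digraph.awalk_verts_conv)
  moreover have "head G (last p) = u"
    using cas_last_head[OF assms False] .
  ultimately have "mset (map (tail G) p) + {#u#} = {#u#} + mset (map (head G) p)"
    by (metis mset_append mset.simps add_mset_add_single add.commute mset_single_iff_right append_Cons append_Nil)
  then have "set (map (tail G) p) = set (map (head G) p)"
    by (metis add.commute add_left_cancel set_mset_mset)
  then show ?thesis by simp
qed simp

lemma full_rank_permutation:
  assumes "structurally_full_rank A"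
  shows "\<exists>\<pi>. \<pi> permutes {..<dim_row A} \<and> (\<forall>u<dim_row A. edge A u (\<pi> u))"
proof -
  let ?G = "state_digraph A"
  obtain F where F: "(\<forall>p\<in>F. pre_digraph.cycle ?G p) \<and>
      (\<forall>p\<in>F. \<forall>q\<in>F. p \<noteq> q \<longrightarrow> fst ` set p \<inter> fst ` set q = {}) \<and> (\<Union>p\<in>F. fst ` set p) = {..<dim_row A}"
    using assms unfolding structurally_full_rank_def verts_state_digraph by (rule exE)
  then have cyc: "pre_digraph.cycle ?G p" if "p \<in> F" for p using that by simp
  have disj: "fst ` set p \<inter> fst ` set q = {}" if "p \<in> F" "q \<in> F" "p \<noteq> q" for p q using F that by simp
  have cover: "(\<Union>p\<in>F. fst ` set p) = {..<dim_row A}" using F by simp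
  have ht: "head ?G = snd" "tail ?G = fst" by (simp_all add: state_digraph_def)
  have C: "snd ` set p = fst ` set p \<and> distinct (map snd p) \<and> (\<forall>(u, w)\<in>set p. edge A u w)" if pF: "p \<in> F" for p
  proof -
    obtain u where u: "pre_digraph.awalk ?G u p u" "distinct (tl (pre_digraph.awalk_verts ?G u p))"
      using cyc[OF pF] unfolding pre_digraph.cycle_def by blast
    then have cas: "pre_digraph.cas ?G u p u" and arcs: "set p \<subseteq> arcs ?G" by (auto simp: pre_digraph.awalk_def)
    have "snd ` set p = fst ` set p" using closed_walk_heads[OF cas] by (simp only: ht)
    moreover have "distinct (map snd p)" using u(2) by (simp add: awalk_verts_tl[OF cas] ht)
    moreover have "\<forall>(u, w)\<in>set p. edge A u w" using arcs arcs_state_digraph[of _ _ A] by blast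
    ultimately show ?thesis by blast
  qed
  define e where "e u = (SOME a. fst a = u \<and> (\<exists>p\<in>F. a \<in> set p))" for u
  have e: "fst (e u) = u \<and> (\<exists>p\<in>F. e u \<in> set p)" if "u < dim_row A" for u
  proof -
    have "u \<in> (\<Union>p\<in>F. fst ` set p)" unfolding cover using that by simp
    then obtain p where "p \<in> F" "u \<in> fst ` set p" by blast
    then have "\<exists>a. fst a = u \<and> (\<exists>p\<in>F. a \<in> set p)" by (metis imageE)
    then show ?thesis unfolding e_def by (rule someI_ex)
  qed
  have inj: "inj_on (snd \<circ> e) {..<dim_row A}"
  proof (rule inj_onI)
    fix u w assume u: "u \<in> {..<dim_row A}" and w: "w \<in> {..<dim_row A}" and eq: "(snd \<circ> e) u = (snd \<circ> e) w"
    obtain p where p: "p \<in> F" "e u \<in> set p" "fst (e u) = u" using e[of u] u by auto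
    obtain q where q: "q \<in> F" "e w \<in> set q" "fst (e w) = w" using e[of w] w by auto
    have "snd (e u) \<in> fst ` set p" using C[OF p(1)] p(2) by (metis imageI)
    moreover have "snd (e u) \<in> fst ` set q" using C[OF q(1)] q(2) eq by (metis comp_apply imageI)
    ultimately have "p = q" using disj[OF p(1) q(1)] by blast
    moreover have "inj_on snd (set p)" using C[OF p(1)] by (simp add: distinct_map)
    ultimately have "e u = e w" using p(2) q(2) eq by (metis comp_apply inj_onD)
    then show "u = w" using p(3) q(3) by metis
  qed
  have edge: "edge A u (snd (e u))" if u: "u < dim_row A" for u
  proof -
    obtain p where p: "p \<in> F" "e u \<in> set p" "fst (e u) = u" using e[OF u] by auto
    have "case e u of (u, w) \<Rightarrow> edge A u w" using C[OF p(1)] p(2) by (intro bspec[where x = "e u"]) auto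
    then show ?thesis using p(3) by (simp add: case_prod_beta)
  qed
  then have "(snd \<circ> e) ` {..<dim_row A} \<subseteq> {..<dim_row A}" by (auto simp: edge_def)
  then have "bij_betw (snd \<circ> e) {..<dim_row A} {..<dim_row A}"
    using inj endo_inj_surj[OF finite_lessThan] unfolding bij_betw_def by blast
  then have "bij_betw (\<lambda>u. if u < dim_row A then snd (e u) else u) {..<dim_row A} {..<dim_row A}"
    by (subst bij_betw_cong[where g = "snd \<circ> e"]) simp_all
  then have "(\<lambda>u. if u < dim_row A then snd (e u) else u) permutes {..<dim_row A}"
    by (rule bij_imp_permutes) simp
  then show ?thesis using edge by (intro exI[of _ "\<lambda>u. if u < dim_row A then snd (e u) else u"]) simp
qed

lemma reaches_parent_scc:
  assumes "u < dim_row A"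
  shows "\<exists>S\<in>parent_sccs A. \<exists>w\<in>S. (edge A)\<^sup>*\<^sup>* u w"
proof -
  let ?R = "(edge A)\<^sup>*\<^sup>*"
  define w where "w = arg_min (\<lambda>w. card {x. ?R w x}) (?R u)"
  have w: "?R u w" and min: "\<And>v. ?R u v \<Longrightarrow> card {x. ?R w x} \<le> card {x. ?R v x}"
    unfolding w_def using arg_min_nat_lemma[of "?R u" u "\<lambda>w. card {x. ?R w x}"] by auto
  have sub: "{x. ?R w x} \<subseteq> {..<dim_row A}"
    using w assms edge_rtranclp_less by blast
  have "{x. ?R v x} = {x. ?R w x}" if "?R w v" for v
  proof (rule card_seteq)
    show "finite {x. ?R w x}" using sub finite_subset by blast
    show "{x. ?R v x} \<subseteq> {x. ?R w x}" using that rtranclp_trans[of "edge A"] by blast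
    show "card {x. ?R w x} \<le> card {x. ?R v x}" using min that w rtranclp_trans[of "edge A"] by blast
  qed
  then have "{x. ?R w x} \<in> parent_sccs A"
    unfolding in_parent_sccs using sub by blast
  then show ?thesis using w by blast
qed

lemma index_mult_mat_vec_sum:
  "M \<in> carrier_mat r n \<Longrightarrow> y \<in> carrier_vec n \<Longrightarrow> i < r \<Longrightarrow> (M *\<^sub>v y) $ i = (\<Sum>l<n. M $$ (i, l) * y $ l)"
  by (simp add: scalar_prod_def atLeast0LessThan)

lemma structurally_observable_imp_measured:
  assumes A: "A \<in> carrier_mat n n" and H: "H \<in> carrier_mat m n" and so: "structurally_observable A H"
    and S: "S \<in> parent_sccs A"
  shows "\<exists>i<m. \<exists>j\<in>S. H $$ (i, j) \<noteq> 0"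
proof (rule ccontr)
  assume "\<not> (\<exists>i<m. \<exists>j\<in>S. H $$ (i, j) \<noteq> 0)"
  then have H0: "\<And>i j. i < m \<Longrightarrow> j \<in> S \<Longrightarrow> H $$ (i, j) = 0" by blast
  obtain A' H' where A': "realizes A' A" and H': "realizes H' H" and obs: "observable A' H'"
    using so unfolding structurally_observable_def by blast
  have cA: "A' \<in> carrier_mat n n" and cH: "H' \<in> carrier_mat m n" using A A' H H' by (auto simp: realizes_def)
  have Sn: "S \<subseteq> {..<n}" and "S \<noteq> {}" and SS: "\<And>u. u \<in> S \<Longrightarrow> S = {w. (edge A)\<^sup>*\<^sup>* u w}" using S A by (auto simp: in_parent_sccs)
  then obtain j where j: "j \<in> S" "j < n" by blast
  have A0: "A' $$ (i, l) = 0" if "i < n" "i \<notin> S" "l \<in> S" for i l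
  proof -
    have "\<not> edge A l i" using SS[OF that(3)] that(2) by blast
    then show ?thesis using A A' that Sn by (auto simp: edge_def realizes_def)
  qed
  have H'0: "H' $$ (i, l) = 0" if "i < m" "l \<in> S" for i l
    using H H' H0[OF that] that Sn by (auto simp: realizes_def)
  have inv: "(A' ^\<^sub>m k *\<^sub>v x) $ i = 0" if "x \<in> carrier_vec n" "\<And>i. i < n \<Longrightarrow> i \<notin> S \<Longrightarrow> x $ i = 0" "i < n" "i \<notin> S" for k x i
    using that
  proof (induction k arbitrary: x)
    case 0
    then show ?case using cA by simp
  next
    case (Suc k)
    have "(A' *\<^sub>v x) $ i = 0" if "i < n" "i \<notin> S" for i
    proof -
      have "(A' *\<^sub>v x) $ i = (\<Sum>l<n. A' $$ (i, l) * x $ l)"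
        by (rule index_mult_mat_vec_sum[OF cA Suc.prems(1) that(1)])
      also have "\<dots> = 0" using A0[OF that] Suc.prems(2) by (intro sum.neutral) auto
      finally show ?thesis .
    qed
    then have "(A' ^\<^sub>m k *\<^sub>v (A' *\<^sub>v x)) $ i = 0"
      using Suc.IH[OF mult_mat_vec_carrier[OF cA Suc.prems(1)]] Suc.prems(3,4) by blast
    moreover have "A' ^\<^sub>m Suc k *\<^sub>v x = A' ^\<^sub>m k *\<^sub>v (A' *\<^sub>v x)"
      using assoc_mult_mat_vec[OF pow_carrier_mat[OF cA] cA Suc.prems(1)] by simp
    ultimately show ?case by simp
  qed
  have out: "outputs A' H' x k = 0\<^sub>v m" if "x \<in> carrier_vec n" "\<And>i. i < n \<Longrightarrow> i \<notin> S \<Longrightarrow> x $ i = 0" for x k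
  proof (rule eq_vecI)
    fix i assume "i < dim_vec (0\<^sub>v m :: real vec)"
    then have i: "i < m" by simp
    let ?y = "A' ^\<^sub>m k *\<^sub>v x"
    have y: "?y \<in> carrier_vec n" by (rule mult_mat_vec_carrier[OF pow_carrier_mat[OF cA] that(1)])
    have "outputs A' H' x k $ i = (\<Sum>l<n. H' $$ (i, l) * ?y $ l)"
      unfolding outputs_def by (rule index_mult_mat_vec_sum[OF cH y i])
    also have "\<dots> = 0" using H'0[OF i] inv[OF that] by (intro sum.neutral) auto
    finally show "outputs A' H' x k $ i = 0\<^sub>v m $ i" using i by simp
  qed (use cH in \<open>simp add: outputs_def\<close>)
  have unit0: "(unit_vec n j :: real vec) $ i = 0" if "i < n" "i \<notin> S" for i
    using j that by (auto simp: index_unit_vec)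
  have "unit_vec n j = (0\<^sub>v n :: real vec)"
  proof -
    have "\<forall>k. outputs A' H' (unit_vec n j) k = outputs A' H' (0\<^sub>v n) k"
      using out[of "0\<^sub>v n"] out[of "unit_vec n j", OF _ unit0] by simp
    moreover have "dim_row A' = n" using cA by simp
    ultimately show ?thesis using obs unfolding observable_def by simp
  qed
  then have "(unit_vec n j :: real vec) $ j = 0\<^sub>v n $ j" by simp
  then show False using j by simp
qed

lemma pow_mat_Suc_vec:
  assumes A: "(A :: real mat) \<in> carrier_mat n n" and x: "x \<in> carrier_vec n"
  shows "A ^\<^sub>m Suc k *\<^sub>v x = A *\<^sub>v (A ^\<^sub>m k *\<^sub>v x)"
  using x
proof (induction k arbitrary: x)
  case 0
  then show ?case using A by simp
next
  case (Suc k)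
  have *: "A ^\<^sub>m Suc k *\<^sub>v y = A ^\<^sub>m k *\<^sub>v (A *\<^sub>v y)" if "y \<in> carrier_vec n" for k y
    using assoc_mult_mat_vec[OF pow_carrier_mat[OF A] A that] by simp
  have "A *\<^sub>v x \<in> carrier_vec n" using A Suc.prems by simp
  from Suc.IH[OF this] show ?case using *[OF Suc.prems] *[of x k] *[of x "Suc k"] Suc.prems by simp
qed

lemma measured_imp_structurally_observable:
  assumes A: "A \<in> carrier_mat n n" and full: "structurally_full_rank A" and H: "H \<in> carrier_mat m n"
    and h: "\<And>i. i < m \<Longrightarrow> h i < n" "\<And>i l. i < m \<Longrightarrow> l < n \<Longrightarrow> H $$ (i, l) = (if l = h i then 1 else 0)"
    and meas: "\<And>S. S \<in> parent_sccs A \<Longrightarrow> \<exists>i<m. h i \<in> S"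
  shows "structurally_observable A H"
proof -
  have dim: "dim_row A = n" using A by simp
  obtain \<pi> where perm: "\<pi> permutes {..<n}" and pi: "\<And>u. u < n \<Longrightarrow> edge A u (\<pi> u)"
    using full_rank_permutation[OF full] dim by auto
  let ?M = "h ` {..<m}"
  have "\<exists>x\<in>?M. (edge A)\<^sup>*\<^sup>* u x" if u: "u < n" for u
  proof -
    obtain S w where S: "S \<in> parent_sccs A" "w \<in> S" "(edge A)\<^sup>*\<^sup>* u w"
      using reaches_parent_scc[of u A] u dim by blast
    obtain i where i: "i < m" "h i \<in> S" using meas[OF S(1)] by blast
    then have "(edge A)\<^sup>*\<^sup>* w (h i)" using S(1,2) unfolding in_parent_sccs by blast
    with S(3) i show ?thesis by (meson imageI lessThan_iff rtranclp_trans)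
  qed
  note reach = this
  have EM: "\<And>u w. edge A u w \<Longrightarrow> u < n \<and> w < n" "?M \<subseteq> {..<n}" using h(1) dim by (auto simp: edge_def)
  have "\<exists>rk X K. cycle_forest n \<pi> rk X ?M K \<and> (\<forall>u w. X u w \<longrightarrow> edge A u w)"
    by (rule ex_cycle_forest[OF perm EM(1) reach EM(2)])
  then obtain rk X K where cf: "cycle_forest n \<pi> rk X ?M K" and XE: "\<And>u w. X u w \<Longrightarrow> edge A u w"
    by blast
  interpret cycle_forest n \<pi> rk X ?M K by (rule cf)
  define A' :: "real mat" where
    "A' = mat n n (\<lambda>(i, j). (if i = \<pi> j then real (rk j) else 0) + (if X j i then 1 else 0))"
  have cA: "A' \<in> carrier_mat n n" by (simp add: A'_def)
  have "realizes A' A"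
    unfolding realizes_def using A pi XE by (auto simp: A'_def edge_def)
  moreover have "realizes H H" by (simp add: realizes_def)
  moreover have "observable A' H"
    unfolding observable_def
  proof (intro ballI impI)
    fix x x' :: "real vec" assume "x \<in> carrier_vec (dim_row A')" "x' \<in> carrier_vec (dim_row A')"
      and out: "\<forall>k. outputs A' H x k = outputs A' H x' k"
    then have x: "x \<in> carrier_vec n" "x' \<in> carrier_vec n" by (simp_all add: A'_def)
    define z where "z t i = (A' ^\<^sub>m t *\<^sub>v x) $ i - (A' ^\<^sub>m t *\<^sub>v x') $ i" for t i
    have cy: "A' ^\<^sub>m t *\<^sub>v y \<in> carrier_vec n" if "y \<in> carrier_vec n" for t y
      by (rule mult_mat_vec_carrier[OF pow_carrier_mat[OF cA] that])
    have step: "(A' ^\<^sub>m Suc t *\<^sub>v y) $ \<pi> u = real (rk u) * (A' ^\<^sub>m t *\<^sub>v y) $ u + (\<Sum>w | w < n \<and> X w (\<pi> u). (A' ^\<^sub>m t *\<^sub>v y) $ w)"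
      if u: "u < n" and y: "y \<in> carrier_vec n" for u t y
    proof -
      let ?y = "A' ^\<^sub>m t *\<^sub>v y"
      have "(A' ^\<^sub>m Suc t *\<^sub>v y) $ \<pi> u = (\<Sum>l<n. A' $$ (\<pi> u, l) * ?y $ l)"
        unfolding pow_mat_Suc_vec[OF cA y] by (rule index_mult_mat_vec_sum[OF cA cy[OF y]]) (use u in simp)
      also have "\<dots> = (\<Sum>l<n. (if l = u then real (rk u) * ?y $ u else 0) + (if X l (\<pi> u) then ?y $ l else 0))"
      proof (intro sum.cong refl)
        fix l assume "l \<in> {..<n}"
        then have "A' $$ (\<pi> u, l) = (if l = u then real (rk u) else 0) + (if X l (\<pi> u) then 1 else 0)"
          using u by (auto simp: A'_def pi_eq)
        then show "A' $$ (\<pi> u, l) * ?y $ l = (if l = u then real (rk u) * ?y $ u else 0) + (if X l (\<pi> u) then ?y $ l else 0)"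
          by (simp only: distrib_right) simp
      qed
      also have "\<dots> = real (rk u) * ?y $ u + (\<Sum>l<n. if X l (\<pi> u) then ?y $ l else 0)"
        using u by (simp add: sum.distrib)
      also have "(\<Sum>l<n. if X l (\<pi> u) then ?y $ l else 0) = (\<Sum>w | w < n \<and> X w (\<pi> u). ?y $ w)"
        by (simp add: sum.If_cases Int_def)
      finally show ?thesis .
    qed
    have T: "trajectory z 0 (\<lambda>t. 0)"
      unfolding trajectory_def z_def using step x by (simp add: sum_subtractf algebra_simps)
    have B: "bounded_rank (sum rk {..<n}) z"
      unfolding bounded_rank_def using member_le_sum[of _ "{..<n}" rk] by (auto simp: not_less[symmetric])
    have Z: "z t l = 0" if l: "l \<in> ?M" for t l
    proof -
      obtain i where i: "i < m" "l = h i" using l by auto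
      have o: "outputs A' H y t $ i = (A' ^\<^sub>m t *\<^sub>v y) $ l" if y: "y \<in> carrier_vec n" for y
      proof -
        have "outputs A' H y t $ i = (\<Sum>k<n. H $$ (i, k) * (A' ^\<^sub>m t *\<^sub>v y) $ k)"
          unfolding outputs_def by (rule index_mult_mat_vec_sum[OF H cy[OF y] i(1)])
        also have "\<dots> = (\<Sum>k<n. if k = h i then (A' ^\<^sub>m t *\<^sub>v y) $ h i else 0)"
          using h(2) i by (intro sum.cong) auto
        finally show ?thesis using h(1) i by simp
      qed
      show ?thesis unfolding z_def using out o[OF x(1)] o[OF x(2)] by simp
    qed
    have z: "z 0 u = 0" if "u < n" for u
      by (rule unforced_zero[OF T B Z that])
    show "x = x'"
    proof (rule eq_vecI)
      fix u assume "u < dim_vec x'"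
      then have "u < n" using x by simp
      from z[OF this] show "x $ u = x' $ u" using x cA by (simp add: z_def)
    qed (use x in simp)
  qed
  ultimately show ?thesis unfolding structurally_observable_def by blast
qed

section \<open>The Hungarian method\<close>

definition partial_optimum ::
    "nat \<Rightarrow> (nat \<Rightarrow> nat \<Rightarrow> real) \<Rightarrow> nat \<Rightarrow> (nat \<Rightarrow> nat) \<Rightarrow> (nat \<Rightarrow> real) \<Rightarrow> (nat \<Rightarrow> real) \<Rightarrow> bool" where
  "partial_optimum m C i z u v \<longleftrightarrow> inj_on z {..<i} \<and> (\<forall>r<i. z r < m \<and> u r + v (z r) = C r (z r)) \<and>
     (\<forall>r<i. \<forall>j<m. u r + v j \<le> C r j)"

definition owners :: "nat \<Rightarrow> nat \<Rightarrow> (nat \<Rightarrow> nat) \<Rightarrow> (nat \<Rightarrow> nat) \<Rightarrow> bool" where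
  "owners m i z p \<longleftrightarrow> (\<forall>r<i. p (z r) = r) \<and> (\<forall>j<m. (p j < i \<longrightarrow> z (p j) = j) \<and> (p j < m \<longrightarrow> p j < i))"

definition in_tree :: "nat \<Rightarrow> (nat \<Rightarrow> nat) \<Rightarrow> nat set \<Rightarrow> nat \<Rightarrow> bool" where
  "in_tree i p U r \<longleftrightarrow> r = i \<or> (\<exists>j\<in>U. p j = r)"

text \<open>\<open>U\<close> is the set of columns in the alternating tree rooted at row \<open>i\<close>, \<open>mv j\<close> the least slack of
  column \<open>j\<close> against a tree row and \<open>way j\<close> a tree row attaining it.  The ghost function \<open>rk\<close> numbers the
  rows in the order in which they enter the tree; it only serves to show that following \<open>way\<close> leads to
  the root.  Before the first dual update row \<open>i\<close> may violate dual feasibility, hence the exception for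
  \<open>U = {}\<close>.\<close>

definition search_inv where
  "search_inv m C i z p u v mv way U rk \<longleftrightarrow>
     partial_optimum m C i z u v \<and> owners m i z p \<and> U \<subseteq> {..<m} \<and>
     (\<forall>j\<in>U. p j < i \<and> in_tree i p U (way j) \<and> C (way j) j = u (way j) + v j \<and>
        u i + v j \<le> C i j \<and> rk (way j) < rk (p j)) \<and>
     (\<forall>j<m. j \<notin> U \<longrightarrow> in_tree i p U (way j) \<and> C (way j) j - u (way j) - v j = mv j \<and>
        (\<forall>r. in_tree i p U r \<longrightarrow> mv j \<le> C r j - u r - v j)) \<and>
     (\<forall>r. in_tree i p U r \<longrightarrow> rk r \<le> card U) \<and>
     (\<forall>j<m. j \<notin> U \<longrightarrow> U \<noteq> {} \<longrightarrow> (0::real) \<le> mv j)"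

lemma search_invD:
  assumes "search_inv m C i z p u v mv way U rk"
  shows "partial_optimum m C i z u v" and "owners m i z p" and "U \<subseteq> {..<m}" and "finite U"
    and "\<And>j. j \<in> U \<Longrightarrow> j < m \<and> p j < i \<and> in_tree i p U (way j) \<and> C (way j) j = u (way j) + v j \<and>
        u i + v j \<le> C i j \<and> rk (way j) < rk (p j)"
    and "\<And>j. j < m \<Longrightarrow> j \<notin> U \<Longrightarrow> in_tree i p U (way j) \<and> C (way j) j - u (way j) - v j = mv j"
    and "\<And>j r. j < m \<Longrightarrow> j \<notin> U \<Longrightarrow> in_tree i p U r \<Longrightarrow> mv j \<le> C r j - u r - v j"
    and "\<And>r. in_tree i p U r \<Longrightarrow> rk r \<le> card U"
    and "\<And>j. j < m \<Longrightarrow> j \<notin> U \<Longrightarrow> U \<noteq> {} \<Longrightarrow> 0 \<le> mv j"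
  using assms unfolding search_inv_def by (auto intro: finite_subset)

lemma in_tree_root [simp]: "in_tree i p U i"
  by (simp add: in_tree_def)

lemma search_init:
  assumes "partial_optimum m C i z u v" "owners m i z p"
  shows "search_inv m C i z p u v (\<lambda>j. C i j - u i - v j) (\<lambda>j. i) {} (\<lambda>r. 0)"
  using assms unfolding search_inv_def in_tree_def by simp

lemma search_dual:
  assumes S: "search_inv m C i z p u v mv way U rk" and k: "k < m" "k \<notin> U"
    and min: "\<And>j. j < m \<Longrightarrow> j \<notin> U \<Longrightarrow> mv k \<le> mv j"
    and u': "\<And>r. u' r = (if in_tree i p U r then u r + mv k else u r)"
    and v': "\<And>j. j < m \<Longrightarrow> v' j = (if j \<in> U then v j - mv k else v j)"
    and mv': "\<And>j. j < m \<Longrightarrow> j \<notin> U \<Longrightarrow> mv' j = mv j - mv k"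
  shows "search_inv m C i z p u' v' mv' way U rk" and "mv' k = 0"
    and "\<And>j. j < m \<Longrightarrow> j \<notin> U \<Longrightarrow> 0 \<le> mv' j" and "\<And>j. j < m \<Longrightarrow> u' i + v' j \<le> C i j"
proof -
  note D = search_invD[OF S]
  note own = D(2) and opt = D(1)
  have tree: "in_tree i p U r \<longleftrightarrow> z r \<in> U" if r: "r < i" for r
  proof
    assume "in_tree i p U r"
    then obtain j where j: "j \<in> U" "p j = r" using r by (auto simp: in_tree_def)
    have "z (p j) = j" using D(5)[OF j(1)] own by (simp add: owners_def)
    then show "z r \<in> U" using j by simp
  next
    assume "z r \<in> U"
    then show "in_tree i p U r" using own r by (auto simp: owners_def in_tree_def)
  qed
  have pos: "0 \<le> mv k" if "j \<in> U" for j using D(9) k that by blast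
  have low: "mv k \<le> C r j - u r - v j" if "in_tree i p U r" "j < m" "j \<notin> U" for r j
    using D(7)[OF that(2,3,1)] min[OF that(2,3)] by linarith
  have "partial_optimum m C i z u' v'"
    unfolding partial_optimum_def
  proof (intro conjI allI impI)
    show "inj_on z {..<i}" using opt by (simp add: partial_optimum_def)
    fix r assume r: "r < i"
    show "z r < m" using opt r by (simp add: partial_optimum_def)
    show "u' r + v' (z r) = C r (z r)" using opt r tree[OF r] by (simp add: partial_optimum_def u' v')
    fix j assume j: "j < m"
    have "u r + v j \<le> C r j" using opt r j by (simp add: partial_optimum_def)
    then show "u' r + v' j \<le> C r j"
      using low[OF _ j, of r] pos[of j] j by (cases "j \<in> U"; cases "in_tree i p U r") (auto simp: u' v')
  qed
  moreover have up: "\<forall>j\<in>U. p j < i \<and> in_tree i p U (way j) \<and> C (way j) j = u' (way j) + v' j \<and>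
        u' i + v' j \<le> C i j \<and> rk (way j) < rk (p j)"
    using D(5) by (auto simp: u' v')
  moreover have free: "\<forall>j<m. j \<notin> U \<longrightarrow> in_tree i p U (way j) \<and> C (way j) j - u' (way j) - v' j = mv' j \<and>
        (\<forall>r. in_tree i p U r \<longrightarrow> mv' j \<le> C r j - u' r - v' j)"
    using D(6,7) by (auto simp: u' v' mv' algebra_simps)
  moreover show nonneg: "\<And>j. j < m \<Longrightarrow> j \<notin> U \<Longrightarrow> 0 \<le> mv' j" using min by (simp add: mv')
  ultimately show "search_inv m C i z p u' v' mv' way U rk"
    using D(2,3,8) unfolding search_inv_def by simp
  show "mv' k = 0" using k by (simp add: mv')
  fix j assume j: "j < m"
  show "u' i + v' j \<le> C i j"
  proof (cases "j \<in> U")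
    case True then show ?thesis using up by blast
  next
    case False
    then have "mv' j \<le> C i j - u' i - v' j" using free j by simp
    with nonneg[OF j False] show ?thesis by linarith
  qed
qed

lemma search_grow:
  assumes S: "search_inv m C i z p u v mv way U rk" and k: "k < m" "k \<notin> U" "mv k = 0" "p k < m"
    and nonneg: "\<And>j. j < m \<Longrightarrow> j \<notin> U \<Longrightarrow> 0 \<le> mv j" and feas: "\<And>j. j < m \<Longrightarrow> u i + v j \<le> C i j"
    and U': "U' = insert k U"
    and mv': "\<And>j. j < m \<Longrightarrow> j \<notin> U' \<Longrightarrow> mv' j = min (mv j) (C (p k) j - u (p k) - v j)"
    and way': "\<And>j. j < m \<Longrightarrow> way' j = (if j \<notin> U' \<and> C (p k) j - u (p k) - v j < mv j then p k else way j)"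
  shows "search_inv m C i z p u v mv' way' U' (rk(p k := card U'))"
proof -
  note D = search_invD[OF S]
  note opt = D(1) and own = D(2) and U = D(3) and fin = D(4)
  have pk: "p k < i" "z (p k) = k" using own k by (auto simp: owners_def)
  have card: "card U' = Suc (card U)" using fin k U' by simp
  have new: "p j \<noteq> p k" if "j \<in> U" for j
  proof -
    have "p j < i" "j < m" using D(5) that by auto
    then have "z (p j) = j" using own by (simp add: owners_def)
    then show ?thesis using that pk(2) k(2) by metis
  qed
  have tree: "in_tree i p U' r \<longleftrightarrow> in_tree i p U r \<or> r = p k" for r by (auto simp: in_tree_def U')
  have ntree: "\<not> in_tree i p U (p k)" using new pk by (auto simp: in_tree_def)
  have rk: "rk r \<le> card U" "r \<noteq> p k" if "in_tree i p U r" for r using D(8) that ntree by auto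
  have pkfeas: "u (p k) + v j \<le> C (p k) j" if "j < m" for j using opt pk that by (auto simp: partial_optimum_def)
  have old: "way' j = way j" if "j \<in> U'" for j using way' that k U U' by auto
  have wk: "in_tree i p U (way k)" "C (way k) k = u (way k) + v k" using D(6)[of k] k by auto
  have wU: "in_tree i p U (way j)" "C (way j) j = u (way j) + v j" "p j < i" "rk (way j) < rk (p j)"
    if "j \<in> U" for j using D(5)[OF that] by auto
  show ?thesis
    unfolding search_inv_def
  proof (intro conjI ballI allI impI)
    show "partial_optimum m C i z u v" "owners m i z p" by fact+
    show "U' \<subseteq> {..<m}" using U k U' by auto
  next
    fix j assume j: "j \<in> U'"
    then have jm: "j < m" using U k U' by auto
    show "p j < i" using wU(3) pk j U' by auto
    show "in_tree i p U' (way' j)" "C (way' j) j = u (way' j) + v j"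
      using old[OF j] wU wk j U' tree by auto
    show "u i + v j \<le> C i j" using feas jm .
    have "in_tree i p U (way j)" using wU wk j U' by auto
    from rk[OF this] show "(rk(p k := card U')) (way' j) < (rk(p k := card U')) (p j)"
      using old[OF j] wU(4) card new j by (auto simp: U')
  next
    fix j assume j: "j < m" "j \<notin> U'"
    then have jU: "j \<notin> U" using U' by auto
    have *: "in_tree i p U (way j)" "C (way j) j - u (way j) - v j = mv j"
      "\<And>r. in_tree i p U r \<Longrightarrow> mv j \<le> C r j - u r - v j" using D(6,7) j jU by auto
    show "in_tree i p U' (way' j)" using way'[OF j(1)] * tree by auto
    show "C (way' j) j - u (way' j) - v j = mv' j" using way'[OF j(1)] mv'[OF j] * j by auto
    fix r assume "in_tree i p U' r"
    then show "mv' j \<le> C r j - u r - v j" using *(3) tree mv'[OF j] by fastforce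
  next
    fix r assume "in_tree i p U' r"
    then show "(rk(p k := card U')) r \<le> card U'" using rk(1) tree card by fastforce
  next
    fix j assume j: "j < m" "j \<notin> U'"
    then show "0 \<le> mv' j" using nonneg[of j] mv'[OF j] pkfeas[of j] U' by auto
  qed
qed

definition augment_inv where
  "augment_inv m C i z0 p u v way U rk k z \<longleftrightarrow>
     partial_optimum m C i z u v \<and> (\<forall>j<m. u i + v j \<le> (C i j :: real)) \<and>
     k < m \<and> k \<notin> z ` {..<i} \<and> in_tree i p U (way k) \<and> C (way k) k = u (way k) + v k \<and>
     (\<forall>r<i. in_tree i p U r \<longrightarrow> (rk r :: nat) \<le> rk (way k) \<longrightarrow> z r = z0 r)"

lemma augment_init:
  assumes S: "search_inv m C i z p u v mv way U rk" and k: "k < m" "k \<notin> U" "mv k = 0" "\<not> p k < m" "i \<le> m"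
    and feas: "\<And>j. j < m \<Longrightarrow> u i + v j \<le> C i j"
  shows "augment_inv m C i z p u v way U rk k z"
proof -
  note D = search_invD[OF S]
  have "k \<notin> z ` {..<i}" using D(2) k by (auto simp: owners_def)
  then show ?thesis using D(1) D(6)[of k] k feas by (auto simp: augment_inv_def)
qed

lemma augment_step:
  assumes S: "search_inv m C i z0 p u v mv way U rk" and A: "augment_inv m C i z0 p u v way U rk k z"
    and k: "way k < i"
  shows "augment_inv m C i z0 p u v way U rk (z (way k)) (z(way k := k))"
    and "rk (way (z (way k))) < rk (way k)"
proof -
  note D = search_invD[OF S]
  note own = D(2) and opt0 = D(1)
  have opt: "partial_optimum m C i z u v" using A by (auto simp: augment_inv_def)
  have "in_tree i p U (way k)" using A by (auto simp: augment_inv_def)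
  then obtain j where j: "j \<in> U" "p j = way k" using k by (auto simp: in_tree_def)
  have jj: "p j < i" "j < m" "in_tree i p U (way j)" "C (way j) j = u (way j) + v j" "rk (way j) < rk (p j)"
    using D(5)[OF j(1)] by auto
  have pz: "p (z0 (way k)) = way k" using own k by (auto simp: owners_def)
  have zj: "z0 (way k) = j" using own jj j by (auto simp: owners_def)
  have zk: "z (way k) = j" using A k zj by (auto simp: augment_inv_def)
  show "rk (way (z (way k))) < rk (way k)" using zk jj j by simp
  have inj: "inj_on z {..<i}" and kz: "k \<notin> z ` {..<i}" "k < m" and Ck: "C (way k) k = u (way k) + v k"
    using A by (auto simp: augment_inv_def partial_optimum_def)
  have "partial_optimum m C i (z(way k := k)) u v"
    using opt kz Ck k unfolding partial_optimum_def by (auto simp: inj_on_def)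
  moreover have "j \<notin> (z(way k := k)) ` {..<i}"
  proof
    assume "j \<in> (z(way k := k)) ` {..<i}"
    then obtain r where r: "r < i" "j = (z(way k := k)) r" by auto
    show False
    proof (cases "r = way k")
      case True
      then show ?thesis using r kz k zk by (metis fun_upd_same imageI lessThan_iff)
    next
      case False
      then show ?thesis using r inj zk k by (auto simp: inj_on_def)
    qed
  qed
  ultimately show "augment_inv m C i z0 p u v way U rk (z (way k)) (z(way k := k))"
    using A jj j unfolding augment_inv_def zk by (auto)
qed

lemma augment_end:
  assumes A: "augment_inv m C i z0 p u v way U rk k z" and S: "search_inv m C i z0 p u v mv way U rk"
    and k: "\<not> way k < i"
  shows "partial_optimum m C (Suc i) (z(i := k)) u v"
proof -
  have "in_tree i p U (way k)" using A by (auto simp: augment_inv_def)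
  then have "way k = i" using k search_invD(5)[OF S] unfolding in_tree_def by metis
  then have "C i k = u i + v k" "k < m" "k \<notin> z ` {..<i}" "partial_optimum m C i z u v" "\<forall>j<m. u i + v j \<le> C i j"
    using A by (simp_all add: augment_inv_def)
  note k = this(1-3) and opt = this(4)[unfolded partial_optimum_def] and feas = this(5)
  show ?thesis
    unfolding partial_optimum_def
  proof (intro conjI allI impI)
    have "inj_on (z(i := k)) {..<i}" using opt k(3) by (simp add: inj_on_def)
    then show "inj_on (z(i := k)) {..<Suc i}" using k(3) by (simp add: lessThan_Suc image_iff)
  next
    fix r assume r: "r < Suc i"
    show "(z(i := k)) r < m" "u r + v ((z(i := k)) r) = C r ((z(i := k)) r)"
      using r opt k(1,2) by (cases "r = i"; simp)+
    fix j assume "j < m"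
    then show "u r + v j \<le> C r j" using r opt feas by (cases "r = i"; simp)
  qed
qed

text \<open>Used columns are owned by rows below \<open>i\<close>.\<close>

lemma search_free_column:
  assumes S: "search_inv m C i z p u v mv way U rk" and i: "i < m"
  shows "\<exists>j<m. j \<notin> U" and "card U < m"
proof -
  note D = search_invD[OF S]
  have "U \<subseteq> z ` {..<i}"
  proof
    fix j assume "j \<in> U"
    then have "p j < i" "j < m" using D(5) by auto
    then have "z (p j) = j" using D(2) by (auto simp: owners_def)
    then show "j \<in> z ` {..<i}" using \<open>p j < i\<close> by (metis imageI lessThan_iff)
  qed
  then have "card U \<le> card (z ` {..<i})" by (intro card_mono) auto
  also have "\<dots> \<le> i" using card_image_le[of "{..<i}" z] by simp
  finally show "card U < m" using i by simp
  show "\<exists>j<m. j \<notin> U"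
  proof (rule ccontr)
    assume "\<not> (\<exists>j<m. j \<notin> U)"
    then have "U = {..<m}" using D(3) by auto
    with \<open>card U < m\<close> show False by simp
  qed
qed

section \<open>Sensor selection as an assignment problem\<close>

definition choice_mat :: "nat \<Rightarrow> nat \<Rightarrow> (nat \<Rightarrow> nat) \<Rightarrow> real mat" where
  "choice_mat r k f = mat r k (\<lambda>(i, j). if j = f i then 1 else 0)"

lemma choice_mat_index: "i < r \<Longrightarrow> j < k \<Longrightarrow> choice_mat r k f $$ (i, j) = (if j = f i then 1 else 0)"
  by (simp add: choice_mat_def)

lemma choice_mat_row_sum: "i < r \<Longrightarrow> f i < k \<Longrightarrow> (\<Sum>j<k. choice_mat r k f $$ (i, j)) = 1"
  by (simp add: choice_mat_index)

lemma choice_mat_binary: "choice_mat r k f \<in> binary_mat r k"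
  by (auto simp: binary_mat_def choice_mat_def)

lemma binary_mat_choice:
  assumes M: "M \<in> binary_mat r k" and sum: "\<And>i. i < r \<Longrightarrow> (\<Sum>j<k. M $$ (i, j)) = 1"
  shows "\<exists>f. (\<forall>i<r. f i < k) \<and> M = choice_mat r k f"
proof -
  have bin: "M $$ (i, j) = 0 \<or> M $$ (i, j) = 1" if "i < r" "j < k" for i j
    using M that by (auto simp: binary_mat_def)
  have "\<exists>l<k. \<forall>j<k. M $$ (i, j) = (if j = l then 1 else 0)" if i: "i < r" for i
  proof -
    have "\<exists>l<k. M $$ (i, l) \<noteq> 0"
    proof (rule ccontr)
      assume "\<not> (\<exists>l<k. M $$ (i, l) \<noteq> 0)"
      then have "(\<Sum>j<k. M $$ (i, j)) = 0" by (intro sum.neutral) auto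
      then show False using sum[OF i] by simp
    qed
    then obtain l where l: "l < k" "M $$ (i, l) = 1" using bin[OF i] by blast
    have "(\<Sum>j<k. M $$ (i, j)) = M $$ (i, l) + (\<Sum>j\<in>{..<k} - {l}. M $$ (i, j))"
      using l by (intro sum.remove) auto
    then have "(\<Sum>j\<in>{..<k} - {l}. M $$ (i, j)) = 0" using sum[OF i] l by simp
    moreover have "\<And>j. j \<in> {..<k} - {l} \<Longrightarrow> 0 \<le> M $$ (i, j)"
      using bin[OF i] by (metis Diff_iff lessThan_iff order_refl zero_le_one)
    ultimately have "\<forall>j\<in>{..<k} - {l}. M $$ (i, j) = 0"
      by (subst (asm) sum_nonneg_eq_0_iff) auto
    then show ?thesis using l by (intro exI[of _ l]) auto
  qed
  then obtain f where "\<And>i. i < r \<Longrightarrow> f i < k \<and> (\<forall>j<k. M $$ (i, j) = (if j = f i then 1 else 0))" by metis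
  moreover have "M \<in> carrier_mat r k" using M by (simp add: binary_mat_def)
  ultimately show ?thesis
    by (intro exI[of _ f] conjI eq_matI) (auto simp: choice_mat_def)
qed

lemma total_cost_choice_mat:
  assumes "c \<in> carrier_mat r k" "\<And>i. i < r \<Longrightarrow> f i < k"
  shows "total_cost c (choice_mat r k f) = (\<Sum>i<r. c $$ (i, f i))"
proof -
  have "(\<Sum>j<k. c $$ (i, j) * choice_mat r k f $$ (i, j)) = c $$ (i, f i)" if "i < r" for i
  proof -
    have "(\<Sum>j<k. c $$ (i, j) * choice_mat r k f $$ (i, j)) = (\<Sum>j<k. if j = f i then c $$ (i, j) else 0)"
      using that by (intro sum.cong) (auto simp: choice_mat_index)
    then show ?thesis using assms(2)[OF that] by simp
  qed
  then show ?thesis using assms(1) by (simp add: total_cost_def)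
qed

lemma assignment_feasible_choice_mat:
  assumes "bij_betw z {..<m} {..<m}"
  shows "assignment_feasible m (choice_mat m m z)"
proof -
  have z: "z i < m" if "i < m" for i using bij_betwE[OF assms] that by auto
  have "(\<Sum>i<m. choice_mat m m z $$ (i, j)) = 1" if j: "j < m" for j
  proof -
    have "j \<in> z ` {..<m}" using assms j by (simp add: bij_betw_def)
    then obtain i where i: "i < m" "z i = j" by auto
    have "(\<Sum>i'<m. choice_mat m m z $$ (i', j)) = (\<Sum>i'<m. if i' = i then 1 else 0)"
    proof (intro sum.cong refl)
      fix i' assume i': "i' \<in> {..<m}"
      have "j = z i' \<longleftrightarrow> i' = i"
        using i i' bij_betw_imp_inj_on[OF assms] by (auto dest: inj_onD)
      then show "choice_mat m m z $$ (i', j) = (if i' = i then 1 else 0)"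
        using i' j by (simp add: choice_mat_index)
    qed
    then show ?thesis using i by simp
  qed
  then show ?thesis
    using choice_mat_binary choice_mat_row_sum z by (auto simp: assignment_feasible_def)
qed

lemma assignment_feasibleD:
  assumes "assignment_feasible m Z"
  shows "\<exists>z. bij_betw z {..<m} {..<m} \<and> Z = choice_mat m m z"
proof -
  obtain z where z: "\<And>i. i < m \<Longrightarrow> z i < m" "Z = choice_mat m m z"
    using binary_mat_choice[of Z m m] assms unfolding assignment_feasible_def by blast
  have "j \<in> z ` {..<m}" if j: "j < m" for j
  proof (rule ccontr)
    assume "j \<notin> z ` {..<m}"
    then have "(\<Sum>i<m. Z $$ (i, j)) = 0"
      using z j by (intro sum.neutral) (auto simp: choice_mat_index)
    then show False using assms j by (simp add: assignment_feasible_def)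
  qed
  then have "z ` {..<m} = {..<m}" using z(1) by auto
  then have "bij_betw z {..<m} {..<m}"
    by (simp add: bij_betw_def eq_card_imp_inj_on)
  then show ?thesis using z(2) by blast
qed

lemma ex_optimal_assignment: "\<exists>Z. optimal_assignment m C Z"
proof -
  let ?F = "{Z. assignment_feasible m Z}"
  have "?F \<subseteq> choice_mat m m ` ({..<m} \<rightarrow>\<^sub>E {..<m})"
  proof
    fix Z assume "Z \<in> ?F"
    then obtain z where z: "bij_betw z {..<m} {..<m}" "Z = choice_mat m m z" using assignment_feasibleD by blast
    then have "restrict z {..<m} \<in> {..<m} \<rightarrow>\<^sub>E {..<m}" by (auto simp: bij_betw_def)
    moreover have "Z = choice_mat m m (restrict z {..<m})"
      unfolding z(2) by (intro eq_matI) (auto simp: choice_mat_def)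
    ultimately show "Z \<in> choice_mat m m ` ({..<m} \<rightarrow>\<^sub>E {..<m})" by blast
  qed
  then have "finite ?F" by (rule finite_subset) (intro finite_imageI finite_PiE; simp)
  moreover have "?F \<noteq> {}" using assignment_feasible_choice_mat[of id m] by auto
  ultimately show ?thesis
    unfolding optimal_assignment_def using ex_is_arg_min_if_finite[of ?F "total_cost C"] by simp
qed

lemma partial_optimum_optimal_assignment:
  assumes opt: "partial_optimum m (\<lambda>i j. D i j) m z u v" and C: "C \<in> carrier_mat m m"
    and D: "\<And>i j. i < m \<Longrightarrow> j < m \<Longrightarrow> D i j = C $$ (i, j)"
  shows "bij_betw z {..<m} {..<m}" and "optimal_assignment m C (choice_mat m m z)"
proof -
  have z: "inj_on z {..<m}" "\<And>i. i < m \<Longrightarrow> z i < m \<and> u i + v (z i) = D i (z i)"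
    and feas: "\<And>i j. i < m \<Longrightarrow> j < m \<Longrightarrow> u i + v j \<le> D i j"
    using opt by (auto simp: partial_optimum_def)
  show bij: "bij_betw z {..<m} {..<m}"
    using z endo_inj_surj[of "{..<m}" z] unfolding bij_betw_def by auto
  have reindex: "(\<Sum>i<m. v (y i)) = (\<Sum>j<m. v j)" if "bij_betw y {..<m} {..<m}" for y
    using sum.reindex_bij_betw[OF that] .
  have "total_cost C (choice_mat m m z) \<le> total_cost C Y" if Y: "assignment_feasible m Y" for Y
  proof -
    obtain y where y: "bij_betw y {..<m} {..<m}" "Y = choice_mat m m y" using assignment_feasibleD Y by blast
    have ym: "\<And>i. i < m \<Longrightarrow> y i < m" using bij_betwE[OF y(1)] by auto
    have "total_cost C (choice_mat m m z) = (\<Sum>i<m. u i + v (z i))"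
      using z(2) D by (subst total_cost_choice_mat[OF C]) (auto intro!: sum.cong)
    also have "\<dots> = (\<Sum>i<m. u i + v (y i))"
      using reindex[OF bij] reindex[OF y(1)] by (simp add: sum.distrib)
    also have "\<dots> \<le> (\<Sum>i<m. C $$ (i, y i))"
      using feas ym D by (intro sum_mono) fastforce
    also have "\<dots> = total_cost C Y" using y ym by (simp add: total_cost_choice_mat[OF C])
    finally show ?thesis .
  qed
  then show "optimal_assignment m C (choice_mat m m z)"
    unfolding optimal_assignment_def is_arg_min_def
    using assignment_feasible_choice_mat[OF bij] by (auto simp: not_less)
qed

lemma parent_sccs_disjoint:
  assumes "S \<in> parent_sccs A" "T \<in> parent_sccs A" "x \<in> S" "x \<in> T"
  shows "S = T"
  using assms unfolding in_parent_sccs by blast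

locale sensing =
  fixes m n :: nat and A c :: "real mat" and scc :: "nat \<Rightarrow> nat set"
  assumes inst: "sensing_instance m n A c scc"
begin

abbreviation C :: "real mat" where "C \<equiv> scc_cost m c scc"

lemma A: "A \<in> carrier_mat n n" and full: "structurally_full_rank A" and c: "c \<in> carrier_mat m n"
  and bij: "bij_betw scc {..<m} (parent_sccs A)"
  using inst by (auto simp: sensing_instance_def binary_mat_def)

lemma C: "C \<in> carrier_mat m m"
  by (simp add: scc_cost_def)

lemma scc_parent: "j < m \<Longrightarrow> scc j \<in> parent_sccs A"
  using bij_betwE[OF bij] by simp

lemma scc_subset: "j < m \<Longrightarrow> scc j \<subseteq> {..<n}" and scc_nonempty: "j < m \<Longrightarrow> scc j \<noteq> {}"
  using scc_parent[of j] A unfolding in_parent_sccs by auto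

lemma scc_finite: "j < m \<Longrightarrow> finite (scc j)"
  using scc_subset finite_subset by blast

lemma scc_unique: "i < m \<Longrightarrow> j < m \<Longrightarrow> x \<in> scc i \<Longrightarrow> x \<in> scc j \<Longrightarrow> i = j"
  using parent_sccs_disjoint[OF scc_parent scc_parent] bij_betw_imp_inj_on[OF bij]
  by (metis inj_onD lessThan_iff)

lemma C_le: "i < m \<Longrightarrow> j < m \<Longrightarrow> l \<in> scc j \<Longrightarrow> C $$ (i, j) \<le> c $$ (i, l)"
  by (simp add: scc_cost_def scc_finite)

lemma C_attained: "i < m \<Longrightarrow> j < m \<Longrightarrow> \<exists>l\<in>scc j. c $$ (i, l) = C $$ (i, j)"
proof -
  assume ij: "i < m" "j < m"
  have "Min ((\<lambda>l. c $$ (i, l)) ` scc j) \<in> (\<lambda>l. c $$ (i, l)) ` scc j"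
    using ij scc_finite scc_nonempty by (intro Min_in) auto
  then obtain l where "l \<in> scc j" "Min ((\<lambda>l. c $$ (i, l)) ` scc j) = c $$ (i, l)" by (rule imageE)
  then show ?thesis using ij by (intro bexI[of _ l]) (simp_all add: scc_cost_def)
qed

lemma C_eqI: "i < m \<Longrightarrow> j < m \<Longrightarrow> l \<in> scc j \<Longrightarrow> (\<And>k. k \<in> scc j \<Longrightarrow> c $$ (i, l) \<le> c $$ (i, k)) \<Longrightarrow> c $$ (i, l) = C $$ (i, j)"
  using C_attained[of i j] C_le[of i j l] by (metis order_antisym)

lemma measured_choice:
  assumes "\<And>j. j < m \<Longrightarrow> \<exists>i<m. h i \<in> scc j"
  shows "\<exists>z. bij_betw z {..<m} {..<m} \<and> (\<forall>i<m. h i \<in> scc (z i))"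
proof -
  obtain t where t: "\<And>j. j < m \<Longrightarrow> t j < m \<and> h (t j) \<in> scc j" using assms by metis
  have "inj_on t {..<m}"
    using t scc_unique by (intro inj_onI) (metis lessThan_iff)
  moreover have "t ` {..<m} \<subseteq> {..<m}" using t by auto
  ultimately have b: "bij_betw t {..<m} {..<m}"
    using endo_inj_surj[of "{..<m}" t] unfolding bij_betw_def by auto
  have "h i \<in> scc (inv_into {..<m} t i)" if "i < m" for i
  proof -
    have i: "i \<in> t ` {..<m}" using b that by (simp add: bij_betw_def)
    have "inv_into {..<m} t i < m" using inv_into_into[OF i] by simp
    from t[OF this] show ?thesis using f_inv_into_f[OF i] by simp
  qed
  then show ?thesis using bij_betw_inv_into[OF b] by blast
qed

lemma sensing_feasibleD:
  assumes "sensing_feasible m n A H"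
  shows "\<exists>h z. (\<forall>i<m. h i < n) \<and> H = choice_mat m n h \<and> bij_betw z {..<m} {..<m} \<and> (\<forall>i<m. h i \<in> scc (z i))"
proof -
  obtain h where h: "\<And>i. i < m \<Longrightarrow> h i < n" "H = choice_mat m n h"
    using binary_mat_choice[of H m n] assms unfolding sensing_feasible_def by blast
  have "H \<in> carrier_mat m n" using h by (simp add: choice_mat_def)
  have "\<exists>i<m. h i \<in> scc j" if j: "j < m" for j
  proof -
    obtain i l where il: "i < m" "l \<in> scc j" "H $$ (i, l) \<noteq> 0"
      using structurally_observable_imp_measured[OF A \<open>H \<in> carrier_mat m n\<close> _ scc_parent[OF j]] assms
      unfolding sensing_feasible_def by blast
    then have "l = h i" using h scc_subset[OF j] by (auto simp: choice_mat_index split: if_splits)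
    then show ?thesis using il by blast
  qed
  from measured_choice[OF this] show ?thesis using h by blast
qed

lemma sensing_feasible_choice_mat:
  assumes z: "bij_betw z {..<m} {..<m}" and h: "\<And>i. i < m \<Longrightarrow> h i \<in> scc (z i)"
  shows "sensing_feasible m n A (choice_mat m n h)"
proof -
  have zm: "\<And>i. i < m \<Longrightarrow> z i < m" using bij_betwE[OF z] by auto
  have hn: "h i < n" if "i < m" for i using h[OF that] scc_subset[OF zm[OF that]] by auto
  have inj: "i = i'" if "i < m" "i' < m" "h i = h i'" for i i'
  proof -
    have "z i = z i'" using scc_unique[OF zm[OF that(1)] zm[OF that(2)] h[OF that(1)]] h[OF that(2)] that(3) by simp
    then show ?thesis using bij_betw_imp_inj_on[OF z] that by (auto dest: inj_onD)
  qed
  have "structurally_observable A (choice_mat m n h)"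
  proof (rule measured_imp_structurally_observable[OF A full _ hn])
    fix S assume "S \<in> parent_sccs A"
    then obtain j where "j < m" "S = scc j" using bij by (auto simp: bij_betw_def)
    moreover obtain i where "i < m" "z i = j" using z \<open>j < m\<close> by (metis bij_betw_iff_bijections lessThan_iff)
    ultimately show "\<exists>i<m. h i \<in> S" using h by blast
  qed (auto simp: choice_mat_def)
  moreover have "(\<Sum>i<m. choice_mat m n h $$ (i, l)) \<le> 1" if l: "l < n" for l
  proof (cases "\<exists>i<m. h i = l")
    case True
    then obtain i where i: "i < m" "h i = l" by blast
    have "(\<Sum>i'<m. choice_mat m n h $$ (i', l)) = (\<Sum>i'<m. if i' = i then 1 else 0)"
      using i inj l by (intro sum.cong) (auto simp: choice_mat_index)
    then show ?thesis using i by simp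
  next
    case False
    then have "(\<Sum>i<m. choice_mat m n h $$ (i, l)) = 0"
      using l by (intro sum.neutral) (auto simp: choice_mat_index)
    then show ?thesis by simp
  qed
  ultimately show ?thesis
    unfolding sensing_feasible_def using choice_mat_binary choice_mat_row_sum hn by blast
qed

lemma induced_sensing_choice_mat:
  assumes "\<And>i. i < m \<Longrightarrow> z i < m" "\<And>i. i < m \<Longrightarrow> h i \<in> scc (z i) \<and> c $$ (i, h i) = C $$ (i, z i)"
  shows "induced_sensing m n c scc (choice_mat m m z) (choice_mat m n h)"
proof -
  have hn: "h i < n" if "i < m" for i using assms scc_subset that by blast
  show ?thesis
    unfolding induced_sensing_def
  proof (intro conjI allI impI)
    show "choice_mat m n h \<in> binary_mat m n" by (rule choice_mat_binary)
    fix i assume i: "i < m"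
    show "(\<Sum>l<n. choice_mat m n h $$ (i, l)) = 1" using choice_mat_row_sum i hn by blast
    fix j assume "j < m" "choice_mat m m z $$ (i, j) = 1"
    then have "j = z i" using i by (simp add: choice_mat_index split: if_splits)
    then show "\<exists>l\<in>scc j. c $$ (i, l) = C $$ (i, j) \<and> choice_mat m n h $$ (i, l) = 1"
      using assms(2)[OF i] i hn by (intro bexI[of _ "h i"]) (auto simp: choice_mat_index)
  qed
qed

lemma ex_induced_sensing:
  assumes "assignment_feasible m Z"
  shows "\<exists>H. induced_sensing m n c scc Z H"
proof -
  obtain z where z: "bij_betw z {..<m} {..<m}" "Z = choice_mat m m z" using assignment_feasibleD[OF assms] by blast
  then have zm: "\<And>i. i < m \<Longrightarrow> z i < m" using bij_betwE[OF z(1)] by auto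
  have "\<forall>i\<in>{..<m}. \<exists>l. l \<in> scc (z i) \<and> c $$ (i, l) = C $$ (i, z i)"
    using C_attained zm by blast
  from bchoice[OF this] obtain h where "\<And>i. i < m \<Longrightarrow> h i \<in> scc (z i) \<and> c $$ (i, h i) = C $$ (i, z i)"
    by auto
  with zm have "induced_sensing m n c scc Z (choice_mat m n h)"
    unfolding z(2) by (intro induced_sensing_choice_mat)
  then show ?thesis by blast
qed

lemma induced_sensing_feasible:
  assumes "assignment_feasible m Z" and ind: "induced_sensing m n c scc Z H"
  shows "sensing_feasible m n A H" and "total_cost c H = total_cost C Z"
proof -
  obtain z where z: "bij_betw z {..<m} {..<m}" "Z = choice_mat m m z" using assignment_feasibleD[OF assms(1)] by blast
  then have zm: "\<And>i. i < m \<Longrightarrow> z i < m" using bij_betwE[OF z(1)] by auto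
  obtain h where hn: "\<And>i. i < m \<Longrightarrow> h i < n" and h: "H = choice_mat m n h"
    using binary_mat_choice[of H m n] ind unfolding induced_sensing_def by blast
  have hz: "h i \<in> scc (z i) \<and> c $$ (i, h i) = C $$ (i, z i)" if i: "i < m" for i
  proof -
    have "Z $$ (i, z i) = 1" using z zm i by (simp add: choice_mat_index)
    then obtain l where l: "l \<in> scc (z i)" "c $$ (i, l) = C $$ (i, z i)" "H $$ (i, l) = 1"
      using ind i zm unfolding induced_sensing_def by blast
    then have "l = h i" using h i scc_subset[OF zm[OF i]] by (auto simp: choice_mat_index split: if_splits)
    then show ?thesis using l by blast
  qed
  show "sensing_feasible m n A H" unfolding h using hz by (intro sensing_feasible_choice_mat[OF z(1)]) blast
  show "total_cost c H = total_cost C Z"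
  proof -
    have "total_cost c H = (\<Sum>i<m. c $$ (i, h i))"
      unfolding h by (rule total_cost_choice_mat[OF c]) (rule hn)
    also have "\<dots> = (\<Sum>i<m. C $$ (i, z i))" using hz by (intro sum.cong) auto
    also have "\<dots> = total_cost C Z"
      unfolding z(2) by (rule total_cost_choice_mat[OF C, symmetric]) (rule zm)
    finally show ?thesis .
  qed
qed

lemma sensing_cost_bound:
  assumes "sensing_feasible m n A H"
  shows "\<exists>Z. assignment_feasible m Z \<and> total_cost C Z \<le> total_cost c H"
proof -
  obtain h z where hn: "\<And>i. i < m \<Longrightarrow> h i < n" and H: "H = choice_mat m n h" and z: "bij_betw z {..<m} {..<m}"
    and hz: "\<And>i. i < m \<Longrightarrow> h i \<in> scc (z i)" using sensing_feasibleD[OF assms] by blast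
  have zm: "\<And>i. i < m \<Longrightarrow> z i < m" using bij_betwE[OF z] by auto
  have "(\<Sum>i<m. C $$ (i, z i)) \<le> (\<Sum>i<m. c $$ (i, h i))"
    using C_le zm hz by (intro sum_mono) auto
  moreover have "total_cost c H = (\<Sum>i<m. c $$ (i, h i))"
    unfolding H by (rule total_cost_choice_mat[OF c]) (rule hn)
  moreover have "total_cost C (choice_mat m m z) = (\<Sum>i<m. C $$ (i, z i))"
    by (rule total_cost_choice_mat[OF C]) (rule zm)
  ultimately have "total_cost C (choice_mat m m z) \<le> total_cost c H"
    by simp
  then show ?thesis using assignment_feasible_choice_mat[OF z] by blast
qed

lemma induced_sensing_optimal:
  assumes opt: "optimal_assignment m C Z" and ind: "induced_sensing m n c scc Z H"
  shows "optimal_sensing m n A c H" and "total_cost c H = total_cost C Z"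
proof -
  have Z: "assignment_feasible m Z" and min: "\<And>Y. assignment_feasible m Y \<Longrightarrow> total_cost C Z \<le> total_cost C Y"
    using opt unfolding optimal_assignment_def is_arg_min_def by (auto simp: not_less)
  note ind' = induced_sensing_feasible[OF Z ind]
  show "total_cost c H = total_cost C Z" by (rule ind'(2))
  have "total_cost c H \<le> total_cost c H'" if "sensing_feasible m n A H'" for H'
    using sensing_cost_bound[OF that] min ind'(2) by fastforce
  then show "optimal_sensing m n A c H"
    unfolding optimal_sensing_def is_arg_min_def using ind'(1) by (auto simp: not_less)
qed

end

section \<open>Total correctness on the real RAM\<close>

primrec nwrites :: "com \<Rightarrow> string set" where
  "nwrites Skip = {}"
| "nwrites (NSet x a b e) = {x}"
| "nwrites (RSet x a b e) = {}"
| "nwrites (Seq p q) = nwrites p \<union> nwrites q"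
| "nwrites (If b p q) = nwrites p \<union> nwrites q"
| "nwrites (While b p) = nwrites p"

primrec rwrites :: "com \<Rightarrow> string set" where
  "rwrites Skip = {}"
| "rwrites (NSet x a b e) = {}"
| "rwrites (RSet x a b e) = {x}"
| "rwrites (Seq p q) = rwrites p \<union> rwrites q"
| "rwrites (If b p q) = rwrites p \<union> rwrites q"
| "rwrites (While b p) = rwrites p"

definition frame :: "string set \<Rightarrow> string set \<Rightarrow> state \<Rightarrow> state \<Rightarrow> bool" where
  "frame X Y s s' \<longleftrightarrow> (\<forall>x. x \<notin> X \<longrightarrow> nats s' x = nats s x) \<and> (\<forall>y. y \<notin> Y \<longrightarrow> reals s' y = reals s y)"

lemma frame_nats: "frame X Y s s' \<Longrightarrow> x \<notin> X \<Longrightarrow> nats s' x = nats s x"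
  by (simp add: frame_def)

lemma frame_refl [simp]: "frame X Y s s"
  by (simp add: frame_def)

lemma frame_trans: "frame X Y s s' \<Longrightarrow> frame X' Y' s' s'' \<Longrightarrow> X \<subseteq> Z \<Longrightarrow> X' \<subseteq> Z \<Longrightarrow> Y \<subseteq> W \<Longrightarrow> Y' \<subseteq> W
    \<Longrightarrow> frame Z W s s''"
  unfolding frame_def by (metis subset_iff)

lemma nats_nat_update [simp]:
  "nats (nat_update x i j v s) y = (if y = x then (nats s x)(i := (nats s x i)(j := v)) else nats s y)"
  by (simp add: nat_update_def)

lemma reals_nat_update [simp]: "reals (nat_update x i j v s) = reals s"
  by (simp add: nat_update_def)

lemma reals_real_update [simp]:
  "reals (real_update x i j v s) y = (if y = x then (reals s x)(i := (reals s x i)(j := v)) else reals s y)"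
  by (simp add: real_update_def)

lemma nats_real_update [simp]: "nats (real_update x i j v s) = nats s"
  by (simp add: real_update_def)

lemma exec_frame: "exec p s t s' \<Longrightarrow> frame (nwrites p) (rwrites p) s s'"
proof (induction rule: exec.induct)
  case (Seq p s t s' q t' s'')
  then show ?case by (auto intro: frame_trans)
next
  case (WhileTrue b s p t s' t' s'')
  then show ?case by (auto intro: frame_trans)
qed (auto simp: frame_def)

primrec cost :: "com \<Rightarrow> nat \<Rightarrow> nat" where
  "cost Skip N = 1"
| "cost (NSet x a b e) N = 1 + ntime a + ntime b + ntime e"
| "cost (RSet x a b e) N = 1 + ntime a + ntime b + rtime e"
| "cost (Seq p q) N = cost p N + cost q N"
| "cost (If b p q) N = btime b + cost p N + cost q N"
| "cost (While b p) N = N * (btime b + cost p N) + btime b"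

primrec depth :: "com \<Rightarrow> nat" where
  "depth Skip = 0"
| "depth (NSet x a b e) = 0"
| "depth (RSet x a b e) = 0"
| "depth (Seq p q) = max (depth p) (depth q)"
| "depth (If b p q) = max (depth p) (depth q)"
| "depth (While b p) = Suc (depth p)"

lemma cost_poly: "\<exists>K. \<forall>N. cost p N \<le> K * (N + 1) ^ depth p"
proof (induction p)
  case (Seq p q)
  then obtain K L where K: "\<And>N. cost p N \<le> K * (N + 1) ^ depth p" and L: "\<And>N. cost q N \<le> L * (N + 1) ^ depth q"
    by blast
  have "cost (Seq p q) N \<le> (K + L) * (N + 1) ^ depth (Seq p q)" for N
  proof -
    have "K * (N + 1) ^ depth p \<le> K * (N + 1) ^ depth (Seq p q)"
      by (intro mult_left_mono power_increasing) auto
    moreover have "L * (N + 1) ^ depth q \<le> L * (N + 1) ^ depth (Seq p q)"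
      by (intro mult_left_mono power_increasing) auto
    ultimately show ?thesis
      using K[of N] L[of N] by (simp only: cost.simps distrib_right)
  qed
  then show ?case by blast
next
  case (If b p q)
  then obtain K L where K: "\<And>N. cost p N \<le> K * (N + 1) ^ depth p" and L: "\<And>N. cost q N \<le> L * (N + 1) ^ depth q"
    by blast
  have "cost (If b p q) N \<le> (btime b + K + L) * (N + 1) ^ depth (If b p q)" for N
  proof -
    have "K * (N + 1) ^ depth p \<le> K * (N + 1) ^ depth (If b p q)"
      by (intro mult_left_mono power_increasing) auto
    moreover have "L * (N + 1) ^ depth q \<le> L * (N + 1) ^ depth (If b p q)"
      by (intro mult_left_mono power_increasing) auto
    moreover have "btime b * 1 \<le> btime b * (N + 1) ^ depth (If b p q)"
      by (intro mult_left_mono) auto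
    ultimately show ?thesis
      using K[of N] L[of N] by (simp only: cost.simps distrib_right)
  qed
  then show ?case by blast
next
  case (While b p)
  then obtain K where K: "\<And>N. cost p N \<le> K * (N + 1) ^ depth p"
    by blast
  have "cost (While b p) N \<le> (btime b + K) * (N + 1) ^ depth (While b p)" for N
  proof -
    let ?P = "(N + 1) ^ depth p"
    have "N * cost p N \<le> N * (K * ?P)" by (intro mult_left_mono K) auto
    moreover have "N * btime b * 1 \<le> N * btime b * ?P" and "btime b * 1 \<le> btime b * ?P"
      by (intro mult_left_mono; simp)+
    moreover have "(btime b + K) * (N + 1) ^ depth (While b p)
        = N * (K * ?P) + N * btime b * ?P + btime b * ?P + K * ?P"
      by (simp add: algebra_simps)
    moreover have "cost (While b p) N = N * btime b + N * cost p N + btime b"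
      by (simp add: algebra_simps)
    ultimately show ?thesis
      by linarith
  qed
  then show ?case by blast
qed (auto intro: exI[of _ "_ :: nat"])

text \<open>Bounding every loop by the same \<open>N\<close> makes the time bound a function of the program alone,
  so that only iteration counts have to be tracked in proofs.\<close>

definition run :: "com \<Rightarrow> state \<Rightarrow> nat \<Rightarrow> (state \<Rightarrow> bool) \<Rightarrow> bool" where
  "run p s N Q \<longleftrightarrow> (\<exists>t s'. exec p s t s' \<and> t \<le> cost p N \<and> Q s')"

lemma run_conseq:
  assumes "run p s N Q" and "\<And>s'. Q s' \<Longrightarrow> frame (nwrites p) (rwrites p) s s' \<Longrightarrow> Q' s'"
  shows "run p s N Q'"
  using assms exec_frame unfolding run_def by meson

lemma run_Skip: "Q s \<Longrightarrow> run Skip s N Q"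
  unfolding run_def using exec.Skip[of s] by fastforce

lemma run_NSet: "Q (nat_update x (nval a s) (nval b s) (nval e s) s) \<Longrightarrow> run (NSet x a b e) s N Q"
  unfolding run_def using exec.NSet by fastforce

lemma run_RSet: "Q (real_update x (nval a s) (nval b s) (rval e s) s) \<Longrightarrow> run (RSet x a b e) s N Q"
  unfolding run_def using exec.RSet by fastforce

lemma run_Seq: "run p s N (\<lambda>s'. run q s' N Q) \<Longrightarrow> run (Seq p q) s N Q"
  unfolding run_def using exec.Seq add_mono by (fastforce)

lemma run_If: "(bval b s \<Longrightarrow> run p s N Q) \<Longrightarrow> (\<not> bval b s \<Longrightarrow> run q s N Q) \<Longrightarrow> run (If b p q) s N Q"
  unfolding run_def by (cases "bval b s") (fastforce intro: exec.IfTrue exec.IfFalse)+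

lemma run_While:
  assumes "I k s" "k \<le> N"
    and step: "\<And>k s'. I k s' \<Longrightarrow> bval b s' \<Longrightarrow> frame (nwrites p) (rwrites p) s s' \<Longrightarrow>
      run p s' N (\<lambda>s''. \<exists>k'<k. I k' s'')"
    and fin: "\<And>k s'. I k s' \<Longrightarrow> \<not> bval b s' \<Longrightarrow> frame (nwrites p) (rwrites p) s s' \<Longrightarrow> Q s'"
  shows "run (While b p) s N Q"
proof -
  have "\<exists>t s''. exec (While b p) s' t s'' \<and> t \<le> k * (btime b + cost p N) + btime b \<and> Q s''"
    if "I k s'" "frame (nwrites p) (rwrites p) s s'" for s'
    using that
  proof (induction k arbitrary: s' rule: less_induct)
    case (less k)
    show ?case
    proof (cases "bval b s'")
      case False
      then show ?thesis using fin[OF less.prems(1) False less.prems(2)] exec.WhileFalse by fastforce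
    next
      case True
      from step[OF less.prems(1) True less.prems(2)] obtain t s1 k' where
        1: "exec p s' t s1" "t \<le> cost p N" "k' < k" "I k' s1"
        unfolding run_def by blast
      have "frame (nwrites p) (rwrites p) s s1"
        using less.prems(2) exec_frame[OF 1(1)] by (rule frame_trans) auto
      from less.IH[OF 1(3,4) this] obtain t' s'' where
        2: "exec (While b p) s1 t' s''" "t' \<le> k' * (btime b + cost p N) + btime b" "Q s''" by blast
      have "Suc k' * (btime b + cost p N) \<le> k * (btime b + cost p N)"
        using 1(3) by (intro mult_right_mono) auto
      then have "btime b + t + t' \<le> k * (btime b + cost p N) + btime b"
        using 1(2) 2(2) by simp
      then show ?thesis using exec.WhileTrue[OF True 1(1) 2(1)] 2(3) by blast
    qed
  qed
  from this[OF assms(1)] obtain t s'' where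
    "exec (While b p) s t s''" "t \<le> k * (btime b + cost p N) + btime b" "Q s''" by auto
  moreover have "k * (btime b + cost p N) \<le> N * (btime b + cost p N)"
    using assms(2) by (rule mult_right_mono) simp
  ultimately show ?thesis unfolding run_def cost.simps
    by (intro exI[of _ t] exI[of _ s''] conjI) linarith+
qed

abbreviation scalar :: "string \<Rightarrow> nexp" where
  "scalar x \<equiv> NGet x (NConst 0) (NConst 0)"

abbreviation set_scalar :: "string \<Rightarrow> nexp \<Rightarrow> com" where
  "set_scalar x e \<equiv> NSet x (NConst 0) (NConst 0) e"

definition for_loop :: "string \<Rightarrow> string \<Rightarrow> com \<Rightarrow> com" where
  "for_loop x y p = Seq (set_scalar x (NConst 0))
     (While (NLess (scalar x) (scalar y)) (Seq p (set_scalar x (NPlus (scalar x) (NConst 1)))))"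

lemma nwrites_for_loop [simp]: "nwrites (for_loop x y p) = insert x (nwrites p)"
  and rwrites_for_loop [simp]: "rwrites (for_loop x y p) = rwrites p"
  and depth_for_loop [simp]: "depth (for_loop x y p) = Suc (depth p)"
  by (auto simp: for_loop_def)

lemma run_for_loop:
  assumes vars: "x \<noteq> y" "x \<notin> nwrites p" "y \<notin> nwrites p" and bound: "nats s y 0 0 = M" "M \<le> N"
    and init: "I 0 (nat_update x 0 0 0 s)"
    and step: "\<And>k s'. k < M \<Longrightarrow> nats s' x 0 0 = k \<Longrightarrow> I k s' \<Longrightarrow>
      frame (insert x (nwrites p)) (rwrites p) s s' \<Longrightarrow>
      run p s' N (\<lambda>s''. I (Suc k) (nat_update x 0 0 (Suc k) s''))"
    and fin: "\<And>s'. I M s' \<Longrightarrow> frame (insert x (nwrites p)) (rwrites p) s s' \<Longrightarrow> Q s'"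
  shows "run (for_loop x y p) s N Q"
proof -
  let ?s = "nat_update x 0 0 0 s"
  let ?J = "\<lambda>k s'. \<exists>i. i + k = M \<and> nats s' x 0 0 = i \<and> I i s'"
  have fr: "frame (insert x (nwrites p)) (rwrites p) s s'" if "frame (insert x (nwrites p)) (rwrites p) ?s s'" for s'
    using that by (auto simp: frame_def)
  have y: "nats s' y 0 0 = M" if "frame (insert x (nwrites p)) (rwrites p) ?s s'" for s'
    using frame_nats[OF fr[OF that], of y] vars bound by simp
  show ?thesis
    unfolding for_loop_def
  proof (intro run_Seq run_NSet, simp only: nval.simps, rule run_While[where I = ?J and k = M])
    show "?J M ?s" using init by simp
  next
    show "M \<le> N" by (rule bound(2))
  next
    fix k s' assume 1: "?J k s'" "bval (NLess (scalar x) (scalar y)) s'"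
      and 2: "frame (nwrites (Seq p (set_scalar x (NPlus (scalar x) (NConst 1)))))
        (rwrites (Seq p (set_scalar x (NPlus (scalar x) (NConst 1))))) ?s s'"
    from 2 have 2: "frame (insert x (nwrites p)) (rwrites p) ?s s'" by simp
    from 1 y[OF 2] obtain i where i: "i + k = M" "nats s' x 0 0 = i" "I i s'" "i < M" by auto
    have R: "run p s' N (\<lambda>s''. I (Suc i) (nat_update x 0 0 (Suc i) s''))"
      using step[OF i(4,2,3) fr[OF 2]] .
    show "run (Seq p (set_scalar x (NPlus (scalar x) (NConst 1)))) s' N (\<lambda>s''. \<exists>k'<k. ?J k' s'')"
    proof (rule run_Seq, rule run_conseq[OF R])
      fix s'' assume 3: "I (Suc i) (nat_update x 0 0 (Suc i) s'')" "frame (nwrites p) (rwrites p) s' s''"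
      have "nats s'' x 0 0 = i" using frame_nats[OF 3(2) vars(2)] i by simp
      with 3 i show "run (set_scalar x (NPlus (scalar x) (NConst 1))) s'' N (\<lambda>s''. \<exists>k'<k. ?J k' s'')"
        by (intro run_NSet) (auto intro!: exI[of _ "k - 1"])
    qed
  next
    fix k s' assume 1: "?J k s'" "\<not> bval (NLess (scalar x) (scalar y)) s'"
      and 2: "frame (nwrites (Seq p (set_scalar x (NPlus (scalar x) (NConst 1)))))
        (rwrites (Seq p (set_scalar x (NPlus (scalar x) (NConst 1))))) ?s s'"
    from 2 have 2: "frame (insert x (nwrites p)) (rwrites p) ?s s'" by simp
    from 1 y[OF 2] have "M = nats s' x 0 0" by auto
    with 1 have "I M s'" by auto
    then show "Q s'" using fin fr[OF 2] by blast
  qed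
qed

primrec wp :: "com \<Rightarrow> (state \<Rightarrow> bool) \<Rightarrow> state \<Rightarrow> bool" where
  "wp Skip Q s = Q s"
| "wp (NSet x a b e) Q s = Q (nat_update x (nval a s) (nval b s) (nval e s) s)"
| "wp (RSet x a b e) Q s = Q (real_update x (nval a s) (nval b s) (rval e s) s)"
| "wp (Seq p q) Q s = wp p (wp q Q) s"
| "wp (If b p q) Q s = (if bval b s then wp p Q s else wp q Q s)"
| "wp (While b p) Q s = False"

lemma run_wp: "wp p Q s \<Longrightarrow> run p s N Q"
proof (induction p arbitrary: Q s)
  case (Seq p q)
  then have "run p s N (wp q Q)" by simp
  then show ?case using Seq.IH(2) by (intro run_Seq) (auto elim: run_conseq)
next
  case (If b p q)
  then show ?case by (intro run_If) auto
qed (auto intro: run_Skip run_NSet run_RSet)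

section \<open>The Hungarian method on the RAM\<close>

abbreviation nref :: "string \<Rightarrow> nexp \<Rightarrow> nexp" where "nref x e \<equiv> NGet x e (NConst 0)"
abbreviation rref :: "string \<Rightarrow> nexp \<Rightarrow> rexp" where "rref x e \<equiv> RGet x e (NConst 0)"

text \<open>Column \<open>j\<close> is free when \<open>p j = m\<close>; row \<open>i\<close> is the one being added to the matching.\<close>

definition set_owners :: com where
  "set_owners = Seq
     (for_loop ''j'' ''m'' (NSet ''p'' (scalar ''j'') (NConst 0) (scalar ''m'')))
     (for_loop ''r'' ''i'' (NSet ''p'' (nref ''z'' (scalar ''r'')) (NConst 0) (scalar ''r'')))"

definition start_search :: com where
  "start_search = Seq (RSet ''u'' (scalar ''i'') (NConst 0) (RConst 0)) (Seq (set_scalar ''g'' (NConst 1))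
     (for_loop ''j'' ''m''
       (Seq (RSet ''minv'' (scalar ''j'') (NConst 0) (RMinus (RGet ''C'' (scalar ''i'') (scalar ''j'')) (rref ''v'' (scalar ''j''))))
       (Seq (NSet ''way'' (scalar ''j'') (NConst 0) (scalar ''i''))
            (NSet ''used'' (scalar ''j'') (NConst 0) (NConst 0))))))"

definition select_column :: com where
  "select_column = Seq (set_scalar ''k'' (scalar ''m''))
     (for_loop ''j'' ''m''
       (If (And (NLess (nref ''used'' (scalar ''j'')) (NConst 1))
                (Not (And (NLess (scalar ''k'') (scalar ''m''))
                          (Not (RLess (rref ''minv'' (scalar ''j'')) (rref ''minv'' (scalar ''k'')))))))
          (set_scalar ''k'' (scalar ''j'')) Skip))"

definition dual_update :: com where
  "dual_update = Seq (RSet ''d'' (NConst 0) (NConst 0) (rref ''minv'' (scalar ''k'')))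
     (Seq (RSet ''u'' (scalar ''i'') (NConst 0) (RPlus (rref ''u'' (scalar ''i'')) (rref ''d'' (NConst 0))))
     (for_loop ''j'' ''m''
       (If (NLess (NConst 0) (nref ''used'' (scalar ''j'')))
          (Seq (RSet ''u'' (nref ''p'' (scalar ''j'')) (NConst 0)
                  (RPlus (rref ''u'' (nref ''p'' (scalar ''j''))) (rref ''d'' (NConst 0))))
               (RSet ''v'' (scalar ''j'') (NConst 0) (RMinus (rref ''v'' (scalar ''j'')) (rref ''d'' (NConst 0)))))
          (RSet ''minv'' (scalar ''j'') (NConst 0) (RMinus (rref ''minv'' (scalar ''j'')) (rref ''d'' (NConst 0)))))))"

definition grow_tree :: com where
  "grow_tree = Seq (NSet ''used'' (scalar ''k'') (NConst 0) (NConst 1))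
     (Seq (set_scalar ''e'' (nref ''p'' (scalar ''k'')))
     (for_loop ''j'' ''m''
       (Seq (RSet ''d'' (NConst 0) (NConst 0) (RMinus (RMinus (RGet ''C'' (scalar ''e'') (scalar ''j''))
                (rref ''u'' (scalar ''e''))) (rref ''v'' (scalar ''j''))))
       (If (And (NLess (nref ''used'' (scalar ''j'')) (NConst 1))
                (RLess (rref ''d'' (NConst 0)) (rref ''minv'' (scalar ''j''))))
          (Seq (RSet ''minv'' (scalar ''j'') (NConst 0) (rref ''d'' (NConst 0)))
               (NSet ''way'' (scalar ''j'') (NConst 0) (scalar ''e'')))
          Skip))))"

definition search_step :: com where
  "search_step = Seq select_column (Seq dual_update
     (If (NLess (nref ''p'' (scalar ''k'')) (scalar ''m'')) grow_tree (set_scalar ''g'' (NConst 0))))"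

definition augment :: com where
  "augment = Seq
     (While (NLess (nref ''way'' (scalar ''k'')) (scalar ''i''))
       (Seq (set_scalar ''e'' (nref ''way'' (scalar ''k'')))
       (Seq (set_scalar ''f'' (nref ''z'' (scalar ''e'')))
       (Seq (NSet ''z'' (scalar ''e'') (NConst 0) (scalar ''k''))
            (set_scalar ''k'' (scalar ''f''))))))
     (NSet ''z'' (scalar ''i'') (NConst 0) (scalar ''k''))"

definition stage :: com where
  "stage = Seq set_owners (Seq start_search (Seq (While (NLess (NConst 0) (scalar ''g'')) search_step) augment))"

definition hungarian :: com where
  "hungarian = Seq (for_loop ''j'' ''m'' (RSet ''v'' (scalar ''j'') (NConst 0) (RConst 0)))
     (for_loop ''i'' ''m'' stage)"

definition assign_program :: com where
  "assign_program = Seq hungarian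
     (for_loop ''r'' ''m'' (NSet ''h'' (scalar ''r'') (NConst 0) (NGet ''L'' (scalar ''r'') (nref ''z'' (scalar ''r'')))))"

abbreviation nvec :: "string \<Rightarrow> state \<Rightarrow> nat \<Rightarrow> nat" where "nvec x s \<equiv> \<lambda>j. nats s x j 0"
abbreviation rvec :: "string \<Rightarrow> state \<Rightarrow> nat \<Rightarrow> real" where "rvec x s \<equiv> \<lambda>j. reals s x j 0"

definition used :: "nat \<Rightarrow> state \<Rightarrow> nat set" where
  "used m s = {j. j < m \<and> nats s ''used'' j 0 \<noteq> 0}"

lemma run_set_owners:
  assumes "nats s ''m'' 0 0 = m" "nats s ''i'' 0 0 = i" "i < m" "m \<le> N"
    and opt: "partial_optimum m C i (nvec ''z'' s) u v"
  shows "run set_owners s N (\<lambda>s'. owners m i (nvec ''z'' s) (nvec ''p'' s'))"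
proof -
  let ?z = "nvec ''z'' s"
  have z: "?z r < m" if "r < i" for r using opt that by (simp add: partial_optimum_def)
  have inj: "?z r = ?z r' \<longleftrightarrow> r = r'" if "r < i" "r' < i" for r r'
    using opt that by (auto simp: partial_optimum_def inj_on_def)
  show ?thesis
    unfolding set_owners_def
  proof (rule run_Seq, rule run_for_loop[where M = m and I = "\<lambda>c s'. \<forall>j<c. nats s' ''p'' j 0 = m"])
    fix c s' assume "nats s' ''j'' 0 0 = c" "\<forall>j<c. nats s' ''p'' j 0 = m"
      "frame (insert ''j'' (nwrites (NSet ''p'' (scalar ''j'') (NConst 0) (scalar ''m''))))
        (rwrites (NSet ''p'' (scalar ''j'') (NConst 0) (scalar ''m''))) s s'"
    then show "run (NSet ''p'' (scalar ''j'') (NConst 0) (scalar ''m'')) s' N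
        (\<lambda>s''. \<forall>j<Suc c. nats (nat_update ''j'' 0 0 (Suc c) s'') ''p'' j 0 = m)"
      using assms(1) by (intro run_NSet) (auto simp: frame_def)
  next
    let ?I = "\<lambda>c s'. (\<forall>r<c. nats s' ''p'' (?z r) 0 = r) \<and>
      (\<forall>j<m. nats s' ''p'' j 0 = m \<or> nats s' ''p'' j 0 < i \<and> ?z (nats s' ''p'' j 0) = j)"
    fix s1 assume 1: "\<forall>j<m. nats s1 ''p'' j 0 = m"
      and fr: "frame (insert ''j'' (nwrites (NSet ''p'' (scalar ''j'') (NConst 0) (scalar ''m''))))
        (rwrites (NSet ''p'' (scalar ''j'') (NConst 0) (scalar ''m''))) s s1"
    show "run (for_loop ''r'' ''i'' (NSet ''p'' (nref ''z'' (scalar ''r'')) (NConst 0) (scalar ''r''))) s1 N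
       (\<lambda>s'. owners m i (nvec ''z'' s) (nvec ''p'' s'))"
    proof (rule run_for_loop[where M = i and I = ?I])
      fix c s' assume 2: "c < i" "nats s' ''r'' 0 0 = c" "?I c s'"
        and 3: "frame (insert ''r'' (nwrites (NSet ''p'' (nref ''z'' (scalar ''r'')) (NConst 0) (scalar ''r''))))
          (rwrites (NSet ''p'' (nref ''z'' (scalar ''r'')) (NConst 0) (scalar ''r''))) s1 s'"
      have "nats s' ''z'' = nats s ''z''" using fr 3 by (simp add: frame_def)
      with 2 inj z show "run (NSet ''p'' (nref ''z'' (scalar ''r'')) (NConst 0) (scalar ''r'')) s' N
        (\<lambda>s''. ?I (Suc c) (nat_update ''r'' 0 0 (Suc c) s''))"
        by (intro run_NSet) (auto simp: less_Suc_eq)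
    next
      fix s' :: state assume I: "?I i s'"
      then have "\<forall>j<m. nats s' ''p'' j 0 < m \<longrightarrow> nats s' ''p'' j 0 < i"
        by (metis less_irrefl)
      moreover have "\<forall>j<m. nats s' ''p'' j 0 < i \<longrightarrow> ?z (nats s' ''p'' j 0) = j"
        using I \<open>i < m\<close> by (metis less_asym)
      ultimately show "owners m i ?z (nvec ''p'' s')" using I unfolding owners_def by blast
    qed (use assms 1 fr in \<open>auto simp: frame_def\<close>)
  qed (use assms in auto)
qed

lemma run_start_search:
  assumes "nats s ''m'' 0 0 = m" "nats s ''i'' 0 0 = i" "i < m" "m \<le> N"
  shows "run start_search s N (\<lambda>s'. reals s' ''u'' i 0 = 0 \<and> (\<forall>r. r \<noteq> i \<longrightarrow> reals s' ''u'' r 0 = reals s ''u'' r 0) \<and>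
     nats s' ''g'' 0 0 = 1 \<and>
     (\<forall>j<m. reals s' ''minv'' j 0 = reals s ''C'' i j - reals s ''v'' j 0 \<and> nats s' ''way'' j 0 = i \<and>
        nats s' ''used'' j 0 = 0))"
  unfolding start_search_def
proof (intro run_Seq run_RSet run_NSet, rule run_for_loop[where M = m and I = "\<lambda>c s'.
    (\<forall>j<c. reals s' ''minv'' j 0 = reals s ''C'' i j - reals s ''v'' j 0 \<and> nats s' ''way'' j 0 = i \<and>
        nats s' ''used'' j 0 = 0)"], goal_cases)
  case (7 k s')
  then show ?case using assms by (intro run_wp) (auto simp: frame_def less_Suc_eq)
qed (use assms in \<open>auto simp: frame_def\<close>)

lemma run_select_column:
  assumes "nats s ''m'' 0 0 = m" "m \<le> N" and free: "\<exists>j<m. j \<notin> used m s"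
  shows "run select_column s N (\<lambda>s'. nats s' ''k'' 0 0 < m \<and> nats s' ''k'' 0 0 \<notin> used m s \<and>
     (\<forall>j<m. j \<notin> used m s \<longrightarrow> reals s ''minv'' (nats s' ''k'' 0 0) 0 \<le> reals s ''minv'' j 0))"
  unfolding select_column_def
proof (intro run_Seq run_NSet, rule run_for_loop[where M = m and I = "\<lambda>c s'. let k = nats s' ''k'' 0 0 in
    if k < m then k \<notin> used m s \<and> (\<forall>j<c. j \<notin> used m s \<longrightarrow> reals s ''minv'' k 0 \<le> reals s ''minv'' j 0)
    else (\<forall>j<c. j \<in> used m s)"], goal_cases)
  case (7 c s')
  have eq: "nats s' ''m'' 0 0 = m" "nats s' ''used'' = nats s ''used''" "reals s' ''minv'' = reals s ''minv''"
    using 7(4) assms(1) by (simp_all add: frame_def)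
  have c: "c \<in> used m s \<longleftrightarrow> nats s ''used'' c 0 \<noteq> 0" using 7(1) by (simp add: used_def)
  show ?case
  proof (cases "nats s' ''k'' 0 0 < m")
    case True
    then have "nats s' ''k'' 0 0 \<notin> used m s"
      "\<forall>j<c. j \<notin> used m s \<longrightarrow> reals s ''minv'' (nats s' ''k'' 0 0) 0 \<le> reals s ''minv'' j 0"
      using 7(3) by (simp_all add: Let_def)
    then show "?thesis"
      using True 7(1,2) eq c by (intro run_wp) (auto simp: less_Suc_eq Let_def)
  next
    case False
    then have "\<forall>j<c. j \<in> used m s"
      using 7(3) by (simp add: Let_def)
    then show "?thesis"
      using False 7(1,2) eq c by (intro run_wp) (auto simp: less_Suc_eq Let_def)
  qed
next
  case (8 s')
  then show ?case using free by (auto simp: Let_def split: if_splits)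
qed (use assms in \<open>auto simp: frame_def\<close>)


lemma run_dual_update:
  assumes "nats s ''m'' 0 0 = m" "nats s ''i'' 0 0 = i" "m \<le> N"
    and d: "d = reals s ''minv'' (nats s ''k'' 0 0) 0" and U: "U = used m s"
    and pi: "\<And>j. j \<in> U \<Longrightarrow> nats s ''p'' j 0 \<noteq> i" and inj: "inj_on (nvec ''p'' s) U"
  shows "run dual_update s N (\<lambda>s'.
     (\<forall>r. reals s' ''u'' r 0 = (if in_tree i (nvec ''p'' s) U r then reals s ''u'' r 0 + d else reals s ''u'' r 0)) \<and>
     (\<forall>j<m. reals s' ''v'' j 0 = (if j \<in> U then reals s ''v'' j 0 - d else reals s ''v'' j 0)) \<and>
     (\<forall>j<m. j \<notin> U \<longrightarrow> reals s' ''minv'' j 0 = reals s ''minv'' j 0 - d))"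
  unfolding dual_update_def
proof (intro run_Seq run_RSet, rule run_for_loop[where M = m and I = "\<lambda>c s'. reals s' ''d'' 0 0 = d \<and>
     (\<forall>r. reals s' ''u'' r 0 = (if in_tree i (nvec ''p'' s) (U \<inter> {..<c}) r then reals s ''u'' r 0 + d else reals s ''u'' r 0)) \<and>
     (\<forall>j. reals s' ''v'' j 0 = (if j < c \<and> j \<in> U then reals s ''v'' j 0 - d else reals s ''v'' j 0)) \<and>
     (\<forall>j. reals s' ''minv'' j 0 = (if j < c \<and> j \<notin> U then reals s ''minv'' j 0 - d else reals s ''minv'' j 0))"], goal_cases)
  case (7 c s')
  have eq: "nats s' ''m'' 0 0 = m" "nats s' ''i'' 0 0 = i" "nats s' ''used'' = nats s ''used''" "nats s' ''p'' = nats s ''p''"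
    using 7(4) assms(1,2) by (simp_all add: frame_def)
  have c: "nats s ''used'' c 0 = 0 \<longleftrightarrow> c \<notin> U" using 7(1) U by (simp add: used_def)
  note I = 7(3)
  show ?case
  proof (cases "c \<in> U")
    case True
    have new: "\<not> in_tree i (nvec ''p'' s) (U \<inter> {..<c}) (nats s ''p'' c 0)"
      using pi[OF True] inj True by (auto simp: in_tree_def inj_on_def)
    have ext: "in_tree i (nvec ''p'' s) (U \<inter> {..<Suc c}) r \<longleftrightarrow> r = nats s ''p'' c 0 \<or> in_tree i (nvec ''p'' s) (U \<inter> {..<c}) r" for r
      using True by (auto simp: in_tree_def less_Suc_eq lessThan_Suc)
    show ?thesis
      using I True eq c new 7(2) by (intro run_wp) (auto simp: less_Suc_eq ext)
  next
    case False
    have ext: "(U \<inter> {..<Suc c}) = (U \<inter> {..<c})" using False by (auto simp: lessThan_Suc)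
    show ?thesis
      using I False eq c 7(2) by (intro run_wp) (auto simp: less_Suc_eq ext)
  qed
next
  case (8 s')
  have "U \<inter> {..<m} = U" using U by (auto simp: used_def)
  with 8(1) show ?case by simp
qed (use assms in \<open>auto simp: frame_def in_tree_def\<close>)

lemma run_grow_tree:
  assumes "nats s ''m'' 0 0 = m" "nats s ''k'' 0 0 = k" "k < m" "m \<le> N"
    and e: "e = nats s ''p'' k 0" and U': "U' = insert k (used m s)"
    and c: "\<And>j. c j = reals s ''C'' e j - reals s ''u'' e 0 - reals s ''v'' j 0"
  shows "run grow_tree s N (\<lambda>s'. used m s' = U' \<and>
     (\<forall>j<m. j \<notin> U' \<longrightarrow> reals s' ''minv'' j 0 = min (reals s ''minv'' j 0) (c j)) \<and>
     (\<forall>j<m. nats s' ''way'' j 0 = (if j \<notin> U' \<and> c j < reals s ''minv'' j 0 then e else nats s ''way'' j 0)))"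
  unfolding grow_tree_def
proof (intro run_Seq run_NSet, rule run_for_loop[where M = m and I = "\<lambda>n s'. 
     (\<forall>j. reals s' ''minv'' j 0 = (if j < n \<and> j \<notin> U' then min (reals s ''minv'' j 0) (c j) else reals s ''minv'' j 0)) \<and>
     (\<forall>j. nats s' ''way'' j 0 = (if j < n \<and> j \<notin> U' \<and> c j < reals s ''minv'' j 0 then e else nats s ''way'' j 0))"], goal_cases)
  case (7 n s')
  have eq: "nats s' ''e'' 0 0 = e" "reals s' ''C'' = reals s ''C''" "reals s' ''u'' = reals s ''u''"
    "reals s' ''v'' = reals s ''v''" "nats s' ''used'' n 0 = (if n = k then 1 else nats s ''used'' n 0)"
    using 7(4) assms(2) e by (simp_all add: frame_def)
  have n: "nats s' ''used'' n 0 = 0 \<longleftrightarrow> n \<notin> U'" using 7(1) U' eq by (simp add: used_def)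
  show ?case
    using 7(3) eq(1-4) c n 7(2) by (intro run_wp) (auto simp: less_Suc_eq)
next
  case (8 s')
  have "nats s' ''used'' j 0 = (if j = k then 1 else nats s ''used'' j 0)" for j
    using 8(2) assms(2) by (simp add: frame_def)
  then have "used m s' = U'" using \<open>k < m\<close> U' by (auto simp: used_def)
  with 8(1) show ?case by simp
qed (use assms in \<open>auto simp: frame_def\<close>)


lemma writes_select_column [simp]: "nwrites select_column = {''k'', ''j''}" "rwrites select_column = {}"
  and writes_dual_update [simp]: "nwrites dual_update = {''j''}" "rwrites dual_update = {''d'', ''u'', ''v'', ''minv''}"
  and writes_grow_tree [simp]: "nwrites grow_tree = {''used'', ''e'', ''j'', ''way''}" "rwrites grow_tree = {''d'', ''minv''}"
  and writes_set_owners [simp]: "nwrites set_owners = {''p'', ''j'', ''r''}" "rwrites set_owners = {}"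
  and writes_start_search [simp]: "nwrites start_search = {''g'', ''j'', ''way'', ''used''}" "rwrites start_search = {''u'', ''minv''}"
  and writes_augment [simp]: "nwrites augment = {''e'', ''f'', ''z'', ''k''}" "rwrites augment = {}"
  by (auto simp: select_column_def dual_update_def grow_tree_def set_owners_def start_search_def augment_def)

lemma writes_search_step [simp]:
  "nwrites search_step = {''k'', ''j'', ''used'', ''e'', ''way'', ''g''}" "rwrites search_step = {''d'', ''u'', ''v'', ''minv''}"
  by (auto simp: search_step_def)

lemma writes_stage [simp]:
  "nwrites stage = {''k'', ''j'', ''used'', ''e'', ''way'', ''g'', ''p'', ''r'', ''f'', ''z''}"
  "rwrites stage = {''d'', ''u'', ''v'', ''minv''}"
  by (auto simp: stage_def)

lemma writes_hungarian [simp]: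
  "nwrites hungarian = {''k'', ''j'', ''used'', ''e'', ''way'', ''g'', ''p'', ''r'', ''f'', ''z'', ''i''}"
  "rwrites hungarian = {''d'', ''u'', ''v'', ''minv''}"
  by (auto simp: hungarian_def)

definition search_state where
  "search_state m C i s rk \<longleftrightarrow> nats s ''m'' 0 0 = m \<and> nats s ''i'' 0 0 = i \<and> reals s ''C'' = C \<and>
     search_inv m C i (nvec ''z'' s) (nvec ''p'' s) (rvec ''u'' s) (rvec ''v'' s) (rvec ''minv'' s) (nvec ''way'' s) (used m s) rk"

definition column_found where
  "column_found m C i s k \<longleftrightarrow> k < m \<and> k \<notin> used m s \<and> reals s ''minv'' k 0 = 0 \<and> \<not> nats s ''p'' k 0 < m \<and>
     (\<forall>j<m. reals s ''u'' i 0 + reals s ''v'' j 0 \<le> C i j)"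

lemma run_search_step:
  assumes S: "search_state m C i s rk" and i: "i < m" and N: "m \<le> N" and g: "nats s ''g'' 0 0 = 1"
  shows "run search_step s N (\<lambda>s'. \<exists>rk'. search_state m C i s' rk' \<and>
     (nats s' ''g'' 0 0 = 1 \<and> card (used m s) < card (used m s') \<or>
      nats s' ''g'' 0 0 = 0 \<and> column_found m C i s' (nats s' ''k'' 0 0)))"
proof -
  let ?U = "used m s" and ?p = "nvec ''p'' s"
  note S' = S[unfolded search_state_def]
  then have inv: "search_inv m C i (nvec ''z'' s) ?p (rvec ''u'' s) (rvec ''v'' s) (rvec ''minv'' s) (nvec ''way'' s) ?U rk"
    and m: "nats s ''m'' 0 0 = m" and ni: "nats s ''i'' 0 0 = i" and C: "reals s ''C'' = C" by simp_all
  note D = search_invD[OF inv]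
  have pi: "?p j \<noteq> i" "nats s ''z'' (?p j) 0 = j" if "j \<in> ?U" for j
    using D(2) D(5)[OF that] by (auto simp: owners_def)
  have inj: "inj_on ?p ?U" by (rule inj_on_inverseI[of _ "nvec ''z'' s"]) (rule pi(2))
  show ?thesis
    unfolding search_step_def
  proof (rule run_Seq, rule run_conseq[OF run_select_column[OF m N]])
    show "\<exists>j<m. j \<notin> ?U" using search_free_column(1)[OF inv i] .
    fix s1 assume s1: "nats s1 ''k'' 0 0 < m \<and> nats s1 ''k'' 0 0 \<notin> ?U \<and>
      (\<forall>j<m. j \<notin> ?U \<longrightarrow> reals s ''minv'' (nats s1 ''k'' 0 0) 0 \<le> reals s ''minv'' j 0)"
      and f1: "frame (nwrites select_column) (rwrites select_column) s s1"
    define k where "k = nats s1 ''k'' 0 0"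
    have k: "k < m" "k \<notin> ?U" and kmin: "\<And>j. j < m \<Longrightarrow> j \<notin> ?U \<Longrightarrow> reals s ''minv'' k 0 \<le> reals s ''minv'' j 0"
      using s1 by (simp_all add: k_def)
    have eq1: "nats s1 ''m'' = nats s ''m''" "nats s1 ''i'' = nats s ''i''" "nats s1 ''p'' = nats s ''p''"
      "nats s1 ''used'' = nats s ''used''" "nats s1 ''way'' = nats s ''way''" "nats s1 ''z'' = nats s ''z''" "nats s1 ''g'' = nats s ''g''"
      "reals s1 = reals s" and U1: "used m s1 = ?U"
      using f1 by (auto simp: frame_def used_def)
    show "run (Seq dual_update (If (NLess (nref ''p'' (scalar ''k'')) (scalar ''m'')) grow_tree (set_scalar ''g'' (NConst 0)))) s1 N
      (\<lambda>s'. \<exists>rk'. search_state m C i s' rk' \<and>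
        (nats s' ''g'' 0 0 = 1 \<and> card ?U < card (used m s') \<or>
         nats s' ''g'' 0 0 = 0 \<and> column_found m C i s' (nats s' ''k'' 0 0)))"
    proof (rule run_Seq, rule run_conseq[OF run_dual_update[where U = ?U and m = m and i = i]])
      fix s2 assume s2: "(\<forall>r. reals s2 ''u'' r 0 = (if in_tree i (nvec ''p'' s1) ?U r
            then reals s1 ''u'' r 0 + reals s1 ''minv'' (nats s1 ''k'' 0 0) 0 else reals s1 ''u'' r 0)) \<and>
          (\<forall>j<m. reals s2 ''v'' j 0 = (if j \<in> ?U then reals s1 ''v'' j 0 - reals s1 ''minv'' (nats s1 ''k'' 0 0) 0 else reals s1 ''v'' j 0)) \<and>
          (\<forall>j<m. j \<notin> ?U \<longrightarrow> reals s2 ''minv'' j 0 = reals s1 ''minv'' j 0 - reals s1 ''minv'' (nats s1 ''k'' 0 0) 0)"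
        and f2: "frame (nwrites dual_update) (rwrites dual_update) s1 s2"
      have eq2: "nats s2 ''m'' = nats s ''m''" "nats s2 ''i'' = nats s ''i''" "nats s2 ''p'' = nats s ''p''"
        "nats s2 ''used'' = nats s ''used''" "nats s2 ''way'' = nats s ''way''" "nats s2 ''z'' = nats s ''z''"
        "nats s2 ''g'' = nats s ''g''" "reals s2 ''C'' = reals s ''C''" "nats s2 ''k'' 0 0 = k" and U2: "used m s2 = ?U"
        using f2 eq1 by (auto simp: frame_def used_def k_def)
      have "search_inv m C i (nvec ''z'' s) ?p (rvec ''u'' s2) (rvec ''v'' s2) (rvec ''minv'' s2) (nvec ''way'' s) ?U rk"
        and "reals s2 ''minv'' k 0 = 0" and "\<And>j. j < m \<Longrightarrow> j \<notin> ?U \<Longrightarrow> 0 \<le> reals s2 ''minv'' j 0"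
        and "\<And>j. j < m \<Longrightarrow> reals s2 ''u'' i 0 + reals s2 ''v'' j 0 \<le> C i j"
        by (rule search_dual[OF inv k kmin, of "rvec ''u'' s2" "rvec ''v'' s2" "rvec ''minv'' s2"];
            use s2 in \<open>simp add: eq1 flip: k_def\<close>)+
      note inv2 = this
      show "run (If (NLess (nref ''p'' (scalar ''k'')) (scalar ''m'')) grow_tree (set_scalar ''g'' (NConst 0))) s2 N
        (\<lambda>s'. \<exists>rk'. search_state m C i s' rk' \<and>
          (nats s' ''g'' 0 0 = 1 \<and> card ?U < card (used m s') \<or>
           nats s' ''g'' 0 0 = 0 \<and> column_found m C i s' (nats s' ''k'' 0 0)))"
      proof (rule run_If)
        assume "bval (NLess (nref ''p'' (scalar ''k'')) (scalar ''m'')) s2"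
        then have pk: "?p k < m" using eq2 m by simp
        show "run grow_tree s2 N (\<lambda>s'. \<exists>rk'. search_state m C i s' rk' \<and>
          (nats s' ''g'' 0 0 = 1 \<and> card ?U < card (used m s') \<or>
           nats s' ''g'' 0 0 = 0 \<and> column_found m C i s' (nats s' ''k'' 0 0)))"
        proof (rule run_conseq[OF run_grow_tree[OF _ eq2(9) k(1) N refl refl refl]])
          show "nats s2 ''m'' 0 0 = m" using eq2 m by simp
          fix s3 assume s3: "used m s3 = insert k (used m s2) \<and>
              (\<forall>j<m. j \<notin> insert k (used m s2) \<longrightarrow> reals s3 ''minv'' j 0 = min (reals s2 ''minv'' j 0)
                 (reals s2 ''C'' (nats s2 ''p'' k 0) j - reals s2 ''u'' (nats s2 ''p'' k 0) 0 - reals s2 ''v'' j 0)) \<and>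
              (\<forall>j<m. nats s3 ''way'' j 0 = (if j \<notin> insert k (used m s2) \<and>
                 reals s2 ''C'' (nats s2 ''p'' k 0) j - reals s2 ''u'' (nats s2 ''p'' k 0) 0 - reals s2 ''v'' j 0 < reals s2 ''minv'' j 0
                 then nats s2 ''p'' k 0 else nats s2 ''way'' j 0))"
            and f3: "frame (nwrites grow_tree) (rwrites grow_tree) s2 s3"
          have eq3: "nats s3 ''m'' = nats s ''m''" "nats s3 ''i'' = nats s ''i''" "nats s3 ''p'' = nats s ''p''"
            "nats s3 ''z'' = nats s ''z''" "nats s3 ''g'' = nats s ''g''" "reals s3 ''C'' = reals s ''C''"
            "reals s3 ''u'' = reals s2 ''u''" "reals s3 ''v'' = reals s2 ''v''"
            using f3 eq2 by (auto simp: frame_def)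
          have U3: "used m s3 = insert k ?U" using s3 U2 by simp
          have "search_inv m C i (nvec ''z'' s) ?p (rvec ''u'' s2) (rvec ''v'' s2) (rvec ''minv'' s3) (nvec ''way'' s3)
            (insert k ?U) (rk(?p k := card (insert k ?U)))"
            by (rule search_grow[OF inv2(1) k inv2(2) pk inv2(3,4) refl]) (use s3 in \<open>simp_all add: U2 eq2 C\<close>)
          then have "search_state m C i s3 (rk(?p k := card (insert k ?U)))"
            using m ni C by (simp add: search_state_def U3 eq3)
          moreover have "card ?U < card (used m s3)" using U3 k D(4) by simp
          ultimately show "\<exists>rk'. search_state m C i s3 rk' \<and>
            (nats s3 ''g'' 0 0 = 1 \<and> card ?U < card (used m s3) \<or>
             nats s3 ''g'' 0 0 = 0 \<and> column_found m C i s3 (nats s3 ''k'' 0 0))"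
            using g eq3 by auto
        qed
      next
        assume "\<not> bval (NLess (nref ''p'' (scalar ''k'')) (scalar ''m'')) s2"
        then have pk: "\<not> ?p k < m" using eq2 m by simp
        let ?s = "nat_update ''g'' 0 0 0 s2"
        have "used m ?s = ?U" using U2 by (simp add: used_def)
        then have "search_state m C i ?s rk" "column_found m C i ?s k"
          using inv2 m ni C k pk by (simp_all add: search_state_def column_found_def eq2)
        then show "run (set_scalar ''g'' (NConst 0)) s2 N (\<lambda>s'. \<exists>rk'. search_state m C i s' rk' \<and>
          (nats s' ''g'' 0 0 = 1 \<and> card ?U < card (used m s') \<or>
           nats s' ''g'' 0 0 = 0 \<and> column_found m C i s' (nats s' ''k'' 0 0)))"
          using eq2 by (intro run_NSet) auto
      qed
    qed (use m ni N eq1 U1 pi inj in auto)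
  qed
qed

lemma run_augment:
  assumes S: "search_state m C i s rk" and F: "column_found m C i s (nats s ''k'' 0 0)" and N: "i < m" "m \<le> N"
  shows "run augment s N (\<lambda>s'. partial_optimum m C (Suc i) (nvec ''z'' s') (rvec ''u'' s') (rvec ''v'' s'))"
proof -
  let ?way = "nvec ''way'' s" and ?U = "used m s"
  let ?A = "augment_inv m C i (nvec ''z'' s) (nvec ''p'' s) (rvec ''u'' s) (rvec ''v'' s) ?way ?U rk"
  let ?J = "\<lambda>n s'. ?A (nats s' ''k'' 0 0) (nvec ''z'' s') \<and> n = rk (?way (nats s' ''k'' 0 0))"
  have inv: "search_inv m C i (nvec ''z'' s) (nvec ''p'' s) (rvec ''u'' s) (rvec ''v'' s) (rvec ''minv'' s) ?way ?U rk"
    and i: "nats s ''i'' 0 0 = i" using S by (simp_all add: search_state_def)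
  have A: "?A (nats s ''k'' 0 0) (nvec ''z'' s)"
    by (rule augment_init[OF inv]) (use F N in \<open>auto simp: column_found_def\<close>)
  have R: "rk (?way (nats s ''k'' 0 0)) \<le> N"
    using search_invD(8)[OF inv] A search_free_column(2)[OF inv N(1)] N(2)
    by (meson augment_inv_def less_imp_le_nat order_trans)
  show ?thesis
    unfolding augment_def
  proof (rule run_Seq, rule run_While[where I = ?J and k = "rk (?way (nats s ''k'' 0 0))"], goal_cases)
    case 1
    then show ?case using A by simp
  next
    case 2
    show ?case by (rule R)
  next
    case (3 n s')
    have eq: "nats s' ''way'' = nats s ''way''" "nats s' ''i'' = nats s ''i''" using 3(3) by (simp_all add: frame_def)
    have A': "?A (nats s' ''k'' 0 0) (nvec ''z'' s')" and n: "n = rk (?way (nats s' ''k'' 0 0))" using 3(1) by auto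
    have w: "?way (nats s' ''k'' 0 0) < i" using 3(2) eq i by simp
    have upd: "(nvec ''z'' s')(a := b) = (\<lambda>r. ((nats s' ''z'')(a := (nats s' ''z'' a)(0 := b))) r 0)" for a b
      by auto
    show ?case
      using augment_step(1)[OF inv A' w, unfolded upd] augment_step(2)[OF inv A' w] n eq
      by (intro run_wp) simp
  next
    case (4 n s')
    have eq: "nats s' ''way'' = nats s ''way''" "nats s' ''i'' = nats s ''i''" "reals s' = reals s" 
      using 4(3) by (auto simp: frame_def)
    have A': "?A (nats s' ''k'' 0 0) (nvec ''z'' s')" using 4(1) by auto
    have w: "\<not> ?way (nats s' ''k'' 0 0) < i" using 4(2) eq i by simp
    have "nvec ''z'' (nat_update ''z'' i 0 (nats s' ''k'' 0 0) s') = (nvec ''z'' s')(i := nats s' ''k'' 0 0)" by auto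
    then show ?case
      using augment_end[OF A' inv w] eq i by (intro run_NSet) (simp del: nats_nat_update)
  qed
qed


lemma run_stage:
  assumes m: "nats s ''m'' 0 0 = m" and i: "nats s ''i'' 0 0 = i" "i < m" and C: "reals s ''C'' = C" and N: "m < N"
    and opt: "partial_optimum m C i (nvec ''z'' s) (rvec ''u'' s) (rvec ''v'' s)"
  shows "run stage s N (\<lambda>s'. partial_optimum m C (Suc i) (nvec ''z'' s') (rvec ''u'' s') (rvec ''v'' s'))"
  unfolding stage_def
proof (rule run_Seq, rule run_conseq[OF run_set_owners[OF m i _ opt]])
  show mN: "m \<le> N" using N by simp
  fix s1 assume own: "owners m i (nvec ''z'' s) (nvec ''p'' s1)" and f1: "frame (nwrites set_owners) (rwrites set_owners) s s1"
  have eq1: "nats s1 ''m'' 0 0 = m" "nats s1 ''i'' 0 0 = i" "nats s1 ''z'' = nats s ''z''" "reals s1 = reals s"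
    using f1 m i by (auto simp: frame_def)
  show "run (Seq start_search (Seq (While (NLess (NConst 0) (scalar ''g'')) search_step) augment)) s1 N
    (\<lambda>s'. partial_optimum m C (Suc i) (nvec ''z'' s') (rvec ''u'' s') (rvec ''v'' s'))"
  proof (rule run_Seq, rule run_conseq[OF run_start_search[OF eq1(1,2) i(2) mN]])
    fix s2 assume s2: "reals s2 ''u'' i 0 = 0 \<and> (\<forall>r. r \<noteq> i \<longrightarrow> reals s2 ''u'' r 0 = reals s1 ''u'' r 0) \<and> nats s2 ''g'' 0 0 = 1 \<and>
       (\<forall>j<m. reals s2 ''minv'' j 0 = reals s1 ''C'' i j - reals s1 ''v'' j 0 \<and> nats s2 ''way'' j 0 = i \<and> nats s2 ''used'' j 0 = 0)"
      and f2: "frame (nwrites start_search) (rwrites start_search) s1 s2"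
    have eq2: "nats s2 ''m'' 0 0 = m" "nats s2 ''i'' 0 0 = i" "nats s2 ''z'' = nats s ''z''" "nats s2 ''p'' = nats s1 ''p''"
      "reals s2 ''C'' = C" "reals s2 ''v'' = reals s ''v''"
      using f2 eq1 C by (auto simp: frame_def)
    have "partial_optimum m C i (nvec ''z'' s) (rvec ''u'' s2) (rvec ''v'' s)"
      using opt s2 eq1(4) by (auto simp: partial_optimum_def)
    from search_init[OF this own]
    have "search_inv m C i (nvec ''z'' s) (nvec ''p'' s1) (rvec ''u'' s2) (rvec ''v'' s) (rvec ''minv'' s2) (nvec ''way'' s2) {} (\<lambda>r. 0)"
      using s2 C eq1(4) by (simp add: search_inv_def in_tree_def)
    moreover have "used m s2 = {}" using s2 by (simp add: used_def)
    ultimately have S: "search_state m C i s2 (\<lambda>r. 0)"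
      by (simp add: search_state_def eq2)
    let ?I = "\<lambda>n s'. (\<exists>rk. search_state m C i s' rk) \<and>
       (nats s' ''g'' 0 0 = 1 \<and> n = Suc m - card (used m s') \<or>
        nats s' ''g'' 0 0 = 0 \<and> n = 0 \<and> column_found m C i s' (nats s' ''k'' 0 0))"
    show "run (Seq (While (NLess (NConst 0) (scalar ''g'')) search_step) augment) s2 N
      (\<lambda>s'. partial_optimum m C (Suc i) (nvec ''z'' s') (rvec ''u'' s') (rvec ''v'' s'))"
    proof (rule run_Seq, rule run_While[where I = ?I and k = "Suc m"], goal_cases)
      case 1
      then show ?case using S s2 \<open>used m s2 = {}\<close> by auto
    next
      case 2
      then show ?case using N by simp
    next
      case (3 n s')
      then obtain rk where rk: "search_state m C i s' rk" and g: "nats s' ''g'' 0 0 = 1" and n: "n = Suc m - card (used m s')"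
        by auto
      have "card (used m s') < m" 
        using rk search_free_column(2) i(2) unfolding search_state_def by blast
      then show ?case
        using n by (intro run_conseq[OF run_search_step[OF rk i(2) mN g]]) fastforce
    next
      case (4 n s')
      then obtain rk where "search_state m C i s' rk" "column_found m C i s' (nats s' ''k'' 0 0)" by auto
      then show ?case by (rule run_augment[OF _ _ i(2) mN])
    qed
  qed
qed

lemma run_hungarian:
  assumes m: "nats s ''m'' 0 0 = m" and C: "reals s ''C'' = C" and N: "m < N"
  shows "run hungarian s N (\<lambda>s'. partial_optimum m C m (nvec ''z'' s') (rvec ''u'' s') (rvec ''v'' s'))"
  unfolding hungarian_def
proof (rule run_Seq, rule run_for_loop[where M = m and I = "\<lambda>c s'. True"], goal_cases)
  case (7 k s')
  then show ?case by (intro run_wp) auto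
next
  case (8 s')
  then have eq: "nats s' ''m'' 0 0 = m" "reals s' ''C'' = C" using m C by (auto simp: frame_def)
  show ?case
  proof (rule run_for_loop[where M = m and I = "\<lambda>c s'. partial_optimum m C c (nvec ''z'' s') (rvec ''u'' s') (rvec ''v'' s')"], goal_cases)
    case (7 k s'')
    then have "nats s'' ''m'' 0 0 = m" "reals s'' ''C'' = C" using eq by (auto simp: frame_def)
    from run_conseq[OF run_stage[OF this(1) 7(2,1) this(2) N 7(3)]] show ?case by simp
  qed (use eq N in \<open>auto simp: partial_optimum_def\<close>)
qed (use m N in auto)

lemma run_assign_program:
  assumes m: "nats s ''m'' 0 0 = m" and C: "reals s ''C'' = C" and N: "m < N"
  shows "run assign_program s N (\<lambda>s'. (\<exists>u v. partial_optimum m C m (nvec ''z'' s') u v) \<and>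
    (\<forall>r<m. nats s' ''h'' r 0 = nats s ''L'' r (nats s' ''z'' r 0)))"
  unfolding assign_program_def
proof (rule run_Seq, rule run_conseq[OF run_hungarian[OF m C N]])
  fix s1 assume opt: "partial_optimum m C m (nvec ''z'' s1) (rvec ''u'' s1) (rvec ''v'' s1)"
    and f1: "frame (nwrites hungarian) (rwrites hungarian) s s1"
  have eq: "nats s1 ''m'' 0 0 = m" "nats s1 ''L'' = nats s ''L''" using f1 m by (auto simp: frame_def)
  show "run (for_loop ''r'' ''m'' (NSet ''h'' (scalar ''r'') (NConst 0) (NGet ''L'' (scalar ''r'') (nref ''z'' (scalar ''r''))))) s1 N
     (\<lambda>s'. (\<exists>u v. partial_optimum m C m (nvec ''z'' s') u v) \<and>
       (\<forall>r<m. nats s' ''h'' r 0 = nats s ''L'' r (nats s' ''z'' r 0)))"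
  proof (rule run_for_loop[where M = m and I = "\<lambda>c s'. \<forall>r<c. nats s' ''h'' r 0 = nats s ''L'' r (nats s1 ''z'' r 0)"], goal_cases)
    case (7 k s')
    then show ?case using eq by (intro run_wp) (auto simp: frame_def less_Suc_eq)
  next
    case (8 s')
    then have "nats s' ''z'' = nats s1 ''z''" by (auto simp: frame_def)
    with 8 opt show ?case by auto
  qed (use eq N in auto)
qed

section \<open>Reduction to the assignment problem on the RAM\<close>

definition init_reach :: com where
  "init_reach = for_loop ''i'' ''n'' (Seq
     (for_loop ''j'' ''n'' (NSet ''R'' (scalar ''i'') (scalar ''j'') (NGet ''A'' (scalar ''j'') (scalar ''i''))))
     (NSet ''R'' (scalar ''i'') (scalar ''i'') (NConst 1)))"

definition warshall_cell :: com where
  "warshall_cell = If (And (NLess (NConst 0) (NGet ''R'' (scalar ''i'') (scalar ''k'')))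
                           (NLess (NConst 0) (NGet ''R'' (scalar ''k'') (scalar ''j''))))
     (NSet ''R'' (scalar ''i'') (scalar ''j'') (NConst 1)) Skip"

definition warshall :: com where
  "warshall = for_loop ''k'' ''n'' (for_loop ''i'' ''n'' (for_loop ''j'' ''n'' warshall_cell))"

text \<open>A component is represented by its least state; \<open>j\<close> passes the test iff it is the least state of a parent
  component, i.e. every state reachable from \<open>j\<close> reaches \<open>j\<close> and is at least \<open>j\<close>.\<close>

definition test_representative :: com where
  "test_representative = Seq (set_scalar ''ok'' (NConst 1))
     (for_loop ''i'' ''n''
       (If (And (NLess (NConst 0) (NGet ''R'' (scalar ''j'') (scalar ''i'')))
                (Not (And (NLess (NConst 0) (NGet ''R'' (scalar ''i'') (scalar ''j'')))
                          (Not (NLess (scalar ''i'') (scalar ''j''))))))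
          (set_scalar ''ok'' (NConst 0)) Skip))"

definition cheapest_state :: com where
  "cheapest_state = Seq (NSet ''L'' (scalar ''i'') (scalar ''q'') (scalar ''j''))
     (for_loop ''l'' ''n''
       (If (And (NLess (NConst 0) (NGet ''R'' (scalar ''j'') (scalar ''l'')))
                (RLess (RGet ''c'' (scalar ''i'') (scalar ''l''))
                       (RGet ''c'' (scalar ''i'') (NGet ''L'' (scalar ''i'') (scalar ''q'')))))
          (NSet ''L'' (scalar ''i'') (scalar ''q'') (scalar ''l'')) Skip))"

definition cost_column :: com where
  "cost_column = Seq
     (for_loop ''i'' ''m'' (Seq cheapest_state
        (RSet ''C'' (scalar ''i'') (scalar ''q'')
           (RGet ''c'' (scalar ''i'') (NGet ''L'' (scalar ''i'') (scalar ''q''))))))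
     (set_scalar ''q'' (NPlus (scalar ''q'') (NConst 1)))"

definition reduce_program :: com where
  "reduce_program = Seq init_reach (Seq warshall (Seq (set_scalar ''q'' (NConst 0))
     (for_loop ''j'' ''n'' (Seq test_representative
        (If (NLess (NConst 0) (scalar ''ok'')) cost_column Skip)))))"

lemma writes_reduce [simp]:
  "nwrites init_reach = {''i'', ''j'', ''R''}" "rwrites init_reach = {}"
  "nwrites warshall_cell = {''R''}" "rwrites warshall_cell = {}"
  "nwrites warshall = {''k'', ''i'', ''j'', ''R''}" "rwrites warshall = {}"
  "nwrites test_representative = {''ok'', ''i''}" "rwrites test_representative = {}"
  "nwrites cheapest_state = {''L'', ''l''}" "rwrites cheapest_state = {}"
  "nwrites cost_column = {''L'', ''l'', ''i'', ''q''}" "rwrites cost_column = {''C''}"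
  by (auto simp: init_reach_def warshall_cell_def warshall_def test_representative_def cheapest_state_def cost_column_def)

abbreviation rel :: "state \<Rightarrow> nat \<Rightarrow> nat \<Rightarrow> bool" where
  "rel s \<equiv> \<lambda>i j. 0 < nats s ''R'' i j"

lemma run_init_reach:
  assumes n: "nats s ''n'' 0 0 = n" "n \<le> N"
  shows "run init_reach s N (\<lambda>s'. \<forall>i<n. \<forall>j<n. rel s' i j \<longleftrightarrow> i = j \<or> 0 < nats s ''A'' j i)"
  unfolding init_reach_def
proof (rule run_for_loop[where M = n and I = "\<lambda>c s'. \<forall>i<c. \<forall>j<n. rel s' i j \<longleftrightarrow> i = j \<or> 0 < nats s ''A'' j i"], goal_cases)
  case (7 c s')
  note I = 7(3) and c = 7(1,2)
  have n': "nats s' ''n'' 0 0 = n" using 7(4) n by (simp add: frame_def)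
  have A: "nats s' ''A'' = nats s ''A''" using 7(4) by (simp add: frame_def)
  show ?case
  proof (rule run_Seq, rule run_for_loop[where M = n and I = "\<lambda>d s''.
     (\<forall>i<c. \<forall>j<n. rel s'' i j = rel s' i j) \<and> (\<forall>j<d. rel s'' c j \<longleftrightarrow> 0 < nats s ''A'' j c)"], goal_cases)
    case (7 d s'')
    then have "nats s'' ''A'' = nats s ''A''" "nats s'' ''i'' 0 0 = c" using A c by (simp_all add: frame_def)
    with 7(2,3) c show ?case by (intro run_wp) (auto simp: less_Suc_eq)
  next
    case (8 s'')
    then have "nats s'' ''i'' 0 0 = c" using c by (simp add: frame_def)
    with 8(1) I c show ?case by (intro run_NSet) (auto simp: less_Suc_eq)
  qed (use n' n in auto)
qed (use n in auto)

lemma run_warshall_round: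
  assumes n: "nats s ''n'' 0 0 = n" "n \<le> N" and k: "nats s ''k'' 0 0 = k" "k < n"
  shows "run (for_loop ''i'' ''n'' (for_loop ''j'' ''n'' warshall_cell)) s N
    (\<lambda>s'. \<forall>i<n. \<forall>j<n. rel s' i j \<longleftrightarrow> rel s i j \<or> rel s i k \<and> rel s k j)"
proof (rule run_for_loop[where M = n and I = "\<lambda>c s'. \<forall>i<n. \<forall>j<n. rel s' i j \<longleftrightarrow> rel s i j \<or> i < c \<and> rel s i k \<and> rel s k j"], goal_cases)
  case (7 c s')
  have n': "nats s' ''n'' 0 0 = n" "nats s' ''k'' 0 0 = k" using 7(4) n k by (simp_all add: frame_def)
  show ?case
  proof (rule run_for_loop[where M = n and I = "\<lambda>d s''. \<forall>i<n. \<forall>j<n. rel s'' i j \<longleftrightarrow>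
      rel s i j \<or> (i < c \<or> i = c \<and> j < d) \<and> rel s i k \<and> rel s k j"], goal_cases)
    case (7 d s'')
    have ij: "nats s'' ''i'' 0 0 = c" "nats s'' ''k'' 0 0 = k" "nats s'' ''j'' 0 0 = d"
      using 7(4,2) \<open>nats s' ''i'' 0 0 = c\<close> n' by (simp_all add: frame_def)
    have "rel s'' c k \<longleftrightarrow> rel s c k" "rel s'' k d \<longleftrightarrow> rel s k d"
      using 7(3) \<open>c < n\<close> k \<open>d < n\<close> by blast+
    with 7(3) ij show ?case unfolding warshall_cell_def by (intro run_wp) (auto simp: less_Suc_eq)
  next
    case (8 s'')
    then show ?case by (auto simp: less_Suc_eq)
  qed (use n' n 7(3) in auto)
qed (use n in auto)

lemma run_warshall:
  assumes n: "nats s ''n'' 0 0 = n" "n \<le> N" and refl: "\<And>i. i < n \<Longrightarrow> rel s i i"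
  shows "run warshall s N (\<lambda>s'. \<forall>i<n. \<forall>j<n. rel s' i j \<longleftrightarrow> (\<lambda>i j. i < n \<and> j < n \<and> rel s i j)\<^sup>*\<^sup>* i j)"
proof -
  let ?E = "\<lambda>i j. i < n \<and> j < n \<and> rel s i j"
  let ?I = "\<lambda>c s'. \<forall>i<n. \<forall>j<n. (rel s' i j \<longrightarrow> ?E\<^sup>*\<^sup>* i j) \<and> (rel s i j \<longrightarrow> rel s' i j) \<and>
     (\<forall>l<c. rel s' i l \<longrightarrow> rel s' l j \<longrightarrow> rel s' i j)"
  show ?thesis
    unfolding warshall_def
  proof (rule run_for_loop[where M = n and I = ?I], goal_cases)
    case 6
    show ?case by auto
  next
    case (7 c s')
    have n': "nats s' ''n'' 0 0 = n" using 7(4) n by (simp add: frame_def)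
    note I = 7(3)
    show ?case
    proof (rule run_conseq[OF run_warshall_round[OF n' n(2) 7(2,1)]])
      fix s2 assume R: "\<forall>i<n. \<forall>j<n. rel s2 i j \<longleftrightarrow> rel s' i j \<or> rel s' i c \<and> rel s' c j"
      have "?I (Suc c) s2"
      proof (intro allI impI conjI)
        fix i j assume ij: "i < n" "j < n"
        { assume "rel s2 i j"
          then have "?E\<^sup>*\<^sup>* i j \<or> ?E\<^sup>*\<^sup>* i c \<and> ?E\<^sup>*\<^sup>* c j" using R I ij 7(1) by blast
          then show "?E\<^sup>*\<^sup>* i j" by (meson rtranclp_trans) }
        { assume "rel s i j"
          then show "rel s2 i j" using R I ij by blast }
        fix l assume l: "l < Suc c" "rel s2 i l" "rel s2 l j"
        then have ln: "l < n" using 7(1) by simp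
        have il: "rel s' i l \<or> rel s' i c \<and> rel s' c l" and lj: "rel s' l j \<or> rel s' l c \<and> rel s' c j"
          using R l ln ij by blast+
        have "rel s' i j \<or> rel s' i c \<and> rel s' c j"
        proof (cases "l = c")
          case True
          then show ?thesis using il lj by blast
        next
          case False
          then have "l < c" using l by simp
          then show ?thesis using il lj I ij 7(1) ln by blast
        qed
        then show "rel s2 i j" using R ij by blast
      qed
      then show "?I (Suc c) (nat_update ''k'' 0 0 (Suc c) s2)" by simp
    qed
  next
    case (8 s')
    show ?case
    proof (intro allI impI iffI)
      fix i j assume ij: "i < n" "j < n"
      { assume "rel s' i j" then show "?E\<^sup>*\<^sup>* i j" using 8(1) ij by blast }
      assume "?E\<^sup>*\<^sup>* i j"
      then have "j < n \<and> rel s' i j"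
      proof (induction rule: rtranclp_induct)
        case base
        then show ?case using 8(1) ij refl by blast
      next
        case (step l j)
        then show ?case using 8(1) ij by blast
      qed
      then show "rel s' i j" by blast
    qed
  qed (use n in auto)
qed

definition is_representative :: "nat \<Rightarrow> (nat \<Rightarrow> nat \<Rightarrow> bool) \<Rightarrow> nat \<Rightarrow> bool" where
  "is_representative n P j \<longleftrightarrow> (\<forall>i<n. P j i \<longrightarrow> P i j \<and> j \<le> i)"

lemma run_test_representative:
  assumes n: "nats s ''n'' 0 0 = n" "n \<le> N" and j: "nats s ''j'' 0 0 = j"
  shows "run test_representative s N (\<lambda>s'. 0 < nats s' ''ok'' 0 0 \<longleftrightarrow> is_representative n (rel s) j)"
  unfolding test_representative_def
proof (rule run_Seq, rule run_NSet, rule run_for_loop[where M = n and I = "\<lambda>c s'.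
    0 < nats s' ''ok'' 0 0 \<longleftrightarrow> (\<forall>i<c. rel s j i \<longrightarrow> rel s i j \<and> j \<le> i)"], goal_cases)
  case (7 c s')
  have eq: "nats s' ''j'' 0 0 = j" "nats s' ''R'' = nats s ''R''" using 7(4) j by (simp_all add: frame_def)
  have "(\<forall>i<Suc c. rel s j i \<longrightarrow> rel s i j \<and> j \<le> i) \<longleftrightarrow>
    (\<forall>i<c. rel s j i \<longrightarrow> rel s i j \<and> j \<le> i) \<and> (rel s j c \<longrightarrow> rel s c j \<and> j \<le> c)" by (auto simp: less_Suc_eq)
  then show ?case using 7(2,3) eq by (intro run_wp) (simp add: not_less; linarith?)
qed (use n in \<open>auto simp: is_representative_def\<close>)

lemma run_cheapest_state:
  assumes n: "nats s ''n'' 0 0 = n" "n \<le> N"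
    and i: "nats s ''i'' 0 0 = i" and j: "nats s ''j'' 0 0 = j" "j < n" "rel s j j" and q: "nats s ''q'' 0 0 = q"
  shows "run cheapest_state s N (\<lambda>s'. nats s' ''L'' i q < n \<and> rel s j (nats s' ''L'' i q) \<and>
      (\<forall>l<n. rel s j l \<longrightarrow> reals s ''c'' i (nats s' ''L'' i q) \<le> reals s ''c'' i l) \<and>
      (\<forall>a b. (a, b) \<noteq> (i, q) \<longrightarrow> nats s' ''L'' a b = nats s ''L'' a b))"
  unfolding cheapest_state_def
proof (rule run_Seq, rule run_NSet, rule run_for_loop[where M = n and I = "\<lambda>c s'.
    nats s' ''L'' i q < n \<and> rel s j (nats s' ''L'' i q) \<and>
      (\<forall>l<c. rel s j l \<longrightarrow> reals s ''c'' i (nats s' ''L'' i q) \<le> reals s ''c'' i l) \<and>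
      (\<forall>a b. (a, b) \<noteq> (i, q) \<longrightarrow> nats s' ''L'' a b = nats s ''L'' a b)"], goal_cases)
  case (7 c s')
  have eq: "nats s' ''j'' 0 0 = j" "nats s' ''i'' 0 0 = i" "nats s' ''q'' 0 0 = q"
    "nats s' ''R'' = nats s ''R''" "reals s' ''c'' = reals s ''c''"
    using 7(4) i j q by (simp_all add: frame_def)
  show ?case
  proof (cases "rel s j c \<and> reals s ''c'' i c < reals s ''c'' i (nats s' ''L'' i q)")
    case True
    then show ?thesis using 7(1,2,3) eq by (intro run_wp) (fastforce simp: less_Suc_eq)
  next
    case False
    then show ?thesis using 7(1,2,3) eq by (intro run_wp) (auto simp: less_Suc_eq)
  qed
qed (use n i j q in auto)

lemma run_cost_column:
  assumes n: "nats s ''n'' 0 0 = n" "n \<le> N" and m: "nats s ''m'' 0 0 = m" "m \<le> N"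
    and j: "nats s ''j'' 0 0 = j" "j < n" "rel s j j" and q: "nats s ''q'' 0 0 = q"
  shows "run cost_column s N (\<lambda>s'. nats s' ''q'' 0 0 = Suc q \<and>
     (\<forall>i<m. nats s' ''L'' i q < n \<and> rel s j (nats s' ''L'' i q) \<and>
       reals s' ''C'' i q = reals s ''c'' i (nats s' ''L'' i q) \<and>
       (\<forall>l<n. rel s j l \<longrightarrow> reals s ''c'' i (nats s' ''L'' i q) \<le> reals s ''c'' i l)) \<and>
     (\<forall>a b. b \<noteq> q \<longrightarrow> nats s' ''L'' a b = nats s ''L'' a b \<and> reals s' ''C'' a b = reals s ''C'' a b))"
  unfolding cost_column_def
proof (rule run_Seq, rule run_for_loop[where M = m and I = "\<lambda>c s'.
     (\<forall>i<c. nats s' ''L'' i q < n \<and> rel s j (nats s' ''L'' i q) \<and>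
       reals s' ''C'' i q = reals s ''c'' i (nats s' ''L'' i q) \<and>
       (\<forall>l<n. rel s j l \<longrightarrow> reals s ''c'' i (nats s' ''L'' i q) \<le> reals s ''c'' i l)) \<and>
     (\<forall>a b. b \<noteq> q \<longrightarrow> nats s' ''L'' a b = nats s ''L'' a b \<and> reals s' ''C'' a b = reals s ''C'' a b)"], goal_cases)
  case (7 c s')
  have eq: "nats s' ''n'' 0 0 = n" "nats s' ''j'' 0 0 = j" "nats s' ''q'' 0 0 = q"
    "nats s' ''R'' = nats s ''R''" "reals s' ''c'' = reals s ''c''"
    using 7(4) n j q by (simp_all add: frame_def)
  have jj: "rel s' j j" using j eq by simp
  show ?case
  proof (rule run_Seq, rule run_conseq[OF run_cheapest_state[OF eq(1) n(2) 7(2) eq(2) j(2) jj eq(3)]])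
    fix s2 assume s2: "nats s2 ''L'' c q < n \<and> rel s' j (nats s2 ''L'' c q) \<and>
      (\<forall>l<n. rel s' j l \<longrightarrow> reals s' ''c'' c (nats s2 ''L'' c q) \<le> reals s' ''c'' c l) \<and>
      (\<forall>a b. (a, b) \<noteq> (c, q) \<longrightarrow> nats s2 ''L'' a b = nats s' ''L'' a b)"
      and f2: "frame (nwrites cheapest_state) (rwrites cheapest_state) s' s2"
    have eq2: "nats s2 ''i'' 0 0 = c" "nats s2 ''q'' 0 0 = q" "reals s2 = reals s'"
      using f2 eq 7(2) by (auto simp: frame_def)
    show "run (RSet ''C'' (scalar ''i'') (scalar ''q'') (RGet ''c'' (scalar ''i'') (NGet ''L'' (scalar ''i'') (scalar ''q'')))) s2 N
      (\<lambda>s''. (\<forall>i<Suc c. nats (nat_update ''i'' 0 0 (Suc c) s'') ''L'' i q < n \<and>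
          rel s j (nats (nat_update ''i'' 0 0 (Suc c) s'') ''L'' i q) \<and>
          reals (nat_update ''i'' 0 0 (Suc c) s'') ''C'' i q = reals s ''c'' i (nats (nat_update ''i'' 0 0 (Suc c) s'') ''L'' i q) \<and>
          (\<forall>l<n. rel s j l \<longrightarrow> reals s ''c'' i (nats (nat_update ''i'' 0 0 (Suc c) s'') ''L'' i q) \<le> reals s ''c'' i l)) \<and>
        (\<forall>a b. b \<noteq> q \<longrightarrow> nats (nat_update ''i'' 0 0 (Suc c) s'') ''L'' a b = nats s ''L'' a b \<and>
          reals (nat_update ''i'' 0 0 (Suc c) s'') ''C'' a b = reals s ''C'' a b))"
      using s2 eq2 eq 7(3) by (intro run_RSet) (auto simp: less_Suc_eq)
  qed
next
  case (8 s')
  then have "nats s' ''q'' 0 0 = q" using q by (simp add: frame_def)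
  with 8(1) show ?case by (intro run_NSet) simp
qed (use m in auto)

lemma run_reduce_program:
  assumes n: "nats s ''n'' 0 0 = n" "n \<le> N" and m: "nats s ''m'' 0 0 = m" "m \<le> N"
    and E: "\<And>i j. E i j \<longleftrightarrow> i < n \<and> j < n \<and> 0 < nats s ''A'' j i"
    and reps: "reps = filter (is_representative n E\<^sup>*\<^sup>*) [0..<n]"
  shows "run reduce_program s N (\<lambda>s'. \<forall>k<length reps. \<forall>i<m.
     nats s' ''L'' i k < n \<and> E\<^sup>*\<^sup>* (reps ! k) (nats s' ''L'' i k) \<and>
     reals s' ''C'' i k = reals s ''c'' i (nats s' ''L'' i k) \<and>
     (\<forall>l<n. E\<^sup>*\<^sup>* (reps ! k) l \<longrightarrow> reals s ''c'' i (nats s' ''L'' i k) \<le> reals s ''c'' i l))"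
  unfolding reduce_program_def
proof (rule run_Seq, rule run_conseq[OF run_init_reach[OF n]])
  fix s1 assume s1: "\<forall>i<n. \<forall>j<n. rel s1 i j \<longleftrightarrow> i = j \<or> 0 < nats s ''A'' j i"
    and f1: "frame (nwrites init_reach) (rwrites init_reach) s s1"
  have eq1: "nats s1 ''n'' 0 0 = n" "nats s1 ''m'' 0 0 = m" "reals s1 = reals s" using f1 n m by (auto simp: frame_def)
  let ?rest = "Seq (set_scalar ''q'' (NConst 0)) (for_loop ''j'' ''n'' (Seq test_representative
     (If (NLess (NConst 0) (scalar ''ok'')) cost_column Skip)))"
  let ?Q = "\<lambda>s' (k, r). \<forall>i<m. nats s' ''L'' i k < n \<and> E\<^sup>*\<^sup>* r (nats s' ''L'' i k) \<and>
     reals s' ''C'' i k = reals s ''c'' i (nats s' ''L'' i k) \<and>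
     (\<forall>l<n. E\<^sup>*\<^sup>* r l \<longrightarrow> reals s ''c'' i (nats s' ''L'' i k) \<le> reals s ''c'' i l)"
  let ?reps = "\<lambda>c. filter (is_representative n E\<^sup>*\<^sup>*) [0..<c]"
  have EE: "(\<lambda>i j. i < n \<and> j < n \<and> rel s1 i j)\<^sup>*\<^sup>* = E\<^sup>*\<^sup>*"
  proof -
    have "(\<lambda>i j. i < n \<and> j < n \<and> rel s1 i j)\<^sup>=\<^sup>= = E\<^sup>=\<^sup>="
    proof (intro ext)
      fix i j
      have "i < n \<and> j < n \<and> rel s1 i j \<or> i = j \<longleftrightarrow> E i j \<or> i = j" using s1 unfolding E by blast
      then show "(\<lambda>i j. i < n \<and> j < n \<and> rel s1 i j)\<^sup>=\<^sup>= i j = E\<^sup>=\<^sup>= i j" by simp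
    qed
    from arg_cong[OF this, of rtranclp] show ?thesis by (simp only: rtranclp_reflclp)
  qed
  show "run (Seq warshall ?rest) s1 N (\<lambda>s'. \<forall>k<length reps. \<forall>i<m.
     nats s' ''L'' i k < n \<and> E\<^sup>*\<^sup>* (reps ! k) (nats s' ''L'' i k) \<and>
     reals s' ''C'' i k = reals s ''c'' i (nats s' ''L'' i k) \<and>
     (\<forall>l<n. E\<^sup>*\<^sup>* (reps ! k) l \<longrightarrow> reals s ''c'' i (nats s' ''L'' i k) \<le> reals s ''c'' i l))"
  proof (rule run_Seq, rule run_conseq[OF run_warshall[OF eq1(1) n(2)]])
    show "\<And>i. i < n \<Longrightarrow> rel s1 i i" using s1 by simp
    fix s2 assume s2: "\<forall>i<n. \<forall>j<n. rel s2 i j \<longleftrightarrow> (\<lambda>i j. i < n \<and> j < n \<and> rel s1 i j)\<^sup>*\<^sup>* i j"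
      and f2: "frame (nwrites warshall) (rwrites warshall) s1 s2"
    then have R: "\<And>i j. i < n \<Longrightarrow> j < n \<Longrightarrow> rel s2 i j \<longleftrightarrow> E\<^sup>*\<^sup>* i j" using EE by simp
    have eq2: "nats s2 ''n'' 0 0 = n" "nats s2 ''m'' 0 0 = m" "reals s2 = reals s"
      using f2 eq1 by (auto simp: frame_def)
    show "run ?rest s2 N (\<lambda>s'. \<forall>k<length reps. \<forall>i<m.
       nats s' ''L'' i k < n \<and> E\<^sup>*\<^sup>* (reps ! k) (nats s' ''L'' i k) \<and>
       reals s' ''C'' i k = reals s ''c'' i (nats s' ''L'' i k) \<and>
       (\<forall>l<n. E\<^sup>*\<^sup>* (reps ! k) l \<longrightarrow> reals s ''c'' i (nats s' ''L'' i k) \<le> reals s ''c'' i l))"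
    proof (rule run_Seq, rule run_NSet, rule run_for_loop[where M = n and I = "\<lambda>c s'. nats s' ''q'' 0 0 = length (?reps c) \<and>
        (\<forall>k<length (?reps c). ?Q s' (k, ?reps c ! k))"], goal_cases)
      case (7 c s3)
      have eq3: "nats s3 ''n'' 0 0 = n" "nats s3 ''m'' 0 0 = m" "nats s3 ''R'' = nats s2 ''R''" "reals s3 ''c'' = reals s ''c''"
        using 7(4) eq2 by (simp_all add: frame_def)
      note I = 7(3) and c = 7(1,2)
      have R3: "\<And>i j. i < n \<Longrightarrow> j < n \<Longrightarrow> rel s3 i j \<longleftrightarrow> E\<^sup>*\<^sup>* i j" using R eq3 by simp
      have rep: "is_representative n (rel s3) c = is_representative n E\<^sup>*\<^sup>* c"
        using R3 c unfolding is_representative_def by blast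
      show ?case
      proof (rule run_Seq, rule run_conseq[OF run_test_representative[OF eq3(1) n(2) c(2)]])
        fix s4 assume "0 < nats s4 ''ok'' 0 0 \<longleftrightarrow> is_representative n (rel s3) c"
          and f4: "frame (nwrites test_representative) (rwrites test_representative) s3 s4"
        then have ok: "0 < nats s4 ''ok'' 0 0 \<longleftrightarrow> is_representative n E\<^sup>*\<^sup>* c" using rep by simp
        have eq4: "nats s4 ''n'' 0 0 = n" "nats s4 ''m'' 0 0 = m" "nats s4 ''R'' = nats s2 ''R''" "reals s4 = reals s3"
          "nats s4 ''j'' 0 0 = c" "nats s4 ''q'' 0 0 = length (?reps c)" "nats s4 ''L'' = nats s3 ''L''"
          using f4 eq3 c I by (auto simp: frame_def)
        show "run (If (NLess (NConst 0) (scalar ''ok'')) cost_column Skip) s4 N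
          (\<lambda>s'. nats (nat_update ''j'' 0 0 (Suc c) s') ''q'' 0 0 = length (?reps (Suc c)) \<and>
            (\<forall>k<length (?reps (Suc c)). ?Q (nat_update ''j'' 0 0 (Suc c) s') (k, ?reps (Suc c) ! k)))"
        proof (rule run_If)
          assume "bval (NLess (NConst 0) (scalar ''ok'')) s4"
          then have r: "is_representative n E\<^sup>*\<^sup>* c" using ok by simp
          have cc: "rel s4 c c" using R c eq4 by simp
          show "run cost_column s4 N
            (\<lambda>s'. nats (nat_update ''j'' 0 0 (Suc c) s') ''q'' 0 0 = length (?reps (Suc c)) \<and>
              (\<forall>k<length (?reps (Suc c)). ?Q (nat_update ''j'' 0 0 (Suc c) s') (k, ?reps (Suc c) ! k)))"
          proof (rule run_conseq[OF run_cost_column[OF eq4(1) n(2) eq4(2) m(2) eq4(5) c(1) cc eq4(6)]])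
            fix s5 :: state assume s5: "nats s5 ''q'' 0 0 = Suc (length (?reps c)) \<and>
               (\<forall>i<m. nats s5 ''L'' i (length (?reps c)) < n \<and> rel s4 c (nats s5 ''L'' i (length (?reps c))) \<and>
                 reals s5 ''C'' i (length (?reps c)) = reals s4 ''c'' i (nats s5 ''L'' i (length (?reps c))) \<and>
                 (\<forall>l<n. rel s4 c l \<longrightarrow> reals s4 ''c'' i (nats s5 ''L'' i (length (?reps c))) \<le> reals s4 ''c'' i l)) \<and>
               (\<forall>a b. b \<noteq> length (?reps c) \<longrightarrow> nats s5 ''L'' a b = nats s4 ''L'' a b \<and> reals s5 ''C'' a b = reals s4 ''C'' a b)"
            have new: "?Q s5 (length (?reps c), c)" using s5 R c eq4 eq3 by auto
            have old: "?Q s5 (k, ?reps c ! k)" if "k < length (?reps c)" for k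
              using I s5 that eq4 by auto
            have app: "?reps (Suc c) = ?reps c @ [c]" using r by simp
            have "?Q s5 (k, ?reps (Suc c) ! k)" if "k < length (?reps (Suc c))" for k
            proof (cases "k < length (?reps c)")
              case True
              then have "?reps (Suc c) ! k = ?reps c ! k" unfolding app by (rule nth_append_left)
              with old[OF True] show ?thesis by simp
            next
              case False
              then have "k = length (?reps c)" using that app by simp
              moreover from this have "?reps (Suc c) ! k = c" unfolding app by simp
              ultimately show ?thesis using new by simp
            qed
            then show "nats (nat_update ''j'' 0 0 (Suc c) s5) ''q'' 0 0 = length (?reps (Suc c)) \<and>
              (\<forall>k<length (?reps (Suc c)). ?Q (nat_update ''j'' 0 0 (Suc c) s5) (k, ?reps (Suc c) ! k))"
              using s5 app by simp
          qed
        next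
          assume "\<not> bval (NLess (NConst 0) (scalar ''ok'')) s4"
          then have "?reps (Suc c) = ?reps c" using ok by simp
          then show "run Skip s4 N
            (\<lambda>s'. nats (nat_update ''j'' 0 0 (Suc c) s') ''q'' 0 0 = length (?reps (Suc c)) \<and>
              (\<forall>k<length (?reps (Suc c)). ?Q (nat_update ''j'' 0 0 (Suc c) s') (k, ?reps (Suc c) ! k)))"
            using I eq4 by (intro run_Skip) simp
        qed
      qed
    next
      case (8 s')
      then show ?case using reps by simp
    qed (use eq2 n in auto)
  qed
qed

section \<open>Correctness and running time of the two programs\<close>

lemma cost_bigo: "(\<lambda>n. real (cost p (n + b))) \<in> O(\<lambda>n. real n ^ depth p)"
proof -
  obtain K where K: "\<And>N. cost p N \<le> K * (N + 1) ^ depth p" using cost_poly by blast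
  have "norm (real (cost p (n + b))) \<le> real (K * (b + 2) ^ depth p) * norm (real n ^ depth p)" if n: "1 \<le> n" for n
  proof -
    have "b \<le> b * n" using n by simp
    moreover have "(b + 2) * n = b * n + 2 * n" by (rule distrib_right)
    ultimately have "n + b + 1 \<le> (b + 2) * n" using n by linarith
    then have "cost p (n + b) \<le> K * ((b + 2) * n) ^ depth p"
      using K[of "n + b"] by (meson le_trans mult_le_mono2 power_mono zero_le)
    then have "real (cost p (n + b)) \<le> real (K * ((b + 2) * n) ^ depth p)" by (rule of_nat_mono)
    also have "\<dots> = real (K * (b + 2) ^ depth p) * real n ^ depth p"
      by (simp only: power_mult_distrib of_nat_mult of_nat_power mult.assoc)
    finally show ?thesis by simp
  qed
  then show ?thesis
    by (intro bigoI[of _ "real (K * (b + 2) ^ depth p)"] eventually_mono[OF eventually_ge_at_top[of 1]])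
qed

lemma depth_reduce_program: "depth reduce_program = 3"
  by (simp add: reduce_program_def init_reach_def warshall_def warshall_cell_def test_representative_def
      cheapest_state_def cost_column_def)

lemma depth_assign_program: "depth assign_program = 3"
  by (simp add: assign_program_def hungarian_def stage_def set_owners_def start_search_def search_step_def
      select_column_def dual_update_def grow_tree_def augment_def)

lemma bij_betw_representatives:
  fixes A :: "real mat"
  defines "R \<equiv> (edge A)\<^sup>*\<^sup>*"
  defines "reps \<equiv> filter (is_representative (dim_row A) R) [0..<dim_row A]"
  shows "bij_betw (\<lambda>k. {l. R (reps ! k) l}) {..<length reps} (parent_sccs A)"
  unfolding bij_betw_def
proof (intro conjI subset_antisym subsetI inj_onI)
  have rep: "reps ! k < dim_row A" "is_representative (dim_row A) R (reps ! k)" if "k < length reps" for k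
    using nth_mem[OF that] by (auto simp: reps_def)
  have less: "R u w \<Longrightarrow> u < dim_row A \<Longrightarrow> w < dim_row A" for u w unfolding R_def by (rule edge_rtranclp_less)
  have trans: "R u v \<Longrightarrow> R v w \<Longrightarrow> R u w" for u v w unfolding R_def by (rule rtranclp_trans)
  have refl: "R u u" for u unfolding R_def by simp
  { fix j k assume j: "j \<in> {..<length reps}" and k: "k \<in> {..<length reps}" and eq: "{l. R (reps ! j) l} = {l. R (reps ! k) l}"
    then have "R (reps ! j) (reps ! k)" "R (reps ! k) (reps ! j)" using refl by blast+
    then have "reps ! j = reps ! k" using rep j k unfolding is_representative_def by (metis lessThan_iff order_antisym)
    moreover have "distinct reps" by (simp add: reps_def)
    ultimately show "j = k" using j k by (simp add: nth_eq_iff_index_eq)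
  }
  { fix S assume "S \<in> (\<lambda>k. {l. R (reps ! k) l}) ` {..<length reps}"
    then obtain k where k: "k < length reps" and S: "S = {l. R (reps ! k) l}" by auto
    have to_rep: "R l (reps ! k)" if "l \<in> S" for l
      using that rep[OF k] less unfolding S is_representative_def by blast
    have "S = {w. R u w}" if "u \<in> S" for u using that to_rep trans unfolding S by blast
    then show "S \<in> parent_sccs A"
      unfolding in_parent_sccs using less rep(1)[OF k] refl unfolding S R_def by blast
  }
  { fix S assume "S \<in> parent_sccs A"
    then have S: "S \<noteq> {}" "S \<subseteq> {..<dim_row A}" "\<And>u. u \<in> S \<Longrightarrow> S = {w. R u w}"
      unfolding in_parent_sccs R_def by blast+
    have fin: "finite S" using S(2) finite_subset by blast
    define u where "u = Min S"
    have u: "u \<in> S" using Min_in[OF fin S(1)] by (simp add: u_def)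
    have "is_representative (dim_row A) R u"
      unfolding is_representative_def
    proof (intro allI impI)
      fix i assume "R u i"
      then have i: "i \<in> S" using S(3)[OF u] by blast
      then show "R i u \<and> u \<le> i" using S(3)[OF i] u fin by (auto simp: u_def)
    qed
    then have "u \<in> set reps" using u S(2) by (auto simp: reps_def)
    then obtain k where "k < length reps" "reps ! k = u" by (metis in_set_conv_nth)
    then show "S \<in> (\<lambda>k. {l. R (reps ! k) l}) ` {..<length reps}" using S(3)[OF u] by auto
  }
qed

lemma exec_reduce_program:
  assumes inst: "sensing_instance m n A c scc" and st: "stores_sensing m n A c s"
  shows "\<exists>t s' scc'. exec reduce_program s t s' \<and> t \<le> cost reduce_program n \<and>
    sensing_instance m n A c scc' \<and> stores_assignment m c scc' s'"
proof -
  let ?R = "(edge A)\<^sup>*\<^sup>*"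
  define reps where "reps = filter (is_representative n ?R) [0..<n]"
  define scc' where "scc' k = {l. ?R (reps ! k) l}" for k
  have dim: "dim_row A = n" using inst by (auto simp: sensing_instance_def binary_mat_def)
  have bij: "bij_betw scc' {..<length reps} (parent_sccs A)"
    using bij_betw_representatives[of A] unfolding dim reps_def[symmetric] scc'_def[abs_def] .
  have "card {..<length reps} = card {..<m}"
    using bij_betw_same_card[OF bij] inst by (metis bij_betw_same_card sensing_instance_def)
  then have len: "length reps = m" by simp
  have inst': "sensing_instance m n A c scc'" using inst bij len by (simp add: sensing_instance_def)
  have "m \<le> n" using len length_filter_le[of "is_representative n ?R" "[0..<n]"] by (simp add: reps_def)
  have st': "nats s ''n'' 0 0 = n" "nats s ''m'' 0 0 = m" using st by (simp_all add: stores_sensing_def)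
  have E: "edge A i j \<longleftrightarrow> i < n \<and> j < n \<and> 0 < nats s ''A'' j i" for i j
    using st dim by (auto simp: stores_sensing_def edge_def)
  have "run reduce_program s n (\<lambda>s'. stores_assignment m c scc' s')"
  proof (rule run_conseq[OF run_reduce_program[OF st'(1) order_refl st'(2) \<open>m \<le> n\<close> E reps_def]])
    fix s' assume P: "\<forall>k<length reps. \<forall>i<m. nats s' ''L'' i k < n \<and> ?R (reps ! k) (nats s' ''L'' i k) \<and>
       reals s' ''C'' i k = reals s ''c'' i (nats s' ''L'' i k) \<and>
       (\<forall>l<n. ?R (reps ! k) l \<longrightarrow> reals s ''c'' i (nats s' ''L'' i k) \<le> reals s ''c'' i l)"
      and fr: "frame (nwrites reduce_program) (rwrites reduce_program) s s'"
    interpret sensing m n A c scc' by unfold_locales (rule inst')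
    have "nats s' ''m'' 0 0 = m" using frame_nats[OF fr, of "''m''"] st'(2) by (simp add: reduce_program_def)
    moreover have "reals s' ''C'' i k = C $$ (i, k) \<and> nats s' ''L'' i k \<in> scc' k \<and> c $$ (i, nats s' ''L'' i k) = C $$ (i, k)"
      if i: "i < m" and k: "k < m" for i k
    proof -
      have cc: "reals s ''c'' i l = c $$ (i, l)" if "l < n" for l using st i that by (simp add: stores_sensing_def)
      have Lk: "nats s' ''L'' i k < n" "nats s' ''L'' i k \<in> scc' k" "reals s' ''C'' i k = c $$ (i, nats s' ''L'' i k)"
        using P i k cc len by (auto simp: scc'_def)
      moreover have "c $$ (i, nats s' ''L'' i k) \<le> c $$ (i, l)" if "l \<in> scc' k" for l
      proof -
        have "l < n" "?R (reps ! k) l" using that scc_subset[OF k] by (auto simp: scc'_def)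
        then show ?thesis using P i k cc Lk(1) len by metis
      qed
      ultimately show ?thesis using C_eqI[OF i k] by metis
    qed
    ultimately show "stores_assignment m c scc' s'" by (simp add: stores_assignment_def)
  qed
  then show ?thesis using inst' unfolding run_def by blast
qed

lemma exec_assign_program:
  assumes inst: "sensing_instance m n A c scc" and st: "stores_assignment m c scc s"
  shows "\<exists>t s'. exec assign_program s t s' \<and> t \<le> cost assign_program (m + 1) \<and>
    optimal_assignment m (scc_cost m c scc) (stored_assignment m s') \<and>
    induced_sensing m n c scc (stored_assignment m s') (stored_placement m n s') \<and>
    optimal_sensing m n A c (stored_placement m n s')"
proof -
  interpret sensing m n A c scc by unfold_locales (rule inst)
  have m: "nats s ''m'' 0 0 = m" using st by (simp add: stores_assignment_def)
  have "m < m + 1" by simp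
  from run_assign_program[OF m refl this] obtain t s' where ex: "exec assign_program s t s'" "t \<le> cost assign_program (m + 1)"
    and opt: "\<exists>u v. partial_optimum m (reals s ''C'') m (nvec ''z'' s') u v"
    and h: "\<And>r. r < m \<Longrightarrow> nats s' ''h'' r 0 = nats s ''L'' r (nats s' ''z'' r 0)"
    unfolding run_def by blast
  let ?z = "nvec ''z'' s'" and ?h = "nvec ''h'' s'"
  obtain u v where "partial_optimum m (\<lambda>i j. reals s ''C'' i j) m ?z u v" using opt by auto
  from partial_optimum_optimal_assignment[OF this C]
  have z: "bij_betw ?z {..<m} {..<m}" and oz: "optimal_assignment m C (choice_mat m m ?z)"
    using st by (simp_all add: stores_assignment_def)
  have zm: "\<And>i. i < m \<Longrightarrow> ?z i < m" using bij_betwE[OF z] by auto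
  have Z: "stored_assignment m s' = choice_mat m m ?z" and H: "stored_placement m n s' = choice_mat m n ?h"
    by (simp_all add: stored_assignment_def stored_placement_def choice_mat_def)
  have "?h i \<in> scc (?z i) \<and> c $$ (i, ?h i) = C $$ (i, ?z i)" if "i < m" for i
    using st h[OF that] zm[OF that] that by (simp add: stores_assignment_def)
  then have ind: "induced_sensing m n c scc (choice_mat m m ?z) (choice_mat m n ?h)"
    by (intro induced_sensing_choice_mat zm)
  show ?thesis using ex oz ind induced_sensing_optimal(1)[OF oz ind] unfolding Z[symmetric] H[symmetric] by blast
qed

theorem mainTheorem1:
  shows
    "(\<forall>m n A c scc. sensing_instance m n A c scc \<longrightarrow>
        (\<exists>H Z. optimal_sensing m n A c H \<and> optimal_assignment m (scc_cost m c scc) Z \<and>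
               total_cost c H = total_cost (scc_cost m c scc) Z) \<and>
        (\<forall>Z. optimal_assignment m (scc_cost m c scc) Z \<longrightarrow>
               (\<exists>H. induced_sensing m n c scc Z H) \<and>
               (\<forall>H. induced_sensing m n c scc Z H \<longrightarrow> optimal_sensing m n A c H))) \<and>
     (\<exists>(reduce :: com) (assign :: com) (T_red :: nat \<Rightarrow> nat) (T_asg :: nat \<Rightarrow> nat) (d :: nat).
        (\<lambda>n. real (T_red n)) \<in> O(\<lambda>n. real n ^ d) \<and>
        (\<lambda>m. real (T_asg m)) \<in> O(\<lambda>m. real m ^ 3) \<and>
        (\<forall>m n A c scc s. sensing_instance m n A c scc \<and> stores_sensing m n A c s \<longrightarrow>
           (\<exists>t s' scc'. exec reduce s t s' \<and> t \<le> T_red n \<and>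
              sensing_instance m n A c scc' \<and> stores_assignment m c scc' s')) \<and>
        (\<forall>m n A c scc s. sensing_instance m n A c scc \<and> stores_assignment m c scc s \<longrightarrow>
           (\<exists>t s'. exec assign s t s' \<and> t \<le> T_asg m \<and>
              optimal_assignment m (scc_cost m c scc) (stored_assignment m s') \<and>
              induced_sensing m n c scc (stored_assignment m s') (stored_placement m n s') \<and>
              optimal_sensing m n A c (stored_placement m n s'))))"
    (is "?L \<and> ?R")
proof (intro conjI)
  show "\<forall>m n A c scc. sensing_instance m n A c scc \<longrightarrow>
        (\<exists>H Z. optimal_sensing m n A c H \<and> optimal_assignment m (scc_cost m c scc) Z \<and>
               total_cost c H = total_cost (scc_cost m c scc) Z) \<and>
        (\<forall>Z. optimal_assignment m (scc_cost m c scc) Z \<longrightarrow>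
               (\<exists>H. induced_sensing m n c scc Z H) \<and>
               (\<forall>H. induced_sensing m n c scc Z H \<longrightarrow> optimal_sensing m n A c H))"
  proof (intro allI impI)
    fix m n A c scc assume "sensing_instance m n A c scc"
    then interpret sensing m n A c scc by unfold_locales
    have ex: "\<exists>H. induced_sensing m n c scc Z H" if "optimal_assignment m C Z" for Z
      using that ex_induced_sensing unfolding optimal_assignment_def is_arg_min_def by blast
    obtain Z where Z: "optimal_assignment m C Z" using ex_optimal_assignment by blast
    obtain H where H: "induced_sensing m n c scc Z H" using ex[OF Z] by blast
    show "(\<exists>H Z. optimal_sensing m n A c H \<and> optimal_assignment m C Z \<and> total_cost c H = total_cost C Z) \<and>
      (\<forall>Z. optimal_assignment m C Z \<longrightarrow> (\<exists>H. induced_sensing m n c scc Z H) \<and>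
         (\<forall>H. induced_sensing m n c scc Z H \<longrightarrow> optimal_sensing m n A c H))"
      using induced_sensing_optimal[OF Z H] Z ex induced_sensing_optimal(1) by blast
  qed
next
  have red: "(\<lambda>n. real (cost reduce_program n)) \<in> O(\<lambda>n. real n ^ 3)"
    using cost_bigo[of reduce_program 0] by (simp add: depth_reduce_program)
  have asg: "(\<lambda>m. real (cost assign_program (m + 1))) \<in> O(\<lambda>m. real m ^ 3)"
    using cost_bigo[of assign_program 1] by (simp only: depth_assign_program)
  show ?R
    by (rule exI[of _ reduce_program], rule exI[of _ assign_program], rule exI[of _ "cost reduce_program"],
        rule exI[of _ "\<lambda>m. cost assign_program (m + 1)"], rule exI[of _ 3], intro conjI allI impI)
      (rule red, rule asg, (elim conjE, rule exec_reduce_program; assumption),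
        (elim conjE, rule exec_assign_program; assumption))
qed

end
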